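(* Let $n\ge 1$. Let $q\in[1,\infty)$, $c\in(0,\infty]$, $\mathbf{B}=(\beta_0,\beta_\infty)\in\mathbb{R}^2$ be such that either $q=c=1$ and $\mathbf{B}=(0,0)$, or $1<q<\infty$ and $0<c\le\infty$ (with $\mathbf{B}\in\mathbb{R}^2$ arbitrary). Let $-\infty<\sigma<\infty$, $\mathbf{\Gamma}=(\gamma_0,\gamma_\infty)\in\mathbb{R}^2$ and $0<u\le\infty$. Let $p,b\in(0,\infty]$ and $\mathbf{A}=(\alpha_0,\alpha_\infty)\in\mathbb{R}^2$ be such that either $q<p<\infty$ (and $0<b\le\infty$), or $p=b=\infty$ and $\mathbf{A}=(0,0)$. Then $$\dot B_{(q,c;\mathbf{B}),u}^{\sigma+n\left(\frac1q-\frac1p\right),\,\mathbf{\Gamma}+(\overleftarrow{\mathbf{A}}-\overleftarrow{\mathbf{B}})}\subset\dot B_{(p,b;\mathbf{A}),u}^{\sigma,\mathbf{\Gamma}}.$$ In particular, for $1\le q<p\le\infty$, $$\dot B_{q,u}^{\sigma+n\left(\frac1q-\frac1p\right),\mathbf{\Gamma}}\subset\dot B_{p,u}^{\sigma,\mathbf{\Gamma}}.$$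
   Context: Convention: $1/\infty=0$. For a pair $\mathbf{A}=(\alpha_0,\alpha_\infty)\in\mathbb{R}^2$ put $\overleftarrow{\mathbf{A}}=(\alpha_\infty,\alpha_0)$; pairs are added and subtracted componentwise. The broken-logarithmic function is $l^{\mathbf{A}}(t)=(1+|\ln t|)^{\alpha_0}$ for $0<t\le 1$ and $l^{\mathbf{A}}(t)=(1+|\ln t|)^{\alpha_\infty}$ for $t>1$. For a complex-valued measurable $f$ on $\mathbb{R}^n$, $f^*$ is its non-increasing rearrangement. For $0<p,b\le\infty$, the Lorentz–Zygmund space $L_{p,b;\mathbf{A}}=L_{p,b;\mathbf{A}}(\mathbb{R}^n)$ consists of all measurable $f$ with $\|f\|_{p,b;\mathbf{A}}:=\left\|t^{\frac1p-\frac1b}l^{\mathbf{A}}(t)f^*(t)\right\|_{L_b(0,\infty)}<\infty$. $S$ and $S'$ are the Schwartz space and the space of tempered distributions on $\mathbb{R}^n$; $\mathcal{F}$ is the Fourier transform, $\mathcal{F}f(\xi)=\int e^{-2\pi i x\xi}f(x)\,dx$, extended to $S'$. Fix $\varphi\in S$ with $\operatorname{supp}\varphi=\{\xi:2^{-1}\le|\xi|\le2\}$, $\varphi(\xi)>0$ for $2^{-1}<|\xi|<2$, and $\sum_{k=-\infty}^\infty\varphi(2^{-k}\xi)=1$ for $\xi\ne0$. Put $\varphi_k(\xi)=\varphi(2^{-k}\xi)$ ($k\in\mathbb{Z}$). For $\sigma\in\mathbb{R}$, $0<p,b,u\le\infty$, $\mathbf{A},\mathbf{\Gamma}\in\mathbb{R}^2$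 with $L_{p,b;\mathbf{A}}\neq\{0\}$, the homogeneous Besov-type space $\dot B^{\sigma,\mathbf{\Gamma}}_{(p,b;\mathbf{A}),u}$ consists of all $f\in S'$ with finite semi-(quasi-)norm $$\|f\|_{\dot B^{\sigma,\mathbf{\Gamma}}_{(p,b;\mathbf{A}),u}}=\left\{\sum_{k=-\infty}^\infty\left(2^{\sigma k}l^{\mathbf{\Gamma}}(2^k)\|\mathcal{F}^{-1}(\varphi_k\mathcal{F}f)\|_{p,b;\mathbf{A}}\right)^u\right\}^{1/u}$$ (supremum over $k\in\mathbb{Z}$ if $u=\infty$). Write $\dot B^{\sigma,\mathbf{\Gamma}}_{p,u}:=\dot B^{\sigma,\mathbf{\Gamma}}_{(p,p;(0,0)),u}$. $X\subset Y$ means continuous embedding: every $f\in X$ is in $Y$ and $\|f\|_Y\le C\|f\|_X$ with $C$ independent of $f$. *)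

theory Defs
  imports "HOL-Analysis.Analysis" "HOL-Probability.Essential_Supremum"
begin

text \<open>
  Exponents in \<open>(0,\<infinity>]\<close> are \<^typ>\<open>ennreal\<close>s; since \<open>inverse \<infinity> = 0\<close> there, \<open>recip\<close> implements the
  convention \<open>1/\<infinity> = 0\<close>.
\<close>

definition recip :: "ennreal \<Rightarrow> real" where
  "recip p = enn2real (inverse p)"

text \<open>Real powers on \<open>[0,\<infinity>]\<close>; only meaningful (and only used) for exponents \<open>r > 0\<close>.\<close>

definition epowr :: "ennreal \<Rightarrow> real \<Rightarrow> ennreal" where
  "epowr x r = (if x = \<infinity> then \<infinity> else ennreal (enn2real x powr r))"


subsection \<open>Lorentz--Zygmund spaces\<close>

text \<open>A pair \<open>(\<alpha>\<^sub>0, \<alpha>\<^sub>\<infinity>)\<close> is an element of \<^typ>\<open>real \<times> real\<close>; its reversal is \<^const>\<open>prod.swap\<close>.\<close>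

definition blog :: "real \<times> real \<Rightarrow> real \<Rightarrow> real" where
  "blog A t = (1 + \<bar>ln t\<bar>) powr (if t \<le> 1 then fst A else snd A)"

definition rearr :: "('a::euclidean_space \<Rightarrow> complex) \<Rightarrow> real \<Rightarrow> ennreal" where
  "rearr f t = Inf {s. emeasure lebesgue {x. s < ennreal (norm (f x))} \<le> ennreal t}"

definition Lb_norm :: "ennreal \<Rightarrow> (real \<Rightarrow> ennreal) \<Rightarrow> ennreal" where
  "Lb_norm b h =
    (if b = \<infinity> then esssup (restrict_space lborel {0<..}) h
     else epowr (\<integral>\<^sup>+t\<in>{0<..}. epowr (h t) (enn2real b) \<partial>lborel) (recip b))"

definition lz_norm ::
    "ennreal \<Rightarrow> ennreal \<Rightarrow> real \<times> real \<Rightarrow> ('a::euclidean_space \<Rightarrow> complex) \<Rightarrow> ennreal" where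
  "lz_norm p b A f =
    Lb_norm b (\<lambda>t. ennreal (t powr (recip p - recip b) * blog A t) * rearr f t)"


subsection \<open>Schwartz functions and tempered distributions\<close>

text \<open>
  A list of basis vectors plays the role of a multi-index; \<open>iter_deriv\<close> is the corresponding
  iterated partial derivative.
\<close>

fun iter_deriv :: "'a::euclidean_space list \<Rightarrow> ('a \<Rightarrow> complex) \<Rightarrow> 'a \<Rightarrow> complex" where
  "iter_deriv [] f = f"
| "iter_deriv (v # vs) f = (\<lambda>x. frechet_derivative (iter_deriv vs f) (at x) v)"

definition schwartz :: "('a::euclidean_space \<Rightarrow> complex) set" where
  "schwartz = {f. \<forall>vs \<in> lists Basis.
      (\<forall>x. iter_deriv vs f differentiable (at x)) \<and>
      (\<forall>N::nat. bounded (range (\<lambda>x. (1 + norm x) ^ N * norm (iter_deriv vs f x))))}"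

definition schwartz_seminorm :: "nat \<Rightarrow> 'a::euclidean_space list \<Rightarrow> ('a \<Rightarrow> complex) \<Rightarrow> real" where
  "schwartz_seminorm N vs f = (SUP x. (1 + norm x) ^ N * norm (iter_deriv vs f x))"

text \<open>
  Distributions are functionals on all of \<^typ>\<open>'a \<Rightarrow> complex\<close>, but only their values on \<^const>\<open>schwartz\<close>
  are ever constrained or used. Continuity for the topology generated by the seminorms is
  domination by finitely many of them.
\<close>

type_synonym 'a distr = "('a \<Rightarrow> complex) \<Rightarrow> complex"

definition tempered :: "'a::euclidean_space distr set" where
  "tempered = {T.
      (\<forall>f\<in>schwartz. \<forall>g\<in>schwartz. T (\<lambda>x. f x + g x) = T f + T g) \<and>
      (\<forall>c. \<forall>f\<in>schwartz. T (\<lambda>x. c * f x) = c * T f) \<and>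
      (\<exists>C N. \<forall>f\<in>schwartz.
         norm (T f) \<le> C * (\<Sum>vs | vs \<in> lists Basis \<and> length vs \<le> N. schwartz_seminorm N vs f))}"

definition fourier :: "('a::euclidean_space \<Rightarrow> complex) \<Rightarrow> 'a \<Rightarrow> complex" where
  "fourier f \<xi> = (\<integral>x. cis (- 2 * pi * (x \<bullet> \<xi>)) * f x \<partial>lborel)"

definition inv_fourier :: "('a::euclidean_space \<Rightarrow> complex) \<Rightarrow> 'a \<Rightarrow> complex" where
  "inv_fourier f x = (\<integral>\<xi>. cis (2 * pi * (x \<bullet> \<xi>)) * f \<xi> \<partial>lborel)"

definition fourier_distr :: "'a::euclidean_space distr \<Rightarrow> 'a distr" where
  "fourier_distr T = (\<lambda>\<psi>. T (fourier \<psi>))"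

definition inv_fourier_distr :: "'a::euclidean_space distr \<Rightarrow> 'a distr" where
  "inv_fourier_distr T = (\<lambda>\<psi>. T (inv_fourier \<psi>))"

definition mult_distr :: "('a::euclidean_space \<Rightarrow> complex) \<Rightarrow> 'a distr \<Rightarrow> 'a distr" where
  "mult_distr g T = (\<lambda>\<psi>. T (\<lambda>x. g x * \<psi> x))"

definition represents :: "('a::euclidean_space \<Rightarrow> complex) \<Rightarrow> 'a distr \<Rightarrow> bool" where
  "represents g T \<longleftrightarrow> g \<in> borel_measurable lebesgue \<and>
     (\<forall>\<psi>\<in>schwartz. integrable lebesgue (\<lambda>x. g x * \<psi> x) \<and>
                  T \<psi> = (\<integral>x. g x * \<psi> x \<partial>lebesgue))"

text \<open>
  The norm of a distribution given by a function. All representing functions agree almost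
  everywhere and so have the same norm; the infimum just selects this value, and is \<open>\<infinity>\<close> if the
  distribution is not given by a function.
\<close>

definition lz_norm_distr ::
    "ennreal \<Rightarrow> ennreal \<Rightarrow> real \<times> real \<Rightarrow> 'a::euclidean_space distr \<Rightarrow> ennreal" where
  "lz_norm_distr p b A T = (INF g\<in>{g. represents g T}. lz_norm p b A g)"


subsection \<open>Homogeneous Besov-type spaces\<close>

definition dyadic_resolution :: "('a::euclidean_space \<Rightarrow> complex) \<Rightarrow> bool" where
  "dyadic_resolution \<phi> \<longleftrightarrow>
     \<phi> \<in> schwartz \<and>
     closure {\<xi>. \<phi> \<xi> \<noteq> 0} = {\<xi>. 1 / 2 \<le> norm \<xi> \<and> norm \<xi> \<le> 2} \<and>
     (\<forall>\<xi>. 1 / 2 < norm \<xi> \<and> norm \<xi> < 2 \<longrightarrow> \<phi> \<xi> \<in> \<real> \<and> 0 < Re (\<phi> \<xi>)) \<and>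
     (\<forall>\<xi>. \<xi> \<noteq> 0 \<longrightarrow> ((\<lambda>k::int. \<phi> ((2 powi (- k)) *\<^sub>R \<xi>)) has_sum 1) UNIV)"

definition dyadic_block ::
    "('a::euclidean_space \<Rightarrow> complex) \<Rightarrow> int \<Rightarrow> 'a distr \<Rightarrow> 'a distr" where
  "dyadic_block \<phi> k f =
     inv_fourier_distr (mult_distr (\<lambda>\<xi>. \<phi> ((2 powi (- k)) *\<^sub>R \<xi>)) (fourier_distr f))"

text \<open>Arguments: \<open>\<phi>\<close>, the smoothness \<open>\<sigma>\<close> and \<open>\<Gamma>\<close>, the base space \<open>p, b, A\<close>, and \<open>u\<close>.\<close>

definition besov_norm ::
    "('a::euclidean_space \<Rightarrow> complex) \<Rightarrow> real \<Rightarrow> real \<times> real \<Rightarrow>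
     ennreal \<Rightarrow> ennreal \<Rightarrow> real \<times> real \<Rightarrow> ennreal \<Rightarrow> 'a distr \<Rightarrow> ennreal" where
  "besov_norm \<phi> \<sigma> \<Gamma> p b A u f =
    (let a = (\<lambda>k::int. ennreal (2 powr (\<sigma> * of_int k) * blog \<Gamma> (2 powi k))
                          * lz_norm_distr p b A (dyadic_block \<phi> k f))
     in if u = \<infinity> then (SUP k. a k)
        else epowr (\<Sum>\<^sub>\<infinity>k. epowr (a k) (enn2real u)) (recip u))"

definition besov_space ::
    "('a::euclidean_space \<Rightarrow> complex) \<Rightarrow> real \<Rightarrow> real \<times> real \<Rightarrow>
     ennreal \<Rightarrow> ennreal \<Rightarrow> real \<times> real \<Rightarrow> ennreal \<Rightarrow> 'a distr set" where
  "besov_space \<phi> \<sigma> \<Gamma> p b A u = {f \<in> tempered. besov_norm \<phi> \<sigma> \<Gamma> p b A u f < \<infinity>}"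

definition besov_embedding ::
    "('a::euclidean_space \<Rightarrow> complex) \<Rightarrow>
     real \<Rightarrow> real \<times> real \<Rightarrow> ennreal \<Rightarrow> ennreal \<Rightarrow> real \<times> real \<Rightarrow> ennreal \<Rightarrow>
     real \<Rightarrow> real \<times> real \<Rightarrow> ennreal \<Rightarrow> ennreal \<Rightarrow> real \<times> real \<Rightarrow> ennreal \<Rightarrow> bool" where
  "besov_embedding \<phi> \<sigma>1 \<Gamma>1 p1 b1 A1 u1 \<sigma>2 \<Gamma>2 p2 b2 A2 u2 \<longleftrightarrow>
    (\<exists>C::real. \<forall>f \<in> besov_space \<phi> \<sigma>1 \<Gamma>1 p1 b1 A1 u1.
        f \<in> besov_space \<phi> \<sigma>2 \<Gamma>2 p2 b2 A2 u2 \<and>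
        besov_norm \<phi> \<sigma>2 \<Gamma>2 p2 b2 A2 u2 f \<le> ennreal C * besov_norm \<phi> \<sigma>1 \<Gamma>1 p1 b1 A1 u1 f)"

end

theory Submission
  imports Defs "HOL-Probability.Characteristic_Functions" "HOL-Probability.Sinc_Integral"
begin

text \<open>
  The embedding is a Nikol'skii inequality for each dyadic block \<open>f\<^sub>k\<close>, uniform in \<open>k\<close>. Let \<open>\<Phi>\<close> be a
  finite sum of dilates of \<open>\<phi>\<close> that is \<open>1\<close> on the support of \<open>\<phi>\<close>. Fourier inversion gives
  \<open>f\<^sub>k = K\<^sub>k * f\<^sub>k\<close>, where \<open>K\<^sub>k\<close> is the \<open>L\<^sub>1\<close>-normalised dilate of the Fourier transform of \<open>\<Phi>\<close>; with
  \<open>T = 2 powr (- k n)\<close>, both \<open>T * sup \<bar>K\<^sub>k\<bar>\<close> and the \<open>L\<^sub>1\<close> norm of \<open>K\<^sub>k\<close> are bounded independently of \<open>k\<close>.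
  Cutting \<open>f\<^sub>k\<close> at the height of its rearrangement yields
  \<open>f\<^sub>k\<^sup>*(t) \<le> C f\<^sub>k\<^sup>*\<^sup>*(max t T)\<close>, where \<open>g\<^sup>*\<^sup>*(t)\<close> is the mean of \<open>g\<^sup>*\<close> over \<open>(0, t)\<close>. The \<open>(q, c; B)\<close> norm
  controls \<open>t powr (1/q) * blog B t * f\<^sub>k\<^sup>*\<^sup>*(t)\<close>, and the \<open>(p, b; A)\<close> norm of the resulting majorant is
  computed from the slow variation of the logarithmic weights.
\<close>

subsection \<open>Powers and logarithmic weights\<close>

text \<open>Below the scale \<open>T\<close> the majorant of the rearrangement is constant; beyond
  \<open>T\<close> only the decay \<open>t powr (- 1/q)\<close>, up to logarithms, is known. In the
  target norm the constant part converges at \<open>0\<close> because \<open>1/p > 0\<close> and the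
  tail because \<open>1/p < 1/q\<close>, so the value at \<open>t = T\<close> decides:
  \<open>T powr (1/p - 1/q)\<close> is the difference in smoothness, and the weights are read at
  \<open>T\<close>, on the other side of \<open>1\<close> from \<open>2 powi k\<close>, which swaps
  the entries of the pairs. The average \<open>g\<^sup>*\<^sup>*\<close> enters since the part of
  \<open>g\<close> above the cut is known only through its integral. Passing to it from
  \<open>g\<^sup>*\<close> is Hardy's inequality and needs \<open>1/q < 1\<close>; at
  \<open>q = 1\<close> the unweighted \<open>L\<^sub>1\<close> norm bounds the integral directly. A
  block is given only as a functional, so the reproducing identity is proved on test functions. This
  needs the convolution of a decaying kernel with a Schwartz function to be Schwartz, and inversion
  for a function that is merely continuous, bounded and integrable with integrable
  transform.\<close>

lemma recip_ennreal: "0 < r \<Longrightarrow> recip (ennreal r) = 1 / r"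
  by (simp add: recip_def inverse_ennreal inverse_eq_divide)

lemma recip_top [simp]: "recip top = 0"
  by (simp add: recip_def)

lemma epowr_mono: "x \<le> y \<Longrightarrow> 0 \<le> r \<Longrightarrow> epowr x r \<le> epowr y r"
  by (auto simp: epowr_def top_unique less_top intro!: ennreal_leI powr_mono2 enn2real_mono)

lemma epowr_cmult:
  assumes "0 < c"
  shows "epowr (ennreal c * x) r = ennreal (c powr r) * epowr x r"
proof (cases x)
  case (real y)
  then show ?thesis using assms
    by (simp add: epowr_def ennreal_mult_eq_top_iff powr_mult flip: ennreal_mult')
next
  case top
  then show ?thesis using assms
    by (simp add: epowr_def ennreal_mult_eq_top_iff ennreal_mult_top)
qed

lemma epowr_epowr:
  assumes "0 < r"
  shows "epowr (epowr x r) (1 / r) = x"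
  using assms by (cases x) (auto simp: epowr_def powr_powr)

lemma epowr_measurable [measurable]: "(\<lambda>x. epowr x r) \<in> borel_measurable borel"
  unfolding epowr_def by measurable

lemma blog_pos: "0 < blog A t"
  by (auto simp: blog_def intro!: powr_gt_zero[THEN iffD2])

lemma blog_measurable [measurable]: "blog A \<in> borel_measurable borel"
  unfolding blog_def by measurable

lemma blog_add: "blog (A + B) t = blog A t * blog B t"
  by (simp add: blog_def powr_add)

lemma blog_diff: "blog (A - B) t = blog A t / blog B t"
  by (simp add: blog_def powr_diff)

lemma blog_zero [simp]: "blog (0, 0) t = 1"
  using abs_ge_zero[of "ln t"] unfolding blog_def by (smt (verit) fst_conv powr_zero_eq_one snd_conv)

text \<open>A one-variable form of Peetre's inequality: \<open>1 + a\<close> and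
  \<open>1 + b\<close> exceed each other by at most the factor \<open>1 + \<bar>a - b\<bar>\<close>.
  A negative exponent uses the bound with \<open>a\<close> and \<open>b\<close> exchanged, hence
  \<open>\<bar>\<alpha>\<bar>\<close> on the right.\<close>

lemma powr_one_plus_shift:
  fixes a b :: real
  assumes "0 \<le> a" "0 \<le> b"
  shows "(1 + a) powr \<alpha> \<le> (1 + \<bar>a - b\<bar>) powr \<bar>\<alpha>\<bar> * (1 + b) powr \<alpha>"
proof -
  have ab: "1 + a \<le> (1 + \<bar>a - b\<bar>) * (1 + b)" and ba: "1 + b \<le> (1 + \<bar>a - b\<bar>) * (1 + a)"
    using assms mult_nonneg_nonneg[OF abs_ge_zero[of "a - b"] assms(1)]
      mult_nonneg_nonneg[OF abs_ge_zero[of "a - b"] assms(2)]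
      abs_ge_self[of "a - b"] abs_ge_minus_self[of "a - b"]
    by (simp_all only: distrib_left distrib_right mult_1_left mult_1_right)
  show ?thesis
  proof (cases "0 \<le> \<alpha>")
    case True
    have "(1 + a) powr \<alpha> \<le> ((1 + \<bar>a - b\<bar>) * (1 + b)) powr \<alpha>"
      using assms True ab by (intro powr_mono2) auto
    then show ?thesis using True assms by (simp add: powr_mult)
  next
    case False
    have "(1 + b) powr \<bar>\<alpha>\<bar> \<le> ((1 + \<bar>a - b\<bar>) * (1 + a)) powr \<bar>\<alpha>\<bar>"
      using assms ba by (intro powr_mono2) auto
    then have "(1 + b) powr \<bar>\<alpha>\<bar> \<le> (1 + \<bar>a - b\<bar>) powr \<bar>\<alpha>\<bar> * (1 + a) powr \<bar>\<alpha>\<bar>"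
      using assms by (simp add: powr_mult)
    moreover have eq: "(1 + a) powr \<alpha> = inverse ((1 + a) powr \<bar>\<alpha>\<bar>)" "(1 + b) powr \<alpha> = inverse ((1 + b) powr \<bar>\<alpha>\<bar>)"
      using False by (simp_all add: powr_minus[symmetric])
    moreover have "0 < (1 + a) powr \<bar>\<alpha>\<bar>" "0 < (1 + b) powr \<bar>\<alpha>\<bar>" using assms by auto
    ultimately show ?thesis unfolding eq
      by (metis (no_types, opaque_lifting) divide_inverse inverse_eq_divide mult.commute mult_imp_div_pos_le
          mult_1 pos_le_divide_eq times_divide_eq_right)
  qed
qed

text \<open>If \<open>s\<close> and \<open>t\<close> lie on the same side of \<open>1\<close>, the
  exponents agree and Peetre's inequality applies. On opposite sides the exponents are unrelated,
  but the logarithms then have opposite signs or vanish, so both are at most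
  \<open>\<bar>ln t - ln s\<bar>\<close> in modulus; each weight is compared with \<open>1\<close>
  separately, which accounts for the factor 2 in the exponent.\<close>

lemma blog_ratio_le:
  assumes "0 < s" "0 < t"
  shows "blog A t \<le> (1 + \<bar>ln t - ln s\<bar>) powr (2 * (\<bar>fst A\<bar> + \<bar>snd A\<bar>)) * blog A s"
proof -
  define d where "d = \<bar>ln t - ln s\<bar>"
  define M where "M = \<bar>fst A\<bar> + \<bar>snd A\<bar>"
  have same: "(1 + \<bar>ln t\<bar>) powr \<alpha> \<le> (1 + d) powr (2 * M) * (1 + \<bar>ln s\<bar>) powr \<alpha>"
    if "\<bar>\<alpha>\<bar> \<le> M" for \<alpha>
  proof -
    have "(1 + \<bar>ln t\<bar>) powr \<alpha> \<le> (1 + \<bar>\<bar>ln t\<bar> - \<bar>ln s\<bar>\<bar>) powr \<bar>\<alpha>\<bar> * (1 + \<bar>ln s\<bar>) powr \<alpha>"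
      by (rule powr_one_plus_shift) auto
    also have "\<dots> \<le> (1 + d) powr \<bar>\<alpha>\<bar> * (1 + \<bar>ln s\<bar>) powr \<alpha>"
      by (intro mult_right_mono powr_mono2) (auto simp: d_def)
    also have "\<dots> \<le> (1 + d) powr (2 * M) * (1 + \<bar>ln s\<bar>) powr \<alpha>"
      using that by (intro mult_right_mono powr_mono) (auto simp: d_def)
    finally show ?thesis .
  qed
  have opp: "(1 + \<bar>ln t\<bar>) powr \<alpha> \<le> (1 + d) powr (2 * M) * (1 + \<bar>ln s\<bar>) powr \<beta>"
    if "\<bar>\<alpha>\<bar> \<le> M" "\<bar>\<beta>\<bar> \<le> M" "\<bar>ln t\<bar> \<le> d" "\<bar>ln s\<bar> \<le> d" for \<alpha> \<beta>
  proof -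
    have "(1 + \<bar>ln t\<bar>) powr \<alpha> \<le> (1 + \<bar>ln t\<bar>) powr M"
      using that by (intro powr_mono) auto
    also have "\<dots> \<le> (1 + d) powr M"
      using that by (intro powr_mono2) (auto)
    finally have 1: "(1 + \<bar>ln t\<bar>) powr \<alpha> \<le> (1 + d) powr M" .
    have "1 = (1 + \<bar>ln s\<bar>) powr \<bar>\<beta>\<bar> * (1 + \<bar>ln s\<bar>) powr - \<bar>\<beta>\<bar>"
      by (simp add: powr_minus)
    also have "\<dots> \<le> (1 + d) powr M * (1 + \<bar>ln s\<bar>) powr \<beta>"
    proof (intro mult_mono)
      have "(1 + \<bar>ln s\<bar>) powr \<bar>\<beta>\<bar> \<le> (1 + \<bar>ln s\<bar>) powr M"
        using that by (intro powr_mono) auto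
      also have "\<dots> \<le> (1 + d) powr M"
        using that by (intro powr_mono2) (auto)
      finally show "(1 + \<bar>ln s\<bar>) powr \<bar>\<beta>\<bar> \<le> (1 + d) powr M" .
    qed (auto intro!: powr_mono)
    finally have "(1 + d) powr M * 1 \<le> (1 + d) powr M * ((1 + d) powr M * (1 + \<bar>ln s\<bar>) powr \<beta>)"
      by (intro mult_left_mono) auto
    with 1 have "(1 + \<bar>ln t\<bar>) powr \<alpha> \<le> (1 + d) powr M * ((1 + d) powr M * (1 + \<bar>ln s\<bar>) powr \<beta>)"
      by linarith
    then show ?thesis unfolding mult_2 powr_add mult.assoc .
  qed
  show ?thesis
  proof (cases "(t \<le> 1) = (s \<le> 1)")
    case True
    then show ?thesis
      unfolding blog_def d_def[symmetric] M_def[symmetric]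
      using same by (auto simp: M_def)
  next
    case False
    then have "\<bar>ln t\<bar> \<le> d" "\<bar>ln s\<bar> \<le> d"
      unfolding d_def using assms
      by (auto simp: abs_if not_less not_le)
    then show ?thesis
      unfolding blog_def d_def[symmetric] M_def[symmetric]
      using opp by (auto simp: M_def)
  qed
qed

text \<open>Potter's bounds for slowly varying functions: by \<open>blog_ratio_le\<close> the
  quotient of two weights grows at most like a power of one plus the logarithm of
  \<open>t / s\<close>, and every positive power of \<open>t / s\<close> absorbs this.\<close>

lemma blog_potter:
  assumes "0 < \<epsilon>"
  obtains C where "1 \<le> C"
    and "\<And>s t. 0 < s \<Longrightarrow> s \<le> t \<Longrightarrow> blog A t \<le> C * (t / s) powr \<epsilon> * blog A s"
    and "\<And>s t. 0 < s \<Longrightarrow> s \<le> t \<Longrightarrow> blog A s \<le> C * (t / s) powr \<epsilon> * blog A t"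
proof -
  define M where "M = 2 * (\<bar>fst A\<bar> + \<bar>snd A\<bar>)"
  \<comment> \<open>Then \<open>\<delta> * M \<le> \<epsilon>\<close>, so the \<open>M\<close>-th
    power of \<open>exp (\<delta> * d)\<close> stays below \<open>exp (\<epsilon> * d)\<close>; the
    added 1 covers \<open>M = 0\<close>.\<close>
  define \<delta> where "\<delta> = \<epsilon> / (M + 1)"
  have M: "0 \<le> M" by (simp add: M_def)
  have \<delta>: "0 < \<delta>" "\<delta> * M \<le> \<epsilon>" using assms M by (auto simp: \<delta>_def field_simps)
  define C where "C = (1 + 1 / \<delta>) powr M"
  have C: "1 \<le> C" unfolding C_def using \<delta> M by (intro ge_one_powr_ge_zero) auto
  have key: "(1 + d) powr M \<le> C * exp (\<epsilon> * d)" if "0 \<le> d" for d :: real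
  proof -
    have "1 + d \<le> (1 + 1 / \<delta>) * (1 + \<delta> * d)"
      using \<delta> that by (simp add: field_simps)
    also have "\<dots> \<le> (1 + 1 / \<delta>) * exp (\<delta> * d)"
      using \<delta> exp_ge_add_one_self[of "\<delta> * d"] by (intro mult_left_mono) auto
    finally have "(1 + d) powr M \<le> ((1 + 1 / \<delta>) * exp (\<delta> * d)) powr M"
      using that M by (intro powr_mono2) auto
    also have "\<dots> = C * exp (\<delta> * M * d)"
      using \<delta> by (simp add: C_def powr_mult exp_powr_real mult_ac)
    also have "\<dots> \<le> C * exp (\<epsilon> * d)"
      using C mult_right_mono[OF \<delta>(2) that] by (intro mult_left_mono) auto
    finally show ?thesis .
  qed
  have le: "blog A t \<le> C * exp (\<epsilon> * \<bar>ln t - ln s\<bar>) * blog A s" if "0 < s" "0 < t" for s t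
  proof -
    have "blog A t \<le> (1 + \<bar>ln t - ln s\<bar>) powr M * blog A s"
      unfolding M_def by (rule blog_ratio_le[OF that])
    also have "\<dots> \<le> C * exp (\<epsilon> * \<bar>ln t - ln s\<bar>) * blog A s"
      using blog_pos[of A s] by (intro mult_right_mono key) auto
    finally show ?thesis .
  qed
  have ex: "exp (\<epsilon> * \<bar>ln t - ln s\<bar>) = (t / s) powr \<epsilon>" "exp (\<epsilon> * \<bar>ln s - ln t\<bar>) = (t / s) powr \<epsilon>"
    if "0 < s" "s \<le> t" for s t :: real
  proof -
    have "ln s \<le> ln t" using that by simp
    then have "\<bar>ln t - ln s\<bar> = ln t - ln s" "\<bar>ln s - ln t\<bar> = ln t - ln s" by auto
    then show "exp (\<epsilon> * \<bar>ln t - ln s\<bar>) = (t / s) powr \<epsilon>" "exp (\<epsilon> * \<bar>ln s - ln t\<bar>) = (t / s) powr \<epsilon>"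
      using that by (simp_all add: powr_def ln_div)
  qed
  show ?thesis
  proof (rule that[OF C])
    fix s t :: real assume "0 < s" "s \<le> t"
    then show "blog A t \<le> C * (t / s) powr \<epsilon> * blog A s" "blog A s \<le> C * (t / s) powr \<epsilon> * blog A t"
      using le[of s t] le[of t s] ex[of s t] by auto
  qed
qed

subsection \<open>Rearrangements\<close>

lemma lebesgue_level_set:
  fixes g :: "'a::euclidean_space \<Rightarrow> complex"
  assumes [measurable]: "g \<in> borel_measurable borel"
  shows "emeasure lebesgue {x. s < ennreal (norm (g x))} = emeasure lborel {x. s < ennreal (norm (g x))}"
proof -
  have "{x. s < ennreal (norm (g x))} \<in> sets lborel" by simp
  then show ?thesis by (simp add: main_part_sets)
qed

lemma less_rearr_iff:
  fixes g :: "'a::euclidean_space \<Rightarrow> complex"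
  assumes [measurable]: "g \<in> borel_measurable borel"
  shows "s < rearr g t \<longleftrightarrow> ennreal t < emeasure lborel {x. s < ennreal (norm (g x))}"
proof
  assume "s < rearr g t"
  then show "ennreal t < emeasure lborel {x. s < ennreal (norm (g x))}"
    unfolding rearr_def lebesgue_level_set[OF assms]
    by (metis (no_types, lifting) Inf_lower leD le_less_linear mem_Collect_eq)
next
  assume t: "ennreal t < emeasure lborel {x. s < ennreal (norm (g x))}"
  have s: "s \<noteq> \<infinity>" using t by (auto)
  define A where "A n = {x. s + ennreal (1 / Suc n) < ennreal (norm (g x))}" for n
  have "(\<Union>n. A n) = {x. s < ennreal (norm (g x))}"
  proof (intro set_eqI iffI)
    fix x assume "x \<in> (\<Union>n. A n)"
    then show "x \<in> {x. s < ennreal (norm (g x))}"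
      unfolding A_def by (auto intro: le_less_trans[OF add_increasing2[OF zero_le order_refl]])
  next
    fix x assume x: "x \<in> {x. s < ennreal (norm (g x))}"
    obtain r where r: "s = ennreal r" "0 \<le> r" using s by (cases s) auto
    then have "r < norm (g x)" using x by (simp add: ennreal_less_iff)
    then obtain n where "1 / Suc n < norm (g x) - r"
      using reals_Archimedean[of "norm (g x) - r"] by (auto simp: inverse_eq_divide)
    then have "x \<in> A n"
      using r by (simp add: A_def ennreal_plus[symmetric] ennreal_less_iff del: ennreal_plus)
    then show "x \<in> (\<Union>n. A n)" by blast
  qed
  moreover have "incseq A"
  proof (rule incseq_SucI, unfold A_def, safe)
    fix n x assume "s + ennreal (1 / Suc n) < ennreal (norm (g x))"
    moreover have "s + ennreal (1 / Suc (Suc n)) \<le> s + ennreal (1 / Suc n)"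
      by (intro add_left_mono ennreal_leI) (simp add: field_simps)
    ultimately show "s + ennreal (1 / Suc (Suc n)) < ennreal (norm (g x))" by (rule le_less_trans[rotated])
  qed
  moreover have "range A \<subseteq> sets lborel" unfolding A_def by auto
  ultimately have "(SUP n. emeasure lborel (A n)) = emeasure lborel {x. s < ennreal (norm (g x))}"
    using SUP_emeasure_incseq[of A lborel] by simp
  then obtain n where n: "ennreal t < emeasure lborel (A n)"
    using t by (metis less_SUP_iff)
  have "s + ennreal (1 / Suc n) \<le> rearr g t"
    unfolding rearr_def lebesgue_level_set[OF assms]
  proof (rule Inf_greatest, safe, rule ccontr)
    fix r assume r: "emeasure lborel {x. r < ennreal (norm (g x))} \<le> ennreal t"
      "\<not> s + ennreal (1 / Suc n) \<le> r"
    have "emeasure lborel (A n) \<le> emeasure lborel {x. r < ennreal (norm (g x))}"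
      using r(2) by (intro emeasure_mono) (auto simp: A_def)
    with n r(1) show False by (meson leD order_trans)
  qed
  moreover have "s < s + ennreal (1 / Suc n)"
    using s by (cases s) (auto simp: ennreal_plus[symmetric] ennreal_less_iff simp del: ennreal_plus)
  ultimately show "s < rearr g t" by (rule less_le_trans[rotated])
qed

lemma rearr_antimono: "s \<le> t \<Longrightarrow> rearr g t \<le> rearr g s"
  unfolding rearr_def by (rule Inf_superset_mono) (auto intro: order_trans ennreal_leI)

lemma rearr_measurable [measurable]:
  assumes "g \<in> borel_measurable borel"
  shows "rearr g \<in> borel_measurable borel"
proof (rule borel_measurableI_greater)
  fix y show "{x \<in> space borel. y < rearr g x} \<in> sets borel"
    unfolding less_rearr_iff[OF assms] by measurable
qed

text \<open>Fubini for the region below the graph, with \<open>f\<close> allowed to be infinite: the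
  positive reals below \<open>y\<close> form a set of length \<open>y\<close> for every
  \<open>y\<close> in \<open>[0, \<infinity>]\<close>.\<close>

lemma nn_integral_layer_cake:
  assumes "sigma_finite_measure M" and [measurable]: "f \<in> borel_measurable M"
  shows "(\<integral>\<^sup>+x. f x \<partial>M) = (\<integral>\<^sup>+s\<in>{0<..}. emeasure M {x\<in>space M. ennreal s < f x} \<partial>lborel)"
proof -
  interpret M: sigma_finite_measure M by fact
  interpret pair_sigma_finite M lborel ..
  have *: "emeasure lborel {s. 0 < s \<and> ennreal s < y} = y" for y
  proof (cases y)
    case (real r)
    then have "{s. 0 < s \<and> ennreal s < y} = {0<..<r}"
      by (auto simp: ennreal_less_iff)
    then show ?thesis using real by simp
  next
    case top
    have "emeasure lborel {0<..<real n} \<le> emeasure lborel {0::real<..}" for n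
      by (rule emeasure_mono) auto
    then have "of_nat n \<le> emeasure lborel {0::real<..}" for n
      by (simp add: ennreal_of_nat_eq_real_of_nat)
    then have "emeasure lborel {0::real<..} = \<infinity>"
      using ennreal_Ex_less_of_nat[of "emeasure lborel {0::real<..}"]
      by (auto simp: less_top[symmetric] not_less[symmetric])
    moreover have "{s. 0 < s \<and> ennreal s < y} = {0<..}" using top by auto
    ultimately show ?thesis using top by simp
  qed
  have "(\<integral>\<^sup>+x. f x \<partial>M) = (\<integral>\<^sup>+x. (\<integral>\<^sup>+s. indicator {s. 0 < s \<and> ennreal s < f x} s \<partial>lborel) \<partial>M)"
    by (simp add: *)
  also have "\<dots> = (\<integral>\<^sup>+s. (\<integral>\<^sup>+x. indicator {s. 0 < s \<and> ennreal s < f x} s \<partial>M) \<partial>lborel)"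
    by (rule Fubini'[symmetric]) simp
  also have "\<dots> = (\<integral>\<^sup>+s. (\<integral>\<^sup>+x. indicator {0<..} s * indicator {x\<in>space M. ennreal s < f x} x \<partial>M) \<partial>lborel)"
    by (intro nn_integral_cong) (auto split: split_indicator)
  also have "\<dots> = (\<integral>\<^sup>+s\<in>{0<..}. emeasure M {x\<in>space M. ennreal s < f x} \<partial>lborel)"
    by (intro nn_integral_cong) (simp add: nn_integral_cmult mult.commute)
  finally show ?thesis .
qed

text \<open>In layer-cake form both sides are integrals over levels \<open>s\<close>. On the left
  the level set lies in \<open>E\<close> and in the level set of \<open>g\<close>, so its measure is
  at most the minimum of \<open>t\<close> and the distribution function. On the right
  \<open>less_rearr_iff\<close> identifies the level set of \<open>rearr g\<close> on
  \<open>(0, t)\<close> as an interval of exactly that length.\<close>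

lemma hardy_littlewood:
  fixes g :: "'a::euclidean_space \<Rightarrow> complex"
  assumes [measurable]: "g \<in> borel_measurable borel" "E \<in> sets borel"
    and E: "emeasure lborel E \<le> ennreal t"
  shows "(\<integral>\<^sup>+x\<in>E. ennreal (norm (g x)) \<partial>lborel) \<le> (\<integral>\<^sup>+r\<in>{0<..<t}. rearr g r \<partial>lborel)"
proof -
  let ?L = "\<lambda>s::real. emeasure lborel {x. ennreal s < ennreal (norm (g x))}"
  have "(\<integral>\<^sup>+x\<in>E. ennreal (norm (g x)) \<partial>lborel)
      = (\<integral>\<^sup>+s\<in>{0<..}. emeasure lborel {x\<in>space lborel. ennreal s < ennreal (norm (g x)) * indicator E x} \<partial>lborel)"
    by (rule nn_integral_layer_cake) (auto intro: sigma_finite_lborel)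
  also have "\<dots> \<le> (\<integral>\<^sup>+s\<in>{0<..}. min (ennreal t) (?L s) \<partial>lborel)"
  proof (intro nn_integral_mono mult_right_mono)
    fix s :: real
    have "emeasure lborel {x\<in>space lborel. ennreal s < ennreal (norm (g x)) * indicator E x} \<le> emeasure lborel E"
      by (intro emeasure_mono) (auto split: split_indicator_asm)
    moreover have "emeasure lborel {x\<in>space lborel. ennreal s < ennreal (norm (g x)) * indicator E x} \<le> ?L s"
      by (intro emeasure_mono) (auto split: split_indicator_asm)
    ultimately show "emeasure lborel {x\<in>space lborel. ennreal s < ennreal (norm (g x)) * indicator E x}
      \<le> min (ennreal t) (?L s)" using E by auto
  qed simp
  also have "\<dots> \<le> (\<integral>\<^sup>+s\<in>{0<..}. emeasure lborel {r\<in>space lborel. ennreal s < rearr g r * indicator {0<..<t} r} \<partial>lborel)"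
  proof (intro nn_integral_mono mult_right_mono)
    fix s :: real
    have eq: "{r\<in>space lborel. ennreal s < rearr g r * indicator {0<..<t} r} = {r. 0 < r \<and> r < t \<and> ennreal r < ?L s}"
      by (auto simp: less_rearr_iff split: split_indicator_asm split_indicator)
    show "min (ennreal t) (?L s) \<le> emeasure lborel {r\<in>space lborel. ennreal s < rearr g r * indicator {0<..<t} r}"
      unfolding eq
    proof (cases "?L s")
      case (real l)
      then have "{r. 0 < r \<and> r < t \<and> ennreal r < ?L s} = {0<..<min t l}"
        by (auto simp: ennreal_less_iff)
      then show "min (ennreal t) (?L s) \<le> emeasure lborel {r. 0 < r \<and> r < t \<and> ennreal r < ?L s}"
        using real by (cases "0 \<le> t") (auto simp: min_def ennreal_neg ennreal_leI)
    next
      case top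
      then have "{r. 0 < r \<and> r < t \<and> ennreal r < ?L s} = {0<..<t}" by auto
      then show "min (ennreal t) (?L s) \<le> emeasure lborel {r. 0 < r \<and> r < t \<and> ennreal r < ?L s}"
        using top by (cases "0 \<le> t") (auto simp: ennreal_neg)
    qed
  qed simp
  also have "\<dots> = (\<integral>\<^sup>+r\<in>{0<..<t}. rearr g r \<partial>lborel)"
    by (rule nn_integral_layer_cake[symmetric]) (auto intro: sigma_finite_lborel)
  finally show ?thesis .
qed

section \<open>The averaged rearrangement and its control of convolutions\<close>

definition rearr_avg :: "('a::euclidean_space \<Rightarrow> complex) \<Rightarrow> real \<Rightarrow> ennreal" where
  "rearr_avg g t = (\<integral>\<^sup>+r\<in>{0<..<t}. rearr g r \<partial>lborel) / ennreal t"

lemma times_rearr_avg: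
  assumes "0 < t"
  shows "ennreal t * rearr_avg g t = (\<integral>\<^sup>+r\<in>{0<..<t}. rearr g r \<partial>lborel)"
proof -
  have "ennreal t * (ennreal (inverse t) * X) = X" for X
    using assms by (simp add: mult.assoc[symmetric] ennreal_mult[symmetric])
  then show ?thesis
    using assms unfolding rearr_avg_def divide_ennreal_def
    by (subst mult.commute[of "set_nn_integral _ _ _"]) (simp add: inverse_ennreal)
qed

lemma rearr_le_avg:
  assumes [measurable]: "g \<in> borel_measurable borel" and "0 < t"
  shows "rearr g t \<le> rearr_avg g t"
proof -
  have "rearr g t * ennreal t = (\<integral>\<^sup>+r\<in>{0<..<t}. rearr g t \<partial>lborel)"
    using \<open>0 < t\<close> by (simp add: nn_integral_cmult_indicator)
  also have "\<dots> \<le> (\<integral>\<^sup>+r\<in>{0<..<t}. rearr g r \<partial>lborel)"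
    by (intro nn_integral_mono) (auto split: split_indicator intro: rearr_antimono)
  finally have "rearr g t * ennreal t / ennreal t \<le> rearr_avg g t"
    unfolding rearr_avg_def by (rule divide_right_mono_ennreal)
  moreover have "rearr g t * ennreal t / ennreal t = rearr g t"
    using \<open>0 < t\<close> by (simp add: ennreal_times_divide[symmetric] ennreal_divide_self)
  ultimately show ?thesis by simp
qed

text \<open>
  Cut \<open>g\<close> at the height \<open>rearr g t\<close>: the part above lives on a set of measure at most \<open>t\<close> and is
  integrable by the Hardy--Littlewood inequality, the part below is bounded.
\<close>

lemma convolution_bounds:
  fixes g \<kappa> :: "'a::euclidean_space \<Rightarrow> complex"
  assumes [measurable]: "g \<in> borel_measurable borel" "\<kappa> \<in> borel_measurable borel"
    and "0 < T" "0 \<le> M" and sup: "\<And>z. norm (\<kappa> z) \<le> M / T"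
    and L1: "(\<integral>\<^sup>+z. ennreal (norm (\<kappa> z)) \<partial>lborel) \<le> ennreal M"
  defines "H y \<equiv> \<integral>\<^sup>+x. ennreal (norm (g x)) * ennreal (norm (\<kappa> (x - y))) \<partial>lborel"
  shows convolution_sup_bound: "H y \<le> ennreal (2 * M) * rearr_avg g T"
    and convolution_weak_bound:
      "0 < t \<Longrightarrow> emeasure lborel {y. ennreal (2 * M) * rearr_avg g t < H y} \<le> ennreal t"
proof -
  define E where "E t = {x. rearr g t < ennreal (norm (g x))}" for t
  have [measurable]: "E t \<in> sets borel" for t unfolding E_def by measurable
  have E: "emeasure lborel (E t) \<le> ennreal t" for t
    using less_rearr_iff[OF assms(1), of "rearr g t" t] by (simp add: E_def not_less)
  define H1 where "H1 t y = (\<integral>\<^sup>+x. ennreal (norm (g x)) * indicator (E t) x * ennreal (norm (\<kappa> (x - y))) \<partial>lborel)" for t y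
  have shift1: "(\<integral>\<^sup>+x. ennreal (norm (\<kappa> (x - y))) \<partial>lborel) \<le> ennreal M" for y
    using L1 nn_integral_distr[of "\<lambda>x. - y + x" lborel borel "\<lambda>z. ennreal (norm (\<kappa> z))"]
    unfolding lborel_distr_plus by simp
  have shift2: "(\<integral>\<^sup>+y. ennreal (norm (\<kappa> (x - y))) \<partial>lborel) \<le> ennreal M" for x
  proof -
    have "lborel = distr lborel borel (\<lambda>y. x + (-1) *\<^sub>R y)"
      using lborel_affine[of "-1" x] by (simp add: density_1)
    then have "(\<integral>\<^sup>+z. ennreal (norm (\<kappa> z)) \<partial>lborel) = (\<integral>\<^sup>+z. ennreal (norm (\<kappa> z)) \<partial>distr lborel borel (\<lambda>y. x + (-1) *\<^sub>R y))"
      by simp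
    also have "\<dots> = (\<integral>\<^sup>+y. ennreal (norm (\<kappa> (x - y))) \<partial>lborel)"
      by (subst nn_integral_distr) auto
    finally show ?thesis using L1 by simp
  qed
  have split: "H y \<le> H1 t y + ennreal M * rearr g t" for t y
  proof -
    have "H y \<le> (\<integral>\<^sup>+x. ennreal (norm (g x)) * indicator (E t) x * ennreal (norm (\<kappa> (x - y)))
          + rearr g t * ennreal (norm (\<kappa> (x - y))) \<partial>lborel)"
      unfolding H_def
      by (intro nn_integral_mono) (auto simp: E_def not_less split: split_indicator intro!: mult_right_mono)
    also have "\<dots> = H1 t y + rearr g t * (\<integral>\<^sup>+x. ennreal (norm (\<kappa> (x - y))) \<partial>lborel)"
      by (simp add: nn_integral_add nn_integral_cmult H1_def)
    also have "\<dots> \<le> H1 t y + rearr g t * ennreal M"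
      by (intro add_left_mono mult_left_mono shift1) simp
    finally show ?thesis by (simp add: mult.commute)
  qed
  have int_E: "(\<integral>\<^sup>+x\<in>E t. ennreal (norm (g x)) \<partial>lborel) \<le> ennreal t * rearr_avg g t" if "0 < t" for t
  proof -
    have "(\<integral>\<^sup>+x\<in>E t. ennreal (norm (g x)) \<partial>lborel) \<le> (\<integral>\<^sup>+r\<in>{0<..<t}. rearr g r \<partial>lborel)"
      by (rule hardy_littlewood[OF _ _ E]) auto
    also have "\<dots> = ennreal t * rearr_avg g t"
      using that by (simp add: times_rearr_avg)
    finally show ?thesis .
  qed
  have two: "ennreal (2 * M) * X = ennreal M * X + ennreal M * X" for X
    using \<open>0 \<le> M\<close> by (simp add: ennreal_mult mult_2[symmetric] mult.assoc)
  have split2: "H y \<le> H1 t y + ennreal M * rearr_avg g t" if "0 < t" for t y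
    using split[of y t] mult_left_mono[OF rearr_le_avg[OF assms(1) that], of "ennreal M"]
    by (meson add_left_mono order_trans zero_le)
  show "H y \<le> ennreal (2 * M) * rearr_avg g T"
  proof -
    \<comment> \<open>At \<open>t = T\<close> the upper part of \<open>g\<close> meets the sup bound
      \<open>M / T\<close>, and \<open>T\<close> cancels against the factor in
      \<open>int_E\<close>.\<close>
    have "H1 T y \<le> (\<integral>\<^sup>+x. ennreal (norm (g x)) * indicator (E T) x * ennreal (M / T) \<partial>lborel)"
      unfolding H1_def by (intro nn_integral_mono mult_left_mono ennreal_leI sup) simp
    also have "\<dots> = (\<integral>\<^sup>+x\<in>E T. ennreal (norm (g x)) \<partial>lborel) * ennreal (M / T)"
      by (simp add: nn_integral_multc)
    also have "\<dots> \<le> ennreal T * rearr_avg g T * ennreal (M / T)"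
      by (intro mult_right_mono int_E \<open>0 < T\<close>) simp
    also have "\<dots> = ennreal M * rearr_avg g T"
    proof -
      have "ennreal T * ennreal (M / T) = ennreal M"
        using \<open>0 < T\<close> \<open>0 \<le> M\<close> by (simp add: ennreal_mult[symmetric])
      then show ?thesis by (metis mult.commute mult.assoc)
    qed
    finally show ?thesis unfolding two
      using split2[OF \<open>0 < T\<close>, of y] by (meson add_right_mono order_trans)
  qed
  show "emeasure lborel {y. ennreal (2 * M) * rearr_avg g t < H y} \<le> ennreal t" if "0 < t"
  proof -
    let ?c = "ennreal M * rearr_avg g t"
    have [measurable]: "H1 t \<in> borel_measurable borel" unfolding H1_def by measurable
    \<comment> \<open>Half of the level is used up by the bounded part of \<open>g\<close>, so the
      upper part must exceed the other half \<open>?c\<close>.\<close>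
    have "{y. ennreal (2 * M) * rearr_avg g t < H y} \<subseteq> {y. ?c < H1 t y}"
    proof safe
      fix y assume "ennreal (2 * M) * rearr_avg g t < H y"
      then have "?c + ?c < H1 t y + ?c"
        using split2[OF that, of y] unfolding two by (rule less_le_trans)
      then show "?c < H1 t y" by (meson add_right_mono leD le_less_linear)
    qed
    then have "emeasure lborel {y. ennreal (2 * M) * rearr_avg g t < H y} \<le> emeasure lborel {y. ?c < H1 t y}"
      by (intro emeasure_mono) auto
    also have "\<dots> \<le> ennreal t"
    proof -
      have "(\<integral>\<^sup>+y. H1 t y \<partial>lborel) =
        (\<integral>\<^sup>+x. (\<integral>\<^sup>+y. ennreal (norm (g x)) * indicator (E t) x * ennreal (norm (\<kappa> (x - y))) \<partial>lborel) \<partial>lborel)"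
        unfolding H1_def by (rule lborel_pair.Fubini') measurable
      also have "\<dots> = (\<integral>\<^sup>+x. ennreal (norm (g x)) * indicator (E t) x * (\<integral>\<^sup>+y. ennreal (norm (\<kappa> (x - y))) \<partial>lborel) \<partial>lborel)"
        by (simp add: nn_integral_cmult)
      also have "\<dots> \<le> (\<integral>\<^sup>+x. ennreal (norm (g x)) * indicator (E t) x * ennreal M \<partial>lborel)"
        by (intro nn_integral_mono mult_left_mono shift2) simp
      also have "\<dots> = (\<integral>\<^sup>+x\<in>E t. ennreal (norm (g x)) \<partial>lborel) * ennreal M"
        by (simp add: nn_integral_multc)
      also have "\<dots> \<le> ennreal t * rearr_avg g t * ennreal M"
        by (intro mult_right_mono int_E that) simp
      finally have I: "(\<integral>\<^sup>+y. H1 t y \<partial>lborel) \<le> ?c * ennreal t" by (simp add: ac_simps)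
      \<comment> \<open>Markov's inequality divides by the level, so the levels \<open>0\<close> and
        \<open>\<infinity>\<close> are treated apart.\<close>
      consider "?c = 0" | "?c = \<infinity>" | "?c \<noteq> 0" "?c \<noteq> \<infinity>" by blast
      then show ?thesis
      proof cases
        case 1
        then have "(\<integral>\<^sup>+y. H1 t y \<partial>lborel) = 0" using I unfolding 1 by simp
        then have "AE y in lborel. H1 t y = 0" by (simp add: nn_integral_0_iff_AE)
        then have "AE y in lborel. \<not> ?c < H1 t y" by eventually_elim (simp add: 1)
        then have "emeasure lborel {y. ?c < H1 t y} = 0"
          by (subst (asm) AE_iff_measurable[OF _ refl]) auto
        then show ?thesis by simp
      next
        case 2
        then have "{y. ?c < H1 t y} = {}" by (auto simp: not_less)
        then show ?thesis by simp
      next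
        case 3
        then obtain r where r: "?c = ennreal r" "0 < r"
          by (cases ?c) (auto simp: less_le)
        have "ennreal r * emeasure lborel {y. ?c < H1 t y} = (\<integral>\<^sup>+y. ennreal r * indicator {y. ?c < H1 t y} y \<partial>lborel)"
          by (simp add: nn_integral_cmult)
        also have "\<dots> \<le> (\<integral>\<^sup>+y. H1 t y \<partial>lborel)"
          using r by (intro nn_integral_mono) (auto split: split_indicator)
        also have "\<dots> \<le> ennreal r * ennreal t" using I r by simp
        finally show ?thesis using r by (simp add: ennreal_mult_le_mult_iff)
      qed
    qed
    finally show ?thesis .
  qed
qed

text \<open>Up to \<open>T\<close> the sup bound leaves no point above the level; beyond
  \<open>T\<close> the weak-type bound makes the set of such points small enough. The kernel appears
  as \<open>\<kappa> (x - y)\<close> because this convolution is the adjoint of the one acting on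
  test functions.\<close>

lemma rearr_convolution_le:
  fixes g \<kappa> :: "'a::euclidean_space \<Rightarrow> complex"
  assumes [measurable]: "g \<in> borel_measurable borel" "\<kappa> \<in> borel_measurable borel"
    and "0 < T" "0 \<le> M" and sup: "\<And>z. norm (\<kappa> z) \<le> M / T"
    and L1: "(\<integral>\<^sup>+z. ennreal (norm (\<kappa> z)) \<partial>lborel) \<le> ennreal M"
  shows "rearr (\<lambda>y. \<integral>x. g x * \<kappa> (x - y) \<partial>lborel) t \<le> ennreal (2 * M) * rearr_avg g (max t T)"
proof -
  let ?G = "\<lambda>y. \<integral>x. g x * \<kappa> (x - y) \<partial>lborel"
  have [measurable]: "?G \<in> borel_measurable borel" by measurable
  let ?H = "\<lambda>y. \<integral>\<^sup>+x. ennreal (norm (g x)) * ennreal (norm (\<kappa> (x - y))) \<partial>lborel"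
  let ?c = "ennreal (2 * M) * rearr_avg g (max t T)"
  \<comment> \<open>If the integrand is not integrable, the Bochner integral is \<open>0\<close>, so
    the bound holds there as well.\<close>
  have le: "ennreal (norm (?G y)) \<le> ?H y" for y
    using integral_norm_bound_ennreal[of lborel "\<lambda>x. g x * \<kappa> (x - y)"]
      not_integrable_integral_eq[of lborel "\<lambda>x. g x * \<kappa> (x - y)"]
    by (cases "integrable lborel (\<lambda>x. g x * \<kappa> (x - y))") (simp_all add: norm_mult ennreal_mult)
  have "emeasure lborel {y. ?c < ennreal (norm (?G y))} \<le> ennreal t"
  proof (cases "t \<le> T")
    case True
    have "{y. ?c < ennreal (norm (?G y))} = {}"
      using le convolution_sup_bound[OF assms] True
      by (force simp: not_less max_def intro: order_trans)
    then show ?thesis by simp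
  next
    case False
    have "emeasure lborel {y. ?c < ennreal (norm (?G y))} \<le> emeasure lborel {y. ?c < ?H y}"
      by (intro emeasure_mono) (auto intro: less_le_trans[OF _ le])
    also have "\<dots> \<le> ennreal t"
      using convolution_weak_bound[OF assms, of t] False \<open>0 < T\<close> by (simp add: max_def)
    finally show ?thesis .
  qed
  then have "\<not> ?c < rearr ?G t"
    by (subst less_rearr_iff) (simp_all add: not_less)
  then show ?thesis by (simp add: not_less)
qed

subsection \<open>Estimates of Lorentz--Zygmund norms\<close>

lemma nn_integral_powr_from_0:
  assumes "-1 < a" "0 < T"
  shows "(\<integral>\<^sup>+t\<in>{0<..<T}. ennreal (t powr a) \<partial>lborel) \<le> ennreal (T powr (a + 1) / (a + 1))"
proof -
  have "(\<integral>\<^sup>+t\<in>{0<..<T}. ennreal (t powr a) \<partial>lborel) \<le> (\<integral>\<^sup>+t. ennreal (indicator {0..T} t * t powr a) \<partial>lborel)"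
    by (intro nn_integral_mono) (auto split: split_indicator)
  also have "\<dots> = ennreal (T powr (a + 1) / (a + 1))"
    using nn_integral_has_integral_lebesgue[OF _ has_integral_powr_from_0[of a T]] assms by simp
  finally show ?thesis .
qed

lemma nn_integral_powr_to_inf:
  assumes "a < -1" "0 < T"
  shows "(\<integral>\<^sup>+t\<in>{T<..}. ennreal (t powr a) \<partial>lborel) \<le> ennreal (T powr (a + 1) / - (a + 1))"
proof -
  have "(\<integral>\<^sup>+t\<in>{T<..}. ennreal (t powr a) \<partial>lborel) \<le> (\<integral>\<^sup>+t. ennreal (indicator {T..} t * t powr a) \<partial>lborel)"
    by (intro nn_integral_mono) (auto split: split_indicator)
  also have "\<dots> = ennreal (T powr (a + 1) / - (a + 1))"
    using nn_integral_has_integral_lebesgue[OF _ has_integral_powr_to_inf[of a T]] assms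
    by (simp add: minus_divide_right)
  finally show ?thesis .
qed

lemma Lb_norm_mono:
  assumes "\<And>t. 0 < t \<Longrightarrow> h t \<le> k t" and [measurable]: "h \<in> borel_measurable borel"
  shows "Lb_norm b h \<le> Lb_norm b k"
proof (cases "b = \<infinity>")
  case True
  have "esssup (restrict_space lborel {0<..}) h \<le> esssup (restrict_space lborel {0<..}) k"
    by (intro esssup_AE_mono) (auto simp: AE_restrict_space_iff assms intro!: measurable_restrict_space1)
  with True show ?thesis by (simp add: Lb_norm_def)
next
  case False
  then show ?thesis unfolding Lb_norm_def
    by (auto intro!: epowr_mono nn_integral_mono simp: recip_def assms split: split_indicator)
qed

text \<open>This is the inclusion of the space with second index \<open>c\<close> in the one with
  second index \<open>\<infinity>\<close>. The non-increasing \<open>rearr g\<close> is at least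
  \<open>rearr g s\<close> on all of \<open>(s/2, s)\<close>, where the weight is comparable with
  its value at \<open>s\<close>; an interval of length \<open>s/2\<close> contributes
  \<open>(s/2) powr (1/c)\<close> to the norm, which restores the exponent \<open>1/q\<close> from
  \<open>1/q - 1/c\<close>.\<close>

lemma rearr_le_lz_norm:
  obtains C where "0 < C"
    and "\<And>(g :: 'a::euclidean_space \<Rightarrow> complex) s. g \<in> borel_measurable borel \<Longrightarrow> 0 < s \<Longrightarrow>
      0 < c \<Longrightarrow> ennreal (s powr recip q * blog B s) * rearr g s \<le> ennreal C * lz_norm q c B g"
proof -
  obtain K where K: "1 \<le> K" "\<And>s t. 0 < s \<Longrightarrow> s \<le> t \<Longrightarrow> blog B t \<le> K * (t / s) powr 1 * blog B s"
    using blog_potter[of 1 B] by (metis zero_less_one)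
  define a where "a = recip q - recip c"
  define w where "w t = t powr a * blog B t" for t
  \<comment> \<open>\<open>2 powr \<bar>a\<bar>\<close> pays for the power and \<open>2 * K\<close>
    for the logarithmic weight, as \<open>s / t\<close> stays below 2 on the interval.\<close>
  define D where "D = 2 powr \<bar>a\<bar> * (2 * K)"
  have D: "0 < D" using K by (simp add: D_def)
  have w_pos: "0 < w s" if "0 < s" for s using that blog_pos[of B s] by (simp add: w_def)
  have w: "w s \<le> D * w t" if "0 < s" "s / 2 < t" "t < s" for s t
  proof -
    have "s powr a \<le> 2 powr \<bar>a\<bar> * t powr a"
    proof -
      have "(s / t) powr a \<le> (s / t) powr \<bar>a\<bar>"
        using that by (intro powr_mono) auto
      also have "\<dots> \<le> 2 powr \<bar>a\<bar>"
        using that by (intro powr_mono2) (auto simp: field_simps)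
      finally show ?thesis using that by (simp add: powr_divide field_simps)
    qed
    moreover have "blog B s \<le> (2 * K) * blog B t"
    proof -
      have "blog B s \<le> K * (s / t) powr 1 * blog B t"
        using that by (intro K(2)) auto
      also have "\<dots> \<le> K * 2 * blog B t"
        using that K(1) blog_pos[of B t]
        by (intro mult_right_mono mult_left_mono) (auto simp: field_simps)
      finally show ?thesis by (simp add: mult_ac)
    qed
    ultimately have "s powr a * blog B s \<le> (2 powr \<bar>a\<bar> * t powr a) * ((2 * K) * blog B t)"
      using blog_pos[of B s] by (intro mult_mono) auto
    then show ?thesis unfolding w_def D_def by (simp only: ac_simps)
  qed
  have wg: "ennreal (w s) * rearr g s \<le> ennreal D * (ennreal (w t) * rearr g t)"
    if "0 < s" "s / 2 < t" "t < s" for s t and g :: "'a \<Rightarrow> complex"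
  proof -
    have "ennreal (w s) * rearr g s \<le> ennreal (D * w t) * rearr g t"
      using that w by (intro mult_mono ennreal_leI rearr_antimono) auto
    then show ?thesis using D w_pos[of t] that by (simp add: ennreal_mult mult_ac)
  qed
  define C where "C = D * 2 powr recip c"
  have C: "0 < C" using D by (simp add: C_def)
  show ?thesis
  proof (rule that[OF C])
    fix g :: "'a \<Rightarrow> complex" and s :: real
    assume [measurable]: "g \<in> borel_measurable borel" and s: "0 < s" and c: "0 < c"
    show "ennreal (s powr recip q * blog B s) * rearr g s \<le> ennreal C * lz_norm q c B g"
    proof (cases "c = \<infinity>")
      case True
      let ?N = "esssup (restrict_space lborel {0<..}) (\<lambda>t. ennreal (w t) * rearr g t)"
      have N: "lz_norm q c B g = ?N"
        using True by (simp add: lz_norm_def Lb_norm_def w_def a_def)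
      have "AE t in lborel. 0 < t \<longrightarrow> ennreal (w t) * rearr g t \<le> ?N"
        using esssup_AE[of "\<lambda>t. ennreal (w t) * rearr g t" "restrict_space lborel {0<..}"]
        by (simp add: AE_restrict_space_iff)
      then obtain Z where Z: "Z \<in> null_sets lborel" "{t. \<not> (0 < t \<longrightarrow> ennreal (w t) * rearr g t \<le> ?N)} \<subseteq> Z"
        by (auto simp: eventually_ae_filter)
      \<comment> \<open>An essential supremum bounds values only off a null set; an interval of
        positive length contains a point off it, and one such point suffices.\<close>
      have "\<exists>t\<in>{s/2<..<s}. t \<notin> Z"
      proof (rule ccontr)
        assume "\<not> ?thesis"
        then have "{s/2<..<s} \<subseteq> Z" by blast
        then have "emeasure lborel {s/2<..<s} \<le> emeasure lborel Z"
          using Z by (intro emeasure_mono) auto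
        then show False using Z s by (simp add: null_sets_def)
      qed
      then obtain t where t: "s / 2 < t" "t < s" "t \<notin> Z" by auto
      moreover have "0 < t" using t s by linarith
      ultimately have "ennreal (w t) * rearr g t \<le> ?N" using Z by blast
      then have "ennreal (w s) * rearr g s \<le> ennreal D * ?N"
        using wg[OF s t(1,2), of g] by (meson mult_left_mono order_trans zero_le)
      then show ?thesis using True unfolding N by (simp add: w_def a_def C_def)
    next
      case False
      then obtain r where r: "c = ennreal r" "0 < r" using c by (cases c) auto
      let ?v = "ennreal (inverse D) * (ennreal (w s) * rearr g s)"
      have v: "?v \<le> ennreal (w t) * rearr g t" if "s / 2 < t" "t < s" for t
      proof -
        have "?v \<le> ennreal (inverse D) * (ennreal D * (ennreal (w t) * rearr g t))"
          by (intro mult_left_mono wg s that) simp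
        also have "\<dots> = ennreal (w t) * rearr g t"
          using D by (simp add: mult.assoc[symmetric] ennreal_mult[symmetric])
        finally show ?thesis .
      qed
      have "ennreal (s / 2) * epowr ?v r = (\<integral>\<^sup>+t\<in>{s/2<..<s}. epowr ?v r \<partial>lborel)"
        using s by (subst nn_integral_cmult_indicator) (simp_all add: mult.commute)
      also have "\<dots> \<le> (\<integral>\<^sup>+t\<in>{0<..}. epowr (ennreal (w t) * rearr g t) r \<partial>lborel)"
        using s r by (intro nn_integral_mono) (auto split: split_indicator intro!: epowr_mono v)
      finally have "epowr (ennreal (s / 2) * epowr ?v r) (1 / r) \<le> lz_norm q c B g"
        using r by (simp add: lz_norm_def Lb_norm_def w_def a_def recip_ennreal epowr_mono)
      also have "epowr (ennreal (s / 2) * epowr ?v r) (1 / r) = ennreal ((s / 2) powr (1 / r)) * ?v"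
        using s r by (simp add: epowr_cmult epowr_epowr)
      finally have "ennreal C * (ennreal ((s / 2) powr (1 / r)) * ?v) \<le> ennreal C * lz_norm q c B g"
        by (intro mult_left_mono) simp_all
      also have "ennreal C * (ennreal ((s / 2) powr (1 / r)) * ?v)
          = ennreal (C * (s / 2) powr (1 / r) * inverse D * w s) * rearr g s"
        using C D w_pos[OF s] by (simp add: ennreal_mult mult_ac)
      also have "C * (s / 2) powr (1 / r) * inverse D * w s = s powr recip q * blog B s"
      proof -
        have "s powr (1 / r) * s powr (recip q - 1 / r) = s powr recip q"
          by (simp add: powr_add[symmetric])
        then show ?thesis
          using s r D by (simp add: C_def w_def a_def recip_ennreal powr_divide field_simps del: powr_add)
      qed
      finally show ?thesis .
    qed
  qed
qed

text \<open>Hardy's inequality in weak form: \<open>\<theta> < 1\<close> makes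
  \<open>s powr - \<theta>\<close> integrable at \<open>0\<close> with some exponent to spare, and
  the spare exponent absorbs the variation of the logarithmic weight between \<open>s\<close> and
  \<open>t\<close>.\<close>

lemma rearr_avg_le:
  assumes "0 \<le> \<theta>" "\<theta> < 1"
  obtains C where "0 < C"
    and "\<And>(g :: 'a::euclidean_space \<Rightarrow> complex) X (t::real). g \<in> borel_measurable borel \<Longrightarrow>
      (\<And>s. 0 < s \<Longrightarrow> ennreal (s powr \<theta> * blog B s) * rearr g s \<le> X) \<Longrightarrow> 0 < t \<Longrightarrow>
      ennreal (t powr \<theta> * blog B t) * rearr_avg g t \<le> ennreal C * X"
proof -
  \<comment> \<open>Half of the margin \<open>1 - \<theta>\<close> goes to Potter's bound; the other
    half, \<open>\<eta>\<close>, is kept for integrability, since the integrand becomes a multiple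
    of \<open>s powr (\<eta> - 1)\<close>.\<close>
  define \<epsilon> where "\<epsilon> = (1 - \<theta>) / 2"
  define \<eta> where "\<eta> = 1 - \<theta> - \<epsilon>"
  have \<epsilon>: "0 < \<epsilon>" "0 < \<eta>" using assms by (auto simp: \<epsilon>_def \<eta>_def field_simps)
  obtain K where K: "1 \<le> K" "\<And>s t. 0 < s \<Longrightarrow> s \<le> t \<Longrightarrow> blog B t \<le> K * (t / s) powr \<epsilon> * blog B s"
    using blog_potter[OF \<epsilon>(1), of B] by metis
  show ?thesis
  proof (rule that)
    show "0 < K / \<eta>" using K \<epsilon> by simp
    fix g :: "'a \<Rightarrow> complex" and X and t :: real
    assume [measurable]: "g \<in> borel_measurable borel"
      and X: "\<And>s. 0 < s \<Longrightarrow> ennreal (s powr \<theta> * blog B s) * rearr g s \<le> X" and t: "0 < t"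
    have bt: "0 < blog B t" by (rule blog_pos)
    have le: "rearr g s \<le> ennreal (s powr (\<eta> - 1)) * (ennreal (K * t powr \<epsilon> / blog B t) * X)"
      if s: "0 < s" "s < t" for s
    proof -
      have bs: "0 < s powr \<theta> * blog B s" using s blog_pos[of B s] by simp
      have "rearr g s = ennreal (inverse (s powr \<theta> * blog B s)) * (ennreal (s powr \<theta> * blog B s) * rearr g s)"
      proof -
        have "inverse (s powr \<theta> * blog B s) * (s powr \<theta> * blog B s) = 1"
          by (rule left_inverse[OF less_imp_neq[OF bs, symmetric]])
        then have "ennreal (inverse (s powr \<theta> * blog B s)) * ennreal (s powr \<theta> * blog B s) = 1"
          using bs by (simp only: ennreal_mult[symmetric] less_imp_le positive_imp_inverse_positive ennreal_1)
        then show ?thesis by (simp only: mult.assoc[symmetric] mult_1_left)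
      qed
      also have "\<dots> \<le> ennreal (inverse (s powr \<theta> * blog B s)) * X"
        by (intro mult_left_mono X s) simp
      also have "\<dots> \<le> ennreal (s powr (\<eta> - 1) * (K * t powr \<epsilon> / blog B t)) * X"
      proof (intro mult_right_mono ennreal_leI)
        have "blog B t \<le> K * (t / s) powr \<epsilon> * blog B s" using s by (intro K) auto
        also have "(t / s) powr \<epsilon> = t powr \<epsilon> * s powr (\<eta> - 1) * s powr \<theta>"
          using s t by (simp add: powr_divide \<eta>_def powr_diff powr_minus field_simps)
        finally show "inverse (s powr \<theta> * blog B s) \<le> s powr (\<eta> - 1) * (K * t powr \<epsilon> / blog B t)"
          using bs bt s blog_pos[of B s] by (simp add: field_simps)
      qed simp
      also have "\<dots> = ennreal (s powr (\<eta> - 1)) * (ennreal (K * t powr \<epsilon> / blog B t) * X)"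
        using K bt by (subst ennreal_mult) (auto simp: mult.assoc)
      finally show ?thesis .
    qed
    have "(\<integral>\<^sup>+s\<in>{0<..<t}. rearr g s \<partial>lborel)
      \<le> (\<integral>\<^sup>+s. (ennreal (s powr (\<eta> - 1)) * indicator {0<..<t} s) * (ennreal (K * t powr \<epsilon> / blog B t) * X) \<partial>lborel)"
      by (intro nn_integral_mono) (auto split: split_indicator intro!: le)
    also have "\<dots> = (\<integral>\<^sup>+s\<in>{0<..<t}. ennreal (s powr (\<eta> - 1)) \<partial>lborel) * (ennreal (K * t powr \<epsilon> / blog B t) * X)"
      by (rule nn_integral_multc) measurable
    also have "\<dots> \<le> ennreal (t powr \<eta> / \<eta>) * (ennreal (K * t powr \<epsilon> / blog B t) * X)"
      using nn_integral_powr_from_0[of "\<eta> - 1" t] \<epsilon> t by (intro mult_right_mono) auto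
    finally have "rearr_avg g t \<le> ennreal (t powr \<eta> / \<eta>) * (ennreal (K * t powr \<epsilon> / blog B t) * X) / ennreal t"
      unfolding rearr_avg_def by (rule divide_right_mono_ennreal)
    also have "\<dots> = ennreal (t powr \<eta> / \<eta> * (K * t powr \<epsilon> / blog B t) / t) * X"
      using t \<epsilon> K bt
      by (simp add: divide_ennreal_def ennreal_mult inverse_ennreal divide_inverse mult_ac)
    finally have "ennreal (t powr \<theta> * blog B t) * rearr_avg g t
      \<le> ennreal (t powr \<theta> * blog B t) * (ennreal (t powr \<eta> / \<eta> * (K * t powr \<epsilon> / blog B t) / t) * X)"
      by (intro mult_left_mono) simp_all
    also have "\<dots> = ennreal (t powr \<theta> * blog B t * (t powr \<eta> / \<eta> * (K * t powr \<epsilon> / blog B t) / t)) * X"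
      using t \<epsilon> K bt by (subst (2) ennreal_mult) (auto simp: mult.assoc)
    also have "t powr \<theta> * blog B t * (t powr \<eta> / \<eta> * (K * t powr \<epsilon> / blog B t) / t) = K / \<eta>"
    proof -
      have "t powr \<theta> * t powr \<eta> * t powr \<epsilon> = t powr (\<theta> + \<eta> + \<epsilon>)" by (simp add: powr_add)
      also have "\<dots> = t" using t by (simp add: \<eta>_def)
      finally have *: "t powr \<theta> * t powr \<eta> * t powr \<epsilon> = t" .
      have "t powr \<theta> * blog B t * (t powr \<eta> / \<eta> * (K * t powr \<epsilon> / blog B t) / t)
        = (t powr \<theta> * t powr \<eta> * t powr \<epsilon>) * K / (\<eta> * t)"
        using bt by (simp add: field_simps)
      then show ?thesis unfolding * using t by simp
    qed
    finally show "ennreal (t powr \<theta> * blog B t) * rearr_avg g t \<le> ennreal (K / \<eta>) * X" .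
  qed
qed

text \<open>For \<open>1 < q\<close> the two preceding bounds combine, as
  \<open>recip q < 1\<close>. At \<open>q = 1\<close> there is no margin for Hardy's inequality, but
  with \<open>c = 1\<close> and trivial weight the norm is the full integral of
  \<open>rearr g\<close>, which dominates the integral over \<open>(0, t)\<close>.\<close>

lemma rearr_avg_le_lz_norm:
  assumes "1 \<le> q" "q < \<infinity>" "0 < c" "q = 1 \<and> c = 1 \<and> B = (0, 0) \<or> 1 < q"
  obtains C where "0 < C"
    and "\<And>(g :: 'a::euclidean_space \<Rightarrow> complex) t. g \<in> borel_measurable borel \<Longrightarrow> 0 < t \<Longrightarrow>
      ennreal (t powr recip q * blog B t) * rearr_avg g t \<le> ennreal C * lz_norm q c B g"
proof (cases "1 < q")
  case False
  then have q: "q = 1" "c = 1" "B = (0, 0)" using assms by auto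
  have "recip 1 = 1" using recip_ennreal[of 1] by simp
  show ?thesis
  proof (rule that[of 1])
    fix g :: "'a \<Rightarrow> complex" and t :: real
    assume [measurable]: "g \<in> borel_measurable borel" and t: "0 < t"
    have "ennreal t * rearr_avg g t = (\<integral>\<^sup>+s\<in>{0<..<t}. rearr g s \<partial>lborel)"
      by (rule times_rearr_avg[OF t])
    also have "\<dots> \<le> (\<integral>\<^sup>+s\<in>{0<..}. rearr g s \<partial>lborel)"
      by (intro nn_integral_mono) (auto split: split_indicator)
    also have "\<dots> = (\<integral>\<^sup>+s\<in>{0<..}. epowr (ennreal (s powr (recip q - recip c) * blog B s) * rearr g s) 1 \<partial>lborel)"
      by (intro nn_integral_cong) (auto simp: q epowr_def ennreal_enn2real_if split: split_indicator)
    also have "\<dots> = lz_norm q c B g"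
      using epowr_epowr[of 1] by (simp add: lz_norm_def Lb_norm_def q \<open>recip 1 = 1\<close> epowr_def ennreal_enn2real_if)
    finally show "ennreal (t powr recip q * blog B t) * rearr_avg g t \<le> ennreal 1 * lz_norm q c B g"
      using t by (simp add: q \<open>recip 1 = 1\<close>)
  qed simp
next
  case True
  obtain r where r: "q = ennreal r" "1 < r" using True assms by (cases q) (auto simp: ennreal_1[symmetric] ennreal_less_iff simp del: ennreal_1)
  have \<theta>: "0 \<le> recip q" "recip q < 1" using r by (auto simp: recip_ennreal)
  obtain C1 where C1: "0 < C1" "\<And>(g :: 'a \<Rightarrow> complex) s. g \<in> borel_measurable borel \<Longrightarrow> 0 < s \<Longrightarrow>
      0 < c \<Longrightarrow> ennreal (s powr recip q * blog B s) * rearr g s \<le> ennreal C1 * lz_norm q c B g"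
    by (rule rearr_le_lz_norm[where ?'a='a and c=c and q=q and B=B]) blast
  obtain C2 where C2: "0 < C2" "\<And>(g :: 'a \<Rightarrow> complex) X (t::real). g \<in> borel_measurable borel \<Longrightarrow>
      (\<And>s. 0 < s \<Longrightarrow> ennreal (s powr recip q * blog B s) * rearr g s \<le> X) \<Longrightarrow> 0 < t \<Longrightarrow>
      ennreal (t powr recip q * blog B t) * rearr_avg g t \<le> ennreal C2 * X"
    by (rule rearr_avg_le[OF \<theta>, where ?'a='a and B=B]) blast
  show ?thesis
  proof (rule that[of "C2 * C1"])
    fix g :: "'a \<Rightarrow> complex" and t :: real
    assume g: "g \<in> borel_measurable borel" and t: "0 < t"
    have "ennreal (t powr recip q * blog B t) * rearr_avg g t \<le> ennreal C2 * (ennreal C1 * lz_norm q c B g)"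
      by (rule C2(2)[OF g C1(2)[OF g _ assms(3)] t])
    then show "ennreal (t powr recip q * blog B t) * rearr_avg g t \<le> ennreal (C2 * C1) * lz_norm q c B g"
      using C1 C2 by (simp add: ennreal_mult mult.assoc)
  qed (use C1 C2 in simp)
qed

text \<open>The hypothesis bounds \<open>rearr G\<close> by a majorant that is constant up to
  \<open>T\<close> and decays like \<open>t powr - \<theta>\<close>, up to logarithms, afterwards.
  Its norm is concentrated near \<open>t = T\<close>, so that up to a constant only the values at
  \<open>T\<close> of the power and of both logarithmic weights remain.\<close>

lemma lz_norm_le_of_rearr_le:
  assumes "0 < p" "0 < b" "0 < \<theta>"
    and p: "recip p < \<theta> \<and> p < \<infinity> \<or> p = \<infinity> \<and> b = \<infinity> \<and> A = (0, 0)"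
  obtains C where "0 < C"
    and "\<And>(G :: 'a::euclidean_space \<Rightarrow> complex) X T. G \<in> borel_measurable borel \<Longrightarrow> 0 < T \<Longrightarrow>
      (\<And>t. 0 < t \<Longrightarrow> ennreal (max t T powr \<theta> * blog B (max t T)) * rearr G t \<le> X) \<Longrightarrow>
      lz_norm p b A G \<le> ennreal (C * T powr (recip p - \<theta>) * blog (A - B) T) * X"
proof (cases "p = \<infinity>")
  case True
  with p have inf: "b = \<infinity>" "A = (0, 0)" by auto
  obtain K where K: "1 \<le> K" "\<And>s t. 0 < s \<Longrightarrow> s \<le> t \<Longrightarrow> blog B s \<le> K * (t / s) powr \<theta> * blog B t"
    using blog_potter[OF \<open>0 < \<theta>\<close>, of B] by metis
  show ?thesis
  proof (rule that[of K])
    fix G :: "'a \<Rightarrow> complex" and X and T :: real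
    assume [measurable]: "G \<in> borel_measurable borel" and T: "0 < T"
      and le: "\<And>t. 0 < t \<Longrightarrow> ennreal (max t T powr \<theta> * blog B (max t T)) * rearr G t \<le> X"
    have bT: "0 < T powr \<theta> * blog B T" using T blog_pos[of B T] by simp
    have "rearr G t \<le> ennreal (K * T powr (recip p - \<theta>) * blog (A - B) T) * X" if t: "0 < t" for t
    proof -
      let ?m = "max t T"
      have bm: "0 < ?m powr \<theta> * blog B ?m" using T blog_pos[of B ?m] by simp
      have "blog B T \<le> K * (?m / T) powr \<theta> * blog B ?m" using T by (intro K) auto
      then have "1 \<le> K / (T powr \<theta> * blog B T) * (?m powr \<theta> * blog B ?m)"
        using bT T blog_pos[of B T] by (simp add: powr_divide field_simps)
      then have "ennreal 1 * rearr G t \<le> ennreal (K / (T powr \<theta> * blog B T) * (?m powr \<theta> * blog B ?m)) * rearr G t"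
        by (intro mult_right_mono ennreal_leI) auto
      also have "\<dots> = ennreal (K / (T powr \<theta> * blog B T)) * (ennreal (?m powr \<theta> * blog B ?m) * rearr G t)"
        using bm bT K by (subst ennreal_mult) (auto simp: mult.assoc intro!: divide_nonneg_pos)
      also have "\<dots> \<le> ennreal (K / (T powr \<theta> * blog B T)) * X"
        by (intro mult_left_mono le t) simp
      also have "K / (T powr \<theta> * blog B T) = K * T powr (recip p - \<theta>) * blog (A - B) T"
        using True inf by (simp add: blog_diff powr_minus field_simps)
      finally show ?thesis by simp
    qed
    then have "Lb_norm b (rearr G) \<le> ennreal (K * T powr (recip p - \<theta>) * blog (A - B) T) * X"
      unfolding Lb_norm_def
      by (auto simp: inf AE_restrict_space_iff intro!: esssup_I measurable_restrict_space1)
    moreover have "lz_norm p b A G \<le> Lb_norm b (rearr G)"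
      unfolding lz_norm_def by (intro Lb_norm_mono) (auto simp: True inf)
    ultimately show "lz_norm p b A G \<le> ennreal (K * T powr (recip p - \<theta>) * blog (A - B) T) * X"
      by simp
  qed (use K in simp)
next
  case False
  then obtain p' where p': "p = ennreal p'" "0 < p'" using assms(1) by (cases p) auto
  define \<pi> where "\<pi> = recip p"
  have \<pi>: "0 < \<pi>" "\<pi> < \<theta>" using p' p False by (auto simp: \<pi>_def recip_ennreal)
  \<comment> \<open>A margin on both sides of \<open>\<pi>\<close>, towards \<open>0\<close> and
    towards \<open>\<theta>\<close>. The rest of each gap is the exponent spent on Potter's bounds,
    and \<open>\<delta>\<close> itself remains as decay in \<open>t / T\<close> away from
    \<open>T\<close>.\<close>
  define \<delta> where "\<delta> = min \<pi> (\<theta> - \<pi>) / 2"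
  have \<delta>: "0 < \<delta>" "0 < \<pi> - \<delta>" "0 < \<theta> - \<pi> - \<delta>" using \<pi> by (auto simp: \<delta>_def min_def field_simps)
  obtain K1 where K1: "1 \<le> K1" "\<And>s t. 0 < s \<Longrightarrow> s \<le> t \<Longrightarrow> blog A s \<le> K1 * (t / s) powr (\<pi> - \<delta>) * blog A t"
    using blog_potter[OF \<delta>(2), of A] by metis
  obtain K2 where K2: "1 \<le> K2" "\<And>s t. 0 < s \<Longrightarrow> s \<le> t \<Longrightarrow> blog (A - B) t \<le> K2 * (t / s) powr (\<theta> - \<pi> - \<delta>) * blog (A - B) s"
    using blog_potter[OF \<delta>(3), of "A - B"] by metis
  define K where "K = max K1 K2"
  have K: "1 \<le> K" "K1 \<le> K" "K2 \<le> K" using K1 by (auto simp: K_def)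
  define \<rho> where "\<rho> T t = (if t \<le> T then (t / T) powr \<delta> else (t / T) powr - \<delta>)" for T t :: real
  have \<rho>_meas [measurable]: "\<rho> T \<in> borel_measurable borel" for T unfolding \<rho>_def by measurable
  have \<rho>0: "0 \<le> \<rho> T t" for T t by (simp add: \<rho>_def)
  have weight: "t powr \<pi> * blog A t / (max t T powr \<theta> * blog B (max t T))
      \<le> K * T powr (\<pi> - \<theta>) * blog (A - B) T * \<rho> T t" if "0 < t" "0 < T" for t T
  proof (cases "t \<le> T")
    case True
    have "t powr \<pi> * blog A t \<le> t powr \<pi> * (K1 * (T / t) powr (\<pi> - \<delta>) * blog A T)"
      using True that by (intro mult_left_mono K1) auto
    also have "\<dots> = K1 * (t powr \<pi> * (T / t) powr (\<pi> - \<delta>)) * blog A T" by (simp add: mult_ac)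
    also have "t powr \<pi> * (T / t) powr (\<pi> - \<delta>) = T powr \<pi> * (t / T) powr \<delta>"
      using that by (simp add: powr_divide powr_diff field_simps)
    also have "K1 * (T powr \<pi> * (t / T) powr \<delta>) * blog A T \<le> K * (T powr \<pi> * (t / T) powr \<delta>) * blog A T"
      using K blog_pos[of A T] by (intro mult_right_mono) auto
    finally have "t powr \<pi> * blog A t / (T powr \<theta> * blog B T) \<le> K * (T powr \<pi> * (t / T) powr \<delta>) * blog A T / (T powr \<theta> * blog B T)"
      using blog_pos[of B T] by (intro divide_right_mono) auto
    also have "\<dots> = K * T powr (\<pi> - \<theta>) * blog (A - B) T * \<rho> T t"
      using True by (simp add: \<rho>_def blog_diff powr_diff)
    finally show ?thesis using True by (simp add: max_def)
  next
    case False
    have "t powr \<pi> * blog A t / (t powr \<theta> * blog B t) = t powr (\<pi> - \<theta>) * blog (A - B) t"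
      by (simp add: blog_diff powr_diff)
    also have "\<dots> \<le> t powr (\<pi> - \<theta>) * (K2 * (t / T) powr (\<theta> - \<pi> - \<delta>) * blog (A - B) T)"
      using False that by (intro mult_left_mono K2) auto
    also have "\<dots> = K2 * (t powr (\<pi> - \<theta>) * (t / T) powr (\<theta> - \<pi> - \<delta>)) * blog (A - B) T" by (simp add: mult_ac)
    also have "t powr (\<pi> - \<theta>) * (t / T) powr (\<theta> - \<pi> - \<delta>) = T powr (\<pi> - \<theta>) * (t / T) powr - \<delta>"
      using that by (simp add: powr_divide powr_diff powr_minus powr_add field_simps)
    also have "K2 * (T powr (\<pi> - \<theta>) * (t / T) powr - \<delta>) * blog (A - B) T \<le> K * (T powr (\<pi> - \<theta>) * (t / T) powr - \<delta>) * blog (A - B) T"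
      using K blog_pos[of "A - B" T] by (intro mult_right_mono) auto
    finally show ?thesis using False by (simp add: max_def \<rho>_def mult_ac)
  qed
  \<comment> \<open>Bounds the \<open>b\<close>-norm of \<open>\<rho> T\<close> for the measure
    \<open>dt / t\<close>; for finite \<open>b\<close> the \<open>b\<close>-th power integrates to
    \<open>1 / (\<delta> * b)\<close> on each side of \<open>T\<close>. This measure is invariant
    under dilations, so \<open>L\<close> does not depend on \<open>T\<close>.\<close>
  define L where "L = (if b = \<infinity> then 1 else (2 / (\<delta> * enn2real b)) powr recip b)"
  have L: "0 < L" using \<delta> assms(2) by (cases b) (auto simp: L_def)
  show ?thesis
  proof (rule that[of "K * L"])
    fix G :: "'a \<Rightarrow> complex" and X and T :: real
    assume [measurable]: "G \<in> borel_measurable borel" and T: "0 < T"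
      and le: "\<And>t. 0 < t \<Longrightarrow> ennreal (max t T powr \<theta> * blog B (max t T)) * rearr G t \<le> X"
    define D where "D = K * T powr (\<pi> - \<theta>) * blog (A - B) T"
    have D: "0 < D" using K T blog_pos[of "A - B" T] by (simp add: D_def)
    have h: "ennreal (t powr (recip p - recip b) * blog A t) * rearr G t \<le> ennreal (t powr - recip b * \<rho> T t) * (ennreal D * X)"
      if t: "0 < t" for t
    proof -
      let ?w = "max t T powr \<theta> * blog B (max t T)"
      have w: "0 < ?w" using T blog_pos[of B "max t T"] by simp
      have "t powr (recip p - recip b) * blog A t = (t powr - recip b * (t powr \<pi> * blog A t / ?w)) * ?w"
        using less_imp_neq[OF w] t by (simp add: \<pi>_def powr_diff powr_minus divide_inverse mult_ac)
      then have "ennreal (t powr (recip p - recip b) * blog A t) * rearr G t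
        = ennreal (t powr - recip b * (t powr \<pi> * blog A t / ?w)) * (ennreal ?w * rearr G t)"
        using w blog_pos[of A t]
        by (metis (no_types, lifting) divide_nonneg_pos ennreal_mult less_imp_le mult.assoc mult_nonneg_nonneg powr_ge_zero)
      also have "\<dots> \<le> ennreal (t powr - recip b * (D * \<rho> T t)) * X"
        using le[OF t] weight[OF t T] unfolding D_def
        by (intro mult_mono ennreal_leI mult_left_mono) auto
      also have "\<dots> = ennreal (t powr - recip b * \<rho> T t) * (ennreal D * X)"
        using D \<rho>0 by (simp add: ennreal_mult mult_ac)
      finally show ?thesis .
    qed
    have "lz_norm p b A G \<le> Lb_norm b (\<lambda>t. ennreal (t powr - recip b * \<rho> T t) * (ennreal D * X))"
      unfolding lz_norm_def by (rule Lb_norm_mono[OF h]) auto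
    also have "\<dots> \<le> ennreal (D * L) * X"
    proof (cases "b = \<infinity>")
      case True
      have "\<rho> T t \<le> 1" if "0 < t" for t
        using that T \<delta> powr_mono2[of \<delta> "t / T" 1] ge_one_powr_ge_zero[of "t / T" \<delta>]
        by (auto simp: \<rho>_def powr_minus field_simps)
      then have "ennreal (t powr - recip b * \<rho> T t) * (ennreal D * X) \<le> ennreal 1 * (ennreal D * X)" if "0 < t" for t
        using True that by (intro mult_right_mono ennreal_leI) auto
      then show ?thesis using True unfolding Lb_norm_def L_def
        by (auto simp: AE_restrict_space_iff intro!: esssup_I measurable_restrict_space1)
    next
      case False
      then obtain r where r: "b = ennreal r" "0 < r" using assms(2) by (cases b) auto
      let ?X = "epowr (ennreal D * X) r"
      have eq: "epowr (ennreal (t powr - recip b * \<rho> T t) * (ennreal D * X)) r = ennreal (t powr - 1 * \<rho> T t powr r) * ?X"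
        if "0 < t" for t
      proof -
        have "0 < \<rho> T t" using that T by (auto simp: \<rho>_def)
        then show ?thesis using that r by (simp add: epowr_cmult recip_ennreal powr_mult powr_powr)
      qed
      have "(\<integral>\<^sup>+t\<in>{0<..}. epowr (ennreal (t powr - recip b * \<rho> T t) * (ennreal D * X)) r \<partial>lborel)
        = (\<integral>\<^sup>+t. (ennreal (t powr - 1 * \<rho> T t powr r) * indicator {0<..} t) * ?X \<partial>lborel)"
        by (intro nn_integral_cong) (auto simp: eq split: split_indicator)
      also have "\<dots> = (\<integral>\<^sup>+t\<in>{0<..}. ennreal (t powr - 1 * \<rho> T t powr r) \<partial>lborel) * ?X"
        by (rule nn_integral_multc) measurable
      also have "(\<integral>\<^sup>+t\<in>{0<..}. ennreal (t powr - 1 * \<rho> T t powr r) \<partial>lborel) \<le> ennreal (2 / (\<delta> * r))"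
      proof -
        have "(\<integral>\<^sup>+t\<in>{0<..}. ennreal (t powr - 1 * \<rho> T t powr r) \<partial>lborel)
          = (\<integral>\<^sup>+t. ennreal (T powr - (\<delta> * r)) * (ennreal (t powr (\<delta> * r - 1)) * indicator {0<..<T} t)
            + ennreal (T powr (\<delta> * r)) * (ennreal (t powr (- (\<delta> * r) - 1)) * indicator {T<..} t) \<partial>lborel)"
        \<comment> \<open>The two pieces leave out the point \<open>t = T\<close>, a null
          set.\<close>
        proof (intro nn_integral_cong_AE)
          show "AE t in lborel. ennreal (t powr - 1 * \<rho> T t powr r) * indicator {0<..} t
            = ennreal (T powr - (\<delta> * r)) * (ennreal (t powr (\<delta> * r - 1)) * indicator {0<..<T} t)
            + ennreal (T powr (\<delta> * r)) * (ennreal (t powr (- (\<delta> * r) - 1)) * indicator {T<..} t)"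
            using AE_lborel_singleton[of T]
          proof eventually_elim
            case (elim t)
            then show ?case using T
              by (auto simp: \<rho>_def powr_powr powr_divide powr_diff powr_minus divide_simps ennreal_mult[symmetric]
                  split: split_indicator)
          qed
        qed
        also have "\<dots> = ennreal (T powr - (\<delta> * r)) * (\<integral>\<^sup>+t\<in>{0<..<T}. ennreal (t powr (\<delta> * r - 1)) \<partial>lborel)
            + ennreal (T powr (\<delta> * r)) * (\<integral>\<^sup>+t\<in>{T<..}. ennreal (t powr (- (\<delta> * r) - 1)) \<partial>lborel)"
          by (simp add: nn_integral_add nn_integral_cmult)
        also have "\<dots> \<le> ennreal (T powr - (\<delta> * r)) * ennreal (T powr (\<delta> * r) / (\<delta> * r))
            + ennreal (T powr (\<delta> * r)) * ennreal (T powr - (\<delta> * r) / (\<delta> * r))"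
          using nn_integral_powr_from_0[of "\<delta> * r - 1" T] nn_integral_powr_to_inf[of "- (\<delta> * r) - 1" T] \<delta> r T
          by (intro add_mono mult_left_mono) auto
        also have "\<dots> = ennreal (T powr - (\<delta> * r) * (T powr (\<delta> * r) / (\<delta> * r)) + T powr (\<delta> * r) * (T powr - (\<delta> * r) / (\<delta> * r)))"
          using \<delta> r by (subst ennreal_plus) (auto simp: ennreal_mult[symmetric])
        also have "T powr - (\<delta> * r) * (T powr (\<delta> * r) / (\<delta> * r)) + T powr (\<delta> * r) * (T powr - (\<delta> * r) / (\<delta> * r)) = 2 / (\<delta> * r)"
          using T by (simp add: powr_minus field_simps)
        finally show ?thesis .
      qed
      finally have "(\<integral>\<^sup>+t\<in>{0<..}. epowr (ennreal (t powr - recip b * \<rho> T t) * (ennreal D * X)) r \<partial>lborel) \<le> ennreal (2 / (\<delta> * r)) * ?X"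
        by (simp add: mult_right_mono)
      then have "Lb_norm b (\<lambda>t. ennreal (t powr - recip b * \<rho> T t) * (ennreal D * X)) \<le> epowr (ennreal (2 / (\<delta> * r)) * ?X) (1 / r)"
        using r by (simp add: Lb_norm_def recip_ennreal epowr_mono)
      also have "\<dots> = ennreal L * (ennreal D * X)"
        using r \<delta> by (simp add: epowr_cmult epowr_epowr L_def recip_ennreal)
      also have "\<dots> = ennreal (D * L) * X" using D L by (simp add: ennreal_mult mult_ac)
      finally show ?thesis .
    qed
    finally show "lz_norm p b A G \<le> ennreal (K * L * T powr (recip p - \<theta>) * blog (A - B) T) * X"
      by (simp add: D_def \<pi>_def mult_ac)
  qed (use K L in simp)
qed

subsection \<open>Integration on Euclidean space\<close>

text \<open>Lebesgue measure on a Euclidean space is the image of a product of copies of the line,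
  one per basis vector, so functions that split over the coordinates reduce to dimension one. The
  Gaussian and the majorant of the decay weight below are of this kind.\<close>

lemma lborel_prod_basis:
  fixes f :: "'a::euclidean_space \<Rightarrow> real \<Rightarrow> 'b::{real_normed_field,banach,second_countable_topology}"
  assumes "\<And>b. b \<in> Basis \<Longrightarrow> integrable lborel (f b)"
  shows integrable_lborel_prod_basis: "integrable lborel (\<lambda>x::'a. \<Prod>b\<in>Basis. f b (x \<bullet> b))"
    and integral_lborel_prod_basis:
      "(\<integral>x. (\<Prod>b\<in>Basis. f b (x \<bullet> b)) \<partial>(lborel :: 'a measure)) = (\<Prod>b\<in>Basis. \<integral>t. f b t \<partial>lborel)"
proof -
  interpret product_sigma_finite "\<lambda>_::'a. lborel::real measure" ..
  have [measurable]: "f b \<in> borel_measurable borel" if "b \<in> Basis" for b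
    using borel_measurable_integrable[OF assms[OF that]] by simp
  have m: "(\<lambda>x::'a. \<Prod>b\<in>Basis. f b (x \<bullet> b)) \<in> borel_measurable borel"
    by measurable
  have m': "(\<lambda>g. \<Sum>b\<in>Basis. g b *\<^sub>R b) \<in> measurable (\<Pi>\<^sub>M b\<in>Basis. lborel) (borel :: 'a measure)"
    by measurable
  show "integrable lborel (\<lambda>x::'a. \<Prod>b\<in>Basis. f b (x \<bullet> b))"
    unfolding lborel_eq[where ?'a='a] integrable_distr_eq[OF m' m]
    using product_integrable_prod[of Basis f] assms by simp
  show "(\<integral>x. (\<Prod>b\<in>Basis. f b (x \<bullet> b)) \<partial>(lborel :: 'a measure)) = (\<Prod>b\<in>Basis. \<integral>t. f b t \<partial>lborel)"
    unfolding lborel_eq[where ?'a='a] integral_distr[OF m' m]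
    using product_integral_prod[of Basis f] assms by simp
qed

lemma lborel_affine_integral:
  fixes f :: "'a::euclidean_space \<Rightarrow> 'b::{banach, second_countable_topology}"
  assumes c: "c \<noteq> 0" and [measurable]: "f \<in> borel_measurable borel"
  shows integrable_lborel_affine: "integrable lborel f \<Longrightarrow> integrable lborel (\<lambda>x. f (t + c *\<^sub>R x))"
    and integral_lborel_affine:
      "(\<integral>x. f x \<partial>lborel) = \<bar>c\<bar> ^ DIM('a) *\<^sub>R (\<integral>x. f (t + c *\<^sub>R x) \<partial>lborel)"
proof -
  have eq: "lborel = density (distr lborel borel (\<lambda>x. t + c *\<^sub>R x)) (\<lambda>_. ennreal (\<bar>c\<bar> ^ DIM('a)))"
    using lborel_affine[OF c, of t] by (simp add: ennreal_power)
  show "integrable lborel (\<lambda>x. f (t + c *\<^sub>R x))" if "integrable lborel f"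
  proof -
    have "integrable lborel (\<lambda>x. \<bar>c\<bar> ^ DIM('a) *\<^sub>R f (t + c *\<^sub>R x))"
      using that c by (subst (asm) eq) (simp add: integrable_density integrable_distr_eq)
    then have "integrable lborel (\<lambda>x. inverse (\<bar>c\<bar> ^ DIM('a)) *\<^sub>R \<bar>c\<bar> ^ DIM('a) *\<^sub>R f (t + c *\<^sub>R x))"
      by (rule integrable_scaleR_right)
    then show ?thesis using c by simp
  qed
  show "(\<integral>x. f x \<partial>lborel) = \<bar>c\<bar> ^ DIM('a) *\<^sub>R (\<integral>x. f (t + c *\<^sub>R x) \<partial>lborel)"
    by (subst eq) (simp add: integral_density integral_distr)
qed

subsection \<open>Rapidly decreasing functions\<close>

text \<open>Schwartz decay without derivatives. The reproducing kernels are used only through this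
  property: in a convolution with a test function, smoothness is supplied by the test
  function.\<close>

definition rapid :: "('a::euclidean_space \<Rightarrow> complex) \<Rightarrow> bool" where
  "rapid f \<longleftrightarrow> f \<in> borel_measurable borel \<and> (\<forall>N. \<exists>C. \<forall>x. (1 + norm x) ^ N * norm (f x) \<le> C)"

lemma rapid_measurable: "rapid f \<Longrightarrow> f \<in> borel_measurable borel"
  by (simp add: rapid_def)

lemma one_plus_norm_pos: "0 < 1 + norm x"
  using norm_ge_zero[of x] by linarith

lemma rapid_bound:
  assumes "rapid f"
  obtains C where "0 < C" "\<And>x. norm (f x) \<le> C / (1 + norm x) ^ N"
proof -
  obtain C where C: "\<And>x. (1 + norm x) ^ N * norm (f x) \<le> C" using assms by (auto simp: rapid_def)
  have "norm (f x) \<le> max C 1 / (1 + norm x) ^ N" for x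
    using C[of x] one_plus_norm_pos[of x] by (simp add: field_simps max_def split: if_splits)
  then show ?thesis by (intro that[of "max C 1"]) auto
qed

text \<open>Each factor \<open>1 + (x \<bullet> b)\<^sup>2\<close> is at most
  \<open>(1 + norm x)\<^sup>2\<close>, so the product over the basis is below
  \<open>(1 + norm x) ^ (2 * DIM('a))\<close>, and integrability in one dimension suffices; hence
  the exponent.\<close>

lemma integrable_inverse_power_norm:
  "integrable lborel (\<lambda>x::'a::euclidean_space. 1 / (1 + norm x) ^ (2 * DIM('a)))"
proof (rule Bochner_Integration.integrable_bound)
  have "integrable lborel (\<lambda>t::real. inverse (1 + t\<^sup>2))"
    using integrable_inverse_1_plus_square by (simp add: set_integrable_def)
  then show "integrable lborel (\<lambda>x::'a. \<Prod>b\<in>Basis. inverse (1 + (x \<bullet> b)\<^sup>2))"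
    by (intro integrable_lborel_prod_basis)
  show "AE x::'a in lborel. norm (1 / (1 + norm x) ^ (2 * DIM('a))) \<le> norm (\<Prod>b\<in>Basis. inverse (1 + (x \<bullet> b)\<^sup>2) :: real)"
  proof (rule AE_I2)
    fix x :: 'a
    have "(\<Prod>b\<in>(Basis::'a set). 1 + (x \<bullet> b)\<^sup>2) \<le> (\<Prod>b\<in>(Basis::'a set). (1 + norm x)\<^sup>2)"
    proof (intro prod_mono conjI)
      fix b :: 'a assume b: "b \<in> Basis"
      have "(x \<bullet> b)\<^sup>2 \<le> (norm x)\<^sup>2"
        using Basis_le_norm[OF b, of x] by (metis abs_ge_zero power2_abs power_mono)
      then show "1 + (x \<bullet> b)\<^sup>2 \<le> (1 + norm x)\<^sup>2"
        by (simp add: power2_sum add_increasing2)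
    qed simp
    also have "\<dots> = (1 + norm x) ^ (2 * DIM('a))" by (simp add: power_mult)
    finally have "inverse ((1 + norm x) ^ (2 * DIM('a))) \<le> inverse (\<Prod>b\<in>(Basis::'a set). 1 + (x \<bullet> b)\<^sup>2)"
      by (intro le_imp_inverse_le prod_pos) (auto intro: add_pos_nonneg)
    then have "1 / (1 + norm x) ^ (2 * DIM('a)) \<le> (\<Prod>b\<in>(Basis::'a set). inverse (1 + (x \<bullet> b)\<^sup>2))"
      by (simp add: inverse_eq_divide prod_dividef)
    then show "norm (1 / (1 + norm x) ^ (2 * DIM('a))) \<le> norm (\<Prod>b\<in>Basis. inverse (1 + (x \<bullet> b)\<^sup>2) :: real)"
      using one_plus_norm_pos[of x] by simp
  qed
qed measurable

lemma rapid_integrable: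
  assumes "rapid (f :: 'a::euclidean_space \<Rightarrow> complex)"
  shows "integrable lborel f"
proof -
  obtain C where C: "0 < C" "\<And>x. norm (f x) \<le> C / (1 + norm x) ^ (2 * DIM('a))"
    using rapid_bound[OF assms] by metis
  show ?thesis
  proof (rule Bochner_Integration.integrable_bound)
    show "integrable lborel (\<lambda>x::'a. C * (1 / (1 + norm x) ^ (2 * DIM('a))))"
      by (intro integrable_mult_right integrable_inverse_power_norm)
    show "f \<in> borel_measurable lborel" using rapid_measurable[OF assms] by simp
    show "AE x in lborel. norm (f x) \<le> norm (C * (1 / (1 + norm x) ^ (2 * DIM('a))))"
      using C one_plus_norm_pos by (auto intro!: AE_I2 simp: abs_mult less_imp_le)
  qed
qed

lemma rapid_weight:
  assumes "rapid f"
  shows "rapid (\<lambda>x. complex_of_real ((1 + norm x) ^ M) * f x)"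
  unfolding rapid_def
proof (intro conjI allI)
  show "(\<lambda>x. complex_of_real ((1 + norm x) ^ M) * f x) \<in> borel_measurable borel"
    using rapid_measurable[OF assms] by measurable
  fix N
  obtain C where "\<And>x. (1 + norm x) ^ (N + M) * norm (f x) \<le> C" using assms unfolding rapid_def by blast
  then show "\<exists>C. \<forall>x. (1 + norm x) ^ N * norm (complex_of_real ((1 + norm x) ^ M) * f x) \<le> C"
    by (intro exI[of _ C]) (auto simp: norm_mult norm_power power_add mult.assoc simp del: of_real_power of_real_add)
qed

lemma rapid_dilate:
  assumes "rapid f" "0 < r"
  shows "rapid (\<lambda>x. f (r *\<^sub>R x))"
  unfolding rapid_def
proof (intro conjI allI)
  show "(\<lambda>x. f (r *\<^sub>R x)) \<in> borel_measurable borel"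
    using rapid_measurable[OF assms(1)] by measurable
  fix N
  obtain C where C: "\<And>x. (1 + norm x) ^ N * norm (f x) \<le> C" using assms unfolding rapid_def by blast
  let ?R = "max 1 (1 / r)"
  have "(1 + norm x) ^ N * norm (f (r *\<^sub>R x)) \<le> ?R ^ N * C" for x
  proof -
    have "1 + norm x \<le> ?R * (1 + norm (r *\<^sub>R x))"
    proof -
      have "norm x = 1 / r * norm (r *\<^sub>R x)" using assms(2) by simp
      also have "\<dots> \<le> ?R * norm (r *\<^sub>R x)" by (intro mult_right_mono) auto
      finally show ?thesis by (simp add: distrib_left)
    qed
    then have "(1 + norm x) ^ N \<le> (?R * (1 + norm (r *\<^sub>R x))) ^ N" by (intro power_mono) auto
    then have "(1 + norm x) ^ N * norm (f (r *\<^sub>R x)) \<le> (?R * (1 + norm (r *\<^sub>R x))) ^ N * norm (f (r *\<^sub>R x))"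
      by (intro mult_right_mono) auto
    also have "\<dots> = ?R ^ N * ((1 + norm (r *\<^sub>R x)) ^ N * norm (f (r *\<^sub>R x)))"
      by (simp add: power_mult_distrib mult.assoc)
    also have "\<dots> \<le> ?R ^ N * C" by (intro mult_left_mono C) auto
    finally show ?thesis .
  qed
  then show "\<exists>C. \<forall>x. (1 + norm x) ^ N * norm (f (r *\<^sub>R x)) \<le> C" by blast
qed

lemma rapid_cmult:
  assumes "rapid f"
  shows "rapid (\<lambda>x. c * f x)"
  unfolding rapid_def
proof (intro conjI allI)
  show "(\<lambda>x. c * f x) \<in> borel_measurable borel"
    using rapid_measurable[OF assms(1)] by measurable
  fix N
  obtain C where C: "\<And>x. (1 + norm x) ^ N * norm (f x) \<le> C" using assms unfolding rapid_def by blast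
  have "(1 + norm x) ^ N * norm (c * f x) \<le> norm c * C" for x
    using mult_left_mono[OF C[of x], of "norm c"] by (simp add: norm_mult mult_ac)
  then show "\<exists>C. \<forall>x. (1 + norm x) ^ N * norm (c * f x) \<le> C" by blast
qed

lemma rapid_sum:
  assumes "finite I" "\<And>i. i \<in> I \<Longrightarrow> rapid (f i)"
  shows "rapid (\<lambda>x. \<Sum>i\<in>I. f i x)"
  unfolding rapid_def
proof (intro conjI allI)
  show "(\<lambda>x. \<Sum>i\<in>I. f i x) \<in> borel_measurable borel"
    using rapid_measurable[OF assms(2)] by (intro borel_measurable_sum) auto
  fix N
  have "\<forall>i\<in>I. \<exists>C. \<forall>x. (1 + norm x) ^ N * norm (f i x) \<le> C" using assms(2) unfolding rapid_def by blast
  then obtain C where C: "\<And>i x. i \<in> I \<Longrightarrow> (1 + norm x) ^ N * norm (f i x) \<le> C i" by metis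
  have "(1 + norm x) ^ N * norm (\<Sum>i\<in>I. f i x) \<le> (\<Sum>i\<in>I. C i)" for x
  proof -
    have "(1 + norm x) ^ N * norm (\<Sum>i\<in>I. f i x) \<le> (1 + norm x) ^ N * (\<Sum>i\<in>I. norm (f i x))"
      by (intro mult_left_mono norm_sum) auto
    also have "\<dots> \<le> (\<Sum>i\<in>I. C i)" unfolding sum_distrib_left by (intro sum_mono C)
    finally show ?thesis .
  qed
  then show "\<exists>C. \<forall>x. (1 + norm x) ^ N * norm (\<Sum>i\<in>I. f i x) \<le> C" by blast
qed

subsection \<open>Schwartz functions\<close>

lemma schwartz_differentiable:
  "f \<in> schwartz \<Longrightarrow> vs \<in> lists Basis \<Longrightarrow> iter_deriv vs f differentiable (at x)"
  by (simp add: schwartz_def)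

lemma iter_deriv_append: "iter_deriv (us @ vs) f = iter_deriv us (iter_deriv vs f)"
  by (induction us) auto

lemma schwartz_iter_deriv: "f \<in> schwartz \<Longrightarrow> vs \<in> lists Basis \<Longrightarrow> iter_deriv vs f \<in> schwartz"
  unfolding schwartz_def by (auto simp: iter_deriv_append[symmetric])

lemma schwartz_deriv:
  assumes "f \<in> schwartz" "b \<in> Basis"
  shows "(\<lambda>x. frechet_derivative f (at x) b) \<in> schwartz"
  using schwartz_iter_deriv[OF assms(1), of "[b]"] assms(2) by simp

lemma schwartz_has_derivative:
  "f \<in> schwartz \<Longrightarrow> (f has_derivative frechet_derivative f (at x)) (at x)"
  using schwartz_differentiable[of f "[]" x] by (simp add: frechet_derivative_works)

lemma schwartz_continuous: "f \<in> schwartz \<Longrightarrow> continuous_on UNIV f"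
  by (meson continuous_at_imp_continuous_on has_derivative_continuous schwartz_has_derivative)

lemma schwartz_rapid:
  assumes "f \<in> schwartz"
  shows "rapid f"
proof -
  have "\<exists>C. \<forall>x. (1 + norm x) ^ N * norm (f x) \<le> C" for N
  proof -
    have "bounded (range (\<lambda>x. (1 + norm x) ^ N * norm (iter_deriv [] f x)))"
      using assms unfolding schwartz_def by blast
    then obtain C where "\<forall>y\<in>range (\<lambda>x. (1 + norm x) ^ N * norm (f x)). norm y \<le> C"
      unfolding bounded_iff by auto
    then show ?thesis by (intro exI[of _ C]) (auto intro: order_trans[OF abs_ge_self])
  qed
  then show ?thesis
    unfolding rapid_def using borel_measurable_continuous_onI[OF schwartz_continuous[OF assms]] by blast
qed

lemma schwartz_measurable: "f \<in> schwartz \<Longrightarrow> f \<in> borel_measurable borel"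
  by (simp add: schwartz_rapid rapid_measurable)

lemma schwartz_deriv_expand:
  assumes "f \<in> schwartz"
  shows "frechet_derivative f (at x) v = (\<Sum>b\<in>Basis. (v \<bullet> b) *\<^sub>R frechet_derivative f (at x) b)"
proof -
  interpret bounded_linear "frechet_derivative f (at x)"
    using schwartz_has_derivative[OF assms] by (rule has_derivative_bounded_linear)
  have "frechet_derivative f (at x) v = frechet_derivative f (at x) (\<Sum>b\<in>Basis. (v \<bullet> b) *\<^sub>R b)"
    by (simp add: euclidean_representation)
  then show ?thesis by (simp add: sum scaleR)
qed

lemma schwartz_onorm_bound:
  fixes f :: "'a::euclidean_space \<Rightarrow> complex"
  assumes "f \<in> schwartz"
  obtains C where "0 < C" "\<And>x. onorm (frechet_derivative f (at x)) \<le> C / (1 + norm x) ^ N"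
proof -
  have "\<exists>C>0. \<forall>x. norm (frechet_derivative f (at x) b) \<le> C / (1 + norm x) ^ N" if "b \<in> Basis" for b
    using rapid_bound[OF schwartz_rapid[OF schwartz_deriv[OF assms that]]] by metis
  then obtain C where C: "\<And>b x. b \<in> Basis \<Longrightarrow> norm (frechet_derivative f (at x) b) \<le> C b / (1 + norm x) ^ N"
    and C0: "\<And>b. b \<in> Basis \<Longrightarrow> 0 < C b"
    by metis
  have "onorm (frechet_derivative f (at x)) \<le> (\<Sum>b\<in>Basis. C b) / (1 + norm x) ^ N" for x
  proof (rule onorm_bound)
    show "0 \<le> (\<Sum>b\<in>Basis. C b) / (1 + norm x) ^ N"
      using C0 one_plus_norm_pos[of x] by (intro divide_nonneg_pos sum_nonneg) (auto simp: less_imp_le)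
    fix v
    have "norm (frechet_derivative f (at x) v) \<le> (\<Sum>b\<in>Basis. norm ((v \<bullet> b) *\<^sub>R frechet_derivative f (at x) b))"
      unfolding schwartz_deriv_expand[OF assms, of x v] by (rule norm_sum)
    also have "\<dots> \<le> (\<Sum>b\<in>Basis. norm v * (C b / (1 + norm x) ^ N))"
    proof (intro sum_mono)
      fix b :: 'a assume b: "b \<in> Basis"
      show "norm ((v \<bullet> b) *\<^sub>R frechet_derivative f (at x) b) \<le> norm v * (C b / (1 + norm x) ^ N)"
        unfolding norm_scaleR by (intro mult_mono C b) (auto simp: Basis_le_norm b)
    qed
    also have "\<dots> = (\<Sum>b\<in>Basis. C b) / (1 + norm x) ^ N * norm v"
      by (simp add: sum_distrib_left sum_divide_distrib sum_distrib_right mult.commute)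
    finally show "norm (frechet_derivative f (at x) v) \<le> (\<Sum>b\<in>Basis. C b) / (1 + norm x) ^ N * norm v" .
  qed
  then show ?thesis using C0 by (intro that[of "\<Sum>b\<in>Basis. C b"]) (auto intro!: sum_pos)
qed

text \<open>The mean value inequality on the unit ball around \<open>x\<close>, where
  \<open>1 + norm y\<close> is at least half of \<open>1 + norm x\<close>; this costs
  \<open>2 ^ N\<close>. For large \<open>N\<close> all difference quotients in a fixed direction
  have one integrable majorant.\<close>

lemma schwartz_difference_bound:
  fixes f :: "'a::euclidean_space \<Rightarrow> complex"
  assumes "f \<in> schwartz"
  obtains C where "0 < C" "\<And>x v. norm v \<le> 1 \<Longrightarrow> norm (f (x + v) - f x) \<le> C * norm v / (1 + norm x) ^ N"
proof -
  obtain C where C: "0 < C" "\<And>x. onorm (frechet_derivative f (at x)) \<le> C / (1 + norm x) ^ N"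
    using schwartz_onorm_bound[OF assms] by metis
  have "norm (f (x + v) - f x) \<le> (2 ^ N * C) * norm v / (1 + norm x) ^ N" if v: "norm v \<le> 1" for x v
  proof -
    have "norm (f (x + v) - f x) \<le> (2 ^ N * C / (1 + norm x) ^ N) * norm ((x + v) - x)"
    proof (rule differentiable_bound[of "cball x 1" f "\<lambda>y. frechet_derivative f (at y)"])
      fix y assume y: "y \<in> cball x 1"
      show "(f has_derivative frechet_derivative f (at y)) (at y within cball x 1)"
        using schwartz_has_derivative[OF assms] by (rule has_derivative_at_withinI)
      have "norm x \<le> norm y + 1"
        using y norm_triangle_ineq[of y "x - y"] by (simp add: dist_norm)
      moreover have "0 \<le> norm y" by simp
      ultimately have "1 + norm x \<le> 2 * (1 + norm y)" by (smt (verit))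
      then have "(1 + norm x) ^ N \<le> 2 ^ N * (1 + norm y) ^ N"
        unfolding power_mult_distrib[symmetric] by (intro power_mono) auto
      then have "C / (1 + norm y) ^ N \<le> 2 ^ N * C / (1 + norm x) ^ N"
        using C(1) one_plus_norm_pos[of x] one_plus_norm_pos[of y]
        by (simp add: frac_le divide_simps)
      then show "onorm (frechet_derivative f (at y)) \<le> 2 ^ N * C / (1 + norm x) ^ N"
        using C(2)[of y] by linarith
    qed (use v in \<open>auto simp: dist_norm\<close>)
    then show ?thesis by simp
  qed
  then show ?thesis using C by (intro that[of "2 ^ N * C"]) auto
qed

subsection \<open>The Fourier transform\<close>

definition euclidean_convolution ::
    "('a::euclidean_space \<Rightarrow> complex) \<Rightarrow> ('a \<Rightarrow> complex) \<Rightarrow> 'a \<Rightarrow> complex" where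
  "euclidean_convolution \<kappa> \<psi> x = (\<integral>z. \<kappa> z * \<psi> (x - z) \<partial>lborel)"

lemma cis_measurable [measurable]: "cis \<in> borel_measurable borel"
  by (intro borel_measurable_continuous_onI continuous_intros)

lemma integrable_unimodular_mult:
  fixes f :: "'a \<Rightarrow> complex"
  assumes "integrable M f" "k \<in> borel_measurable M" "\<And>x. norm (k x) = 1"
  shows "integrable M (\<lambda>x. k x * f x)"
  using assms by (intro Bochner_Integration.integrable_bound[OF assms(1)]) (auto simp: norm_mult)

lemma vector_derivative_difference_quotient:
  fixes g :: "real \<Rightarrow> complex"
  assumes g: "(g has_vector_derivative D) (at 0)" and e: "e \<longlonglongrightarrow> 0" "\<And>m. e m \<noteq> 0"
  shows "(\<lambda>m. (g (e m) - g 0) / e m) \<longlonglongrightarrow> D"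
proof -
  have "(\<lambda>h. norm (g (0 + h) - g 0 - h *\<^sub>R D) / norm h) \<midarrow>0\<rightarrow> 0"
    using g unfolding has_vector_derivative_def has_derivative_at by simp
  moreover have "filterlim e (at 0) sequentially"
    using e by (intro filterlim_atI) auto
  ultimately have "(\<lambda>m. norm (g (0 + e m) - g 0 - e m *\<^sub>R D) / norm (e m)) \<longlonglongrightarrow> 0"
    by (rule filterlim_compose)
  also have "(\<lambda>m. norm (g (0 + e m) - g 0 - e m *\<^sub>R D) / norm (e m)) = (\<lambda>m. norm ((g (e m) - g 0) / e m - D))"
  proof
    fix m
    have "(g (e m) - g 0) / e m - D = (g (0 + e m) - g 0 - e m *\<^sub>R D) / complex_of_real (e m)"
      using e(2)[of m] by (simp add: field_simps scaleR_conv_of_real)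
    then show "norm (g (0 + e m) - g 0 - e m *\<^sub>R D) / norm (e m) = norm ((g (e m) - g 0) / e m - D)"
      by (simp add: norm_divide)
  qed
  finally have "(\<lambda>m. (g (e m) - g 0) / e m - D) \<longlonglongrightarrow> 0" by (rule tendsto_norm_zero_cancel)
  then show ?thesis by (rule LIM_zero_cancel)
qed

text \<open>
  Instead of integrating by parts, differentiate the translation rule
  \<open>F(f(\<cdot> + t b))(\<xi>) = cis (2 \<pi> t (\<xi> \<bullet> b)) * F f(\<xi>)\<close> at \<open>t = 0\<close>.
\<close>

lemma fourier_deriv:
  fixes f :: "'a::euclidean_space \<Rightarrow> complex"
  assumes f: "f \<in> schwartz" and b: "b \<in> Basis"
  shows "fourier (\<lambda>x. frechet_derivative f (at x) b) \<xi> = 2 * pi * \<i> * (\<xi> \<bullet> b) * fourier f \<xi>"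
proof -
  define e where "e m = inverse (real (Suc m))" for m
  have e: "0 < e m" "e m \<le> 1" for m by (auto simp: e_def inverse_eq_divide)
  have e0: "e \<longlonglongrightarrow> 0" unfolding e_def by (rule LIMSEQ_inverse_real_of_nat)
  have [measurable]: "f \<in> borel_measurable borel" by (rule schwartz_measurable[OF f])
  have [measurable]: "(\<lambda>x. frechet_derivative f (at x) b) \<in> borel_measurable borel"
    by (rule schwartz_measurable[OF schwartz_deriv[OF f b]])
  have int: "integrable lborel f" by (rule rapid_integrable[OF schwartz_rapid[OF f]])
  let ?c = "\<lambda>x. cis (- 2 * pi * (x \<bullet> \<xi>))"
  define u where "u m x = ?c x * ((f (x + e m *\<^sub>R b) - f x) / e m)" for m x
  have [measurable]: "u m \<in> borel_measurable borel" for m unfolding u_def by measurable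
  obtain C where C: "0 < C" "\<And>x v. norm v \<le> 1 \<Longrightarrow> norm (f (x + v) - f x) \<le> C * norm v / (1 + norm x) ^ (2 * DIM('a))"
    using schwartz_difference_bound[OF f] by metis
  have "(\<lambda>m. integral\<^sup>L lborel (u m)) \<longlonglongrightarrow> (\<integral>x. ?c x * frechet_derivative f (at x) b \<partial>lborel)"
  proof (rule integral_dominated_convergence)
    show "integrable lborel (\<lambda>x::'a. C * (1 / (1 + norm x) ^ (2 * DIM('a))))"
      by (intro integrable_mult_right integrable_inverse_power_norm)
    show "AE x in lborel. norm (u m x) \<le> C * (1 / (1 + norm x) ^ (2 * DIM('a)))" for m
    proof (rule AE_I2)
      fix x :: 'a
      have "norm (f (x + e m *\<^sub>R b) - f x) \<le> C * norm (e m *\<^sub>R b) / (1 + norm x) ^ (2 * DIM('a))"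
        using e[of m] b by (intro C) auto
      then have "norm (f (x + e m *\<^sub>R b) - f x) / e m \<le> (C * norm (e m *\<^sub>R b) / (1 + norm x) ^ (2 * DIM('a))) / e m"
        using e[of m] by (intro divide_right_mono) auto
      then show "norm (u m x) \<le> C * (1 / (1 + norm x) ^ (2 * DIM('a)))"
        using e[of m] b by (simp add: u_def norm_mult norm_divide)
    qed
    show "AE x in lborel. (\<lambda>m. u m x) \<longlonglongrightarrow> ?c x * frechet_derivative f (at x) b"
    proof (rule AE_I2)
      fix x :: 'a
      have "((\<lambda>t::real. x + t *\<^sub>R b) has_derivative (\<lambda>t. t *\<^sub>R b)) (at 0)"
        by (auto intro!: derivative_eq_intros)
      moreover have "(f has_derivative frechet_derivative f (at x)) (at (x + (0::real) *\<^sub>R b))"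
        using schwartz_has_derivative[OF f, of x] by simp
      ultimately have "((\<lambda>t::real. f (x + t *\<^sub>R b)) has_derivative (\<lambda>t. frechet_derivative f (at x) (t *\<^sub>R b))) (at 0)"
        by (rule has_derivative_compose)
      then have "((\<lambda>t::real. f (x + t *\<^sub>R b)) has_vector_derivative frechet_derivative f (at x) b) (at 0)"
        unfolding has_vector_derivative_def
        by (simp add: linear_scale[OF has_derivative_linear[OF schwartz_has_derivative[OF f]]])
      then have "(\<lambda>m. (f (x + e m *\<^sub>R b) - f (x + 0 *\<^sub>R b)) / e m) \<longlonglongrightarrow> frechet_derivative f (at x) b"
        using e by (intro vector_derivative_difference_quotient[OF _ e0]) (auto simp: less_imp_neq[symmetric])
      then show "(\<lambda>m. u m x) \<longlonglongrightarrow> ?c x * frechet_derivative f (at x) b"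
        unfolding u_def by (intro tendsto_mult tendsto_const) simp
    qed
  qed measurable
  \<comment> \<open>Substituting \<open>x + e m *\<^sub>R b\<close> for \<open>x\<close> evaluates
    the same integral exactly, so its limit can be read off from the derivative of
    \<open>cis\<close> at \<open>0\<close>.\<close>
  moreover have "integral\<^sup>L lborel (u m) = (cis (2 * pi * e m * (\<xi> \<bullet> b)) - 1) / e m * fourier f \<xi>" for m
  proof -
    have int2: "integrable lborel (\<lambda>x. f (e m *\<^sub>R b + 1 *\<^sub>R x))" by (rule integrable_lborel_affine[OF _ _ int]) auto
    have "fourier f \<xi> = (\<integral>x. ?c (e m *\<^sub>R b + 1 *\<^sub>R x) * f (e m *\<^sub>R b + 1 *\<^sub>R x) \<partial>lborel)"
      unfolding fourier_def by (subst integral_lborel_affine[where c=1 and t="e m *\<^sub>R b"]) auto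
    also have "\<dots> = (\<integral>x. cis (- 2 * pi * e m * (\<xi> \<bullet> b)) * (?c x * f (x + e m *\<^sub>R b)) \<partial>lborel)"
    proof (rule Bochner_Integration.integral_cong[OF refl])
      fix x
      have "?c (e m *\<^sub>R b + 1 *\<^sub>R x) = cis (- 2 * pi * e m * (\<xi> \<bullet> b)) * ?c x"
        unfolding cis_mult by (simp add: inner_add_left inner_commute[of b] distrib_left mult.assoc)
      then show "?c (e m *\<^sub>R b + 1 *\<^sub>R x) * f (e m *\<^sub>R b + 1 *\<^sub>R x)
          = cis (- 2 * pi * e m * (\<xi> \<bullet> b)) * (?c x * f (x + e m *\<^sub>R b))"
        by (simp add: add.commute mult.assoc)
    qed
    also have "\<dots> = cis (- 2 * pi * e m * (\<xi> \<bullet> b)) * (\<integral>x. ?c x * f (x + e m *\<^sub>R b) \<partial>lborel)"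
      by simp
    finally have "cis (2 * pi * e m * (\<xi> \<bullet> b)) * fourier f \<xi> = (\<integral>x. ?c x * f (x + e m *\<^sub>R b) \<partial>lborel)"
      by (simp add: mult.assoc[symmetric] cis_mult)
    moreover have "integral\<^sup>L lborel (u m) = ((\<integral>x. ?c x * f (x + e m *\<^sub>R b) \<partial>lborel) - fourier f \<xi>) / e m"
    proof -
      have "integral\<^sup>L lborel (u m) = (\<integral>x. (?c x * f (x + e m *\<^sub>R b) - ?c x * f x) / e m \<partial>lborel)"
        unfolding u_def by (intro Bochner_Integration.integral_cong) (simp_all add: algebra_simps)
      also have "\<dots> = (\<integral>x. ?c x * f (x + e m *\<^sub>R b) - ?c x * f x \<partial>lborel) / e m" by simp
      also have "(\<integral>x. ?c x * f (x + e m *\<^sub>R b) - ?c x * f x \<partial>lborel) = (\<integral>x. ?c x * f (x + e m *\<^sub>R b) \<partial>lborel) - fourier f \<xi>"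
        unfolding fourier_def using int int2
        by (intro Bochner_Integration.integral_diff integrable_unimodular_mult) (auto simp: add.commute)
      finally show ?thesis .
    qed
    ultimately show ?thesis by (simp add: algebra_simps diff_divide_distrib)
  qed
  moreover have "(\<lambda>m. (cis (2 * pi * e m * (\<xi> \<bullet> b)) - 1) / e m * fourier f \<xi>) \<longlonglongrightarrow> 2 * pi * \<i> * (\<xi> \<bullet> b) * fourier f \<xi>"
  proof (intro tendsto_mult tendsto_const)
    have "((\<lambda>t. cis (2 * pi * t * (\<xi> \<bullet> b))) has_vector_derivative 2 * pi * \<i> * (\<xi> \<bullet> b)) (at 0)"
      unfolding has_vector_derivative_def
      by (auto intro!: derivative_eq_intros simp: scaleR_conv_of_real)
    then have "(\<lambda>m. (cis (2 * pi * e m * (\<xi> \<bullet> b)) - cis (2 * pi * 0 * (\<xi> \<bullet> b))) / e m) \<longlonglongrightarrow> 2 * pi * \<i> * (\<xi> \<bullet> b)"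
      using e by (intro vector_derivative_difference_quotient[OF _ e0]) (auto simp: less_imp_neq[symmetric])
    then show "(\<lambda>m. (cis (2 * pi * e m * (\<xi> \<bullet> b)) - 1) / e m) \<longlonglongrightarrow> 2 * pi * \<i> * (\<xi> \<bullet> b)"
      by simp
  qed
  ultimately show ?thesis
    unfolding fourier_def using LIMSEQ_unique by fastforce
qed

lemma fourier_measurable:
  assumes [measurable]: "f \<in> borel_measurable borel"
  shows "fourier f \<in> borel_measurable borel"
  unfolding fourier_def by measurable

lemma norm_fourier_le: "norm (fourier f \<xi>) \<le> (\<integral>x. norm (f x) \<partial>lborel)"
  unfolding fourier_def by (rule order_trans[OF integral_norm_bound]) (simp add: norm_mult)

lemma fourier_iter_deriv:
  assumes "f \<in> schwartz" "b \<in> Basis"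
  shows "fourier (iter_deriv (replicate N b) f) \<xi> = (2 * pi * \<i> * (\<xi> \<bullet> b)) ^ N * fourier f \<xi>"
proof (induction N)
  case (Suc N)
  have "iter_deriv (replicate N b) f \<in> schwartz"
    using assms by (intro schwartz_iter_deriv) auto
  from fourier_deriv[OF this assms(2)] Suc show ?case by (simp add: mult_ac)
qed simp

text \<open>With \<open>m\<close> the largest of \<open>1\<close> and the \<open>a i\<close>, the
  base on the left is at most \<open>1 + card I\<close> times \<open>m\<close>, and
  \<open>m ^ N\<close> is one of the terms summed on the right.\<close>

lemma one_plus_sum_power_le:
  fixes a :: "'i \<Rightarrow> real"
  assumes "finite I" "\<And>i. i \<in> I \<Longrightarrow> 0 \<le> a i"
  shows "(1 + (\<Sum>i\<in>I. a i)) ^ N \<le> (1 + card I) ^ N * (1 + (\<Sum>i\<in>I. a i ^ N))"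
proof -
  define m where "m = Max (insert 1 (a ` I))"
  have fin: "finite (insert 1 (a ` I))" using assms by simp
  have m1: "1 \<le> m" and ma: "\<And>i. i \<in> I \<Longrightarrow> a i \<le> m"
    using fin by (auto simp: m_def intro!: Max_ge)
  have "1 + (\<Sum>i\<in>I. a i) \<le> m + (\<Sum>i\<in>I. m)" by (intro add_mono sum_mono m1 ma)
  also have "\<dots> = (1 + card I) * m" by (simp add: algebra_simps)
  finally have "(1 + (\<Sum>i\<in>I. a i)) ^ N \<le> ((1 + card I) * m) ^ N"
    using assms by (intro power_mono add_nonneg_nonneg sum_nonneg) auto
  also have "\<dots> = (1 + card I) ^ N * m ^ N" by (simp add: power_mult_distrib)
  also have "m ^ N \<le> 1 + (\<Sum>i\<in>I. a i ^ N)"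
  proof -
    have "m \<in> insert 1 (a ` I)" unfolding m_def using fin by (intro Max_in) auto
    then show ?thesis
    proof
      assume "m \<in> a ` I"
      then obtain i where i: "i \<in> I" "m = a i" by auto
      have "a i ^ N \<le> (\<Sum>i\<in>I. a i ^ N)"
        using assms i by (intro member_le_sum) auto
      then show ?thesis using i by simp
    qed (use assms in \<open>auto intro!: sum_nonneg\<close>)
  qed
  finally show ?thesis by (simp add: mult_left_mono)
qed

text \<open>\<open>N\<close> derivatives in direction \<open>b\<close> multiply the transform by
  \<open>(2 * pi * \<i> * (\<xi> \<bullet> b)) ^ N\<close>, and a transform is bounded by the
  \<open>L\<^sub>1\<close> norm; powers of single coordinates then control powers of
  \<open>norm \<xi>\<close>.\<close>

lemma fourier_rapid:
  fixes f :: "'a::euclidean_space \<Rightarrow> complex"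
  assumes f: "f \<in> schwartz"
  shows "rapid (fourier f)"
  unfolding rapid_def
proof (intro conjI allI)
  show "fourier f \<in> borel_measurable borel"
    by (rule fourier_measurable[OF schwartz_measurable[OF f]])
  fix N
  let ?I = "\<lambda>g::'a \<Rightarrow> complex. \<integral>x. norm (g x) \<partial>lborel"
  have b: "\<bar>\<xi> \<bullet> b\<bar> ^ N * norm (fourier f \<xi>) \<le> ?I (iter_deriv (replicate N b) f)" if b: "b \<in> Basis" for b \<xi> :: 'a
  proof -
    have "\<bar>\<xi> \<bullet> b\<bar> ^ N \<le> (2 * pi * \<bar>\<xi> \<bullet> b\<bar>) ^ N"
      using pi_ge_two mult_right_mono[of 1 "2 * pi" "\<bar>\<xi> \<bullet> b\<bar>"] by (intro power_mono) auto
    then have "\<bar>\<xi> \<bullet> b\<bar> ^ N * norm (fourier f \<xi>) \<le> (2 * pi * \<bar>\<xi> \<bullet> b\<bar>) ^ N * norm (fourier f \<xi>)"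
      by (intro mult_right_mono) auto
    also have "\<dots> = norm (fourier (iter_deriv (replicate N b) f) \<xi>)"
      by (simp add: fourier_iter_deriv[OF f b] norm_mult norm_power)
    also have "\<dots> \<le> ?I (iter_deriv (replicate N b) f)" by (rule norm_fourier_le)
    finally show ?thesis .
  qed
  have "(1 + norm \<xi>) ^ N * norm (fourier f \<xi>)
      \<le> (1 + DIM('a)) ^ N * (?I f + (\<Sum>b\<in>Basis. ?I (iter_deriv (replicate N b) f)))" for \<xi>
  proof -
    have "(1 + norm \<xi>) ^ N \<le> (1 + (\<Sum>b\<in>Basis. \<bar>\<xi> \<bullet> b\<bar>)) ^ N"
      using norm_le_l1[of \<xi>] by (intro power_mono) auto
    also have "\<dots> \<le> (1 + DIM('a)) ^ N * (1 + (\<Sum>b\<in>Basis. \<bar>\<xi> \<bullet> b\<bar> ^ N))"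
      by (rule one_plus_sum_power_le) auto
    finally have "(1 + norm \<xi>) ^ N * norm (fourier f \<xi>)
      \<le> (1 + DIM('a)) ^ N * (1 + (\<Sum>b\<in>Basis. \<bar>\<xi> \<bullet> b\<bar> ^ N)) * norm (fourier f \<xi>)"
      by (intro mult_right_mono) auto
    also have "\<dots> = (1 + DIM('a)) ^ N * (norm (fourier f \<xi>) + (\<Sum>b\<in>Basis. \<bar>\<xi> \<bullet> b\<bar> ^ N * norm (fourier f \<xi>)))"
      by (simp add: distrib_right sum_distrib_right mult.assoc)
    also have "\<dots> \<le> (1 + DIM('a)) ^ N * (?I f + (\<Sum>b\<in>Basis. ?I (iter_deriv (replicate N b) f)))"
      by (intro mult_left_mono add_mono sum_mono b norm_fourier_le) auto
    finally show ?thesis .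
  qed
  then show "\<exists>C. \<forall>\<xi>. (1 + norm \<xi>) ^ N * norm (fourier f \<xi>) \<le> C" by blast
qed

section \<open>Convolution of a rapidly decreasing kernel with a Schwartz function\<close>

lemma integrable_mult_bounded:
  fixes f g :: "'a \<Rightarrow> complex"
  assumes "integrable M f" "g \<in> borel_measurable M" "\<And>x. norm (g x) \<le> C"
  shows "integrable M (\<lambda>x. f x * g x)"
proof (rule Bochner_Integration.integrable_bound)
  show "integrable M (\<lambda>x. of_real C * f x)" using assms(1) by simp
  show "(\<lambda>x. f x * g x) \<in> borel_measurable M"
    using borel_measurable_integrable[OF assms(1)] assms(2) by measurable
  have "norm (f x) * norm (g x) \<le> \<bar>C\<bar> * norm (f x)" for x
    using mult_left_mono[OF order_trans[OF assms(3)[of x] abs_ge_self[of C]], of "norm (f x)"]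
    by (simp add: mult.commute)
  then show "AE x in M. norm (f x * g x) \<le> norm (of_real C * f x)" by (simp add: norm_mult)
qed

lemma euclidean_convolution_integrable:
  fixes \<kappa> \<psi> :: "'a::euclidean_space \<Rightarrow> complex"
  assumes \<kappa>: "rapid \<kappa>" and \<psi>: "rapid \<psi>"
  shows "integrable lborel (\<lambda>z. \<kappa> z * \<psi> (x - z))"
proof -
  obtain C where C: "\<And>x. norm (\<psi> x) \<le> C / (1 + norm x) ^ 0"
    using rapid_bound[OF \<psi>] by metis
  have [measurable]: "\<psi> \<in> borel_measurable borel" by (rule rapid_measurable[OF \<psi>])
  show ?thesis
    using C by (intro integrable_mult_bounded[OF rapid_integrable[OF \<kappa>]]) auto
qed

text \<open>The weight is submultiplicative,
  \<open>1 + norm x \<le> (1 + norm z) * (1 + norm (x - z))\<close>: one factor is absorbed by the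
  decay of \<open>\<psi>\<close>, the other leaves a weighted \<open>\<kappa>\<close>, which is
  still integrable.\<close>

lemma euclidean_convolution_rapid:
  fixes \<kappa> \<psi> :: "'a::euclidean_space \<Rightarrow> complex"
  assumes \<kappa>: "rapid \<kappa>" and \<psi>: "rapid \<psi>"
  shows "\<exists>C. \<forall>x. (1 + norm x) ^ N * norm (euclidean_convolution \<kappa> \<psi> x) \<le> C"
proof -
  obtain C where C: "0 < C" "\<And>x. norm (\<psi> x) \<le> C / (1 + norm x) ^ N"
    using rapid_bound[OF \<psi>] by metis
  let ?\<kappa> = "\<lambda>z. complex_of_real ((1 + norm z) ^ N) * \<kappa> z"
  have int: "integrable lborel ?\<kappa>" by (rule rapid_integrable[OF rapid_weight[OF \<kappa>]])
  have "(1 + norm x) ^ N * norm (euclidean_convolution \<kappa> \<psi> x) \<le> (\<integral>z. C * norm (?\<kappa> z) \<partial>lborel)" for x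
  proof -
    have "(1 + norm x) ^ N * norm (euclidean_convolution \<kappa> \<psi> x)
      \<le> (1 + norm x) ^ N * (\<integral>z. norm (\<kappa> z * \<psi> (x - z)) \<partial>lborel)"
      unfolding euclidean_convolution_def by (intro mult_left_mono integral_norm_bound) auto
    also have "\<dots> = (\<integral>z. (1 + norm x) ^ N * norm (\<kappa> z * \<psi> (x - z)) \<partial>lborel)" by simp
    also have "\<dots> \<le> (\<integral>z. C * norm (?\<kappa> z) \<partial>lborel)"
    proof (rule integral_mono)
      show "integrable lborel (\<lambda>z. (1 + norm x) ^ N * norm (\<kappa> z * \<psi> (x - z)))"
        by (intro integrable_mult_right integrable_norm euclidean_convolution_integrable assms)
      show "integrable lborel (\<lambda>z. C * norm (?\<kappa> z))"
        by (intro integrable_mult_right integrable_norm int)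
      fix z
      have "1 + norm x \<le> (1 + norm z) * (1 + norm (x - z))"
      proof -
        have "norm x \<le> norm z + norm (x - z)" using norm_triangle_ineq[of z "x - z"] by simp
        moreover have "0 \<le> norm z * norm (x - z)" by simp
        ultimately show ?thesis unfolding distrib_left distrib_right mult_1_left mult_1_right by linarith
      qed
      then have "(1 + norm x) ^ N \<le> (1 + norm z) ^ N * (1 + norm (x - z)) ^ N"
        unfolding power_mult_distrib[symmetric] by (intro power_mono) auto
      moreover have "norm (\<psi> (x - z)) \<le> C / (1 + norm (x - z)) ^ N" by (rule C)
      ultimately have "(1 + norm x) ^ N * norm (\<psi> (x - z))
          \<le> ((1 + norm z) ^ N * (1 + norm (x - z)) ^ N) * (C / (1 + norm (x - z)) ^ N)"
        by (intro mult_mono) auto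
      also have "\<dots> = C * (1 + norm z) ^ N"
        using one_plus_norm_pos[of "x - z"] by simp
      finally have "norm (\<kappa> z) * ((1 + norm x) ^ N * norm (\<psi> (x - z))) \<le> norm (\<kappa> z) * (C * (1 + norm z) ^ N)"
        by (intro mult_left_mono) auto
      then show "(1 + norm x) ^ N * norm (\<kappa> z * \<psi> (x - z)) \<le> C * norm (?\<kappa> z)"
        by (simp add: norm_mult norm_power mult_ac del: of_real_power of_real_add)
    qed
    finally show ?thesis .
  qed
  then show ?thesis by blast
qed

text \<open>The derivative falls on \<open>\<psi>\<close> alone. The first-order remainder of
  \<open>\<psi>\<close>, divided by the norm of the increment, is uniformly bounded and tends to
  \<open>0\<close> pointwise, so its integral against the integrable \<open>\<kappa>\<close>
  vanishes in the limit.\<close>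

lemma euclidean_convolution_has_derivative:
  fixes \<kappa> \<psi> :: "'a::euclidean_space \<Rightarrow> complex"
  assumes \<kappa>: "rapid \<kappa>" and \<psi>: "\<psi> \<in> schwartz"
  shows "(euclidean_convolution \<kappa> \<psi> has_derivative
      (\<lambda>v. \<Sum>b\<in>Basis. (v \<bullet> b) *\<^sub>R euclidean_convolution \<kappa> (\<lambda>y. frechet_derivative \<psi> (at y) b) x)) (at x)"
    (is "(_ has_derivative ?D) _")
proof -
  let ?\<psi>' = "\<lambda>y. frechet_derivative \<psi> (at y)"
  obtain C where C: "0 < C" "\<And>x. onorm (?\<psi>' x) \<le> C / (1 + norm x) ^ 0"
    using schwartz_onorm_bound[OF \<psi>] by metis
  have C': "onorm (?\<psi>' y) \<le> C" for y using C(2)[of y] by simp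
  have bl: "bounded_linear (?\<psi>' y)" for y
    by (rule has_derivative_bounded_linear[OF schwartz_has_derivative[OF \<psi>]])
  have [measurable]: "\<kappa> \<in> borel_measurable borel" "\<psi> \<in> borel_measurable borel"
    using rapid_measurable[OF \<kappa>] schwartz_measurable[OF \<psi>] by auto
  have \<psi>'_rapid: "rapid (\<lambda>y. ?\<psi>' y b)" if "b \<in> Basis" for b
    by (rule schwartz_rapid[OF schwartz_deriv[OF \<psi> that]])
  have [measurable]: "(\<lambda>y. ?\<psi>' y b) \<in> borel_measurable borel" if "b \<in> Basis" for b
    by (rule rapid_measurable[OF \<psi>'_rapid[OF that]])
  have \<psi>'_meas [measurable]: "(\<lambda>y. ?\<psi>' y v) \<in> borel_measurable borel" for v
    unfolding schwartz_deriv_expand[OF \<psi>, of _ v] by measurable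
  define R where "R y h = \<psi> (y + h) - \<psi> y - ?\<psi>' y h" for y h
  have [measurable]: "(\<lambda>y. R y h) \<in> borel_measurable borel" for h
    unfolding R_def by measurable
  have R_le: "norm (R y h) \<le> 2 * C * norm h" for y h
  proof -
    have "norm (\<psi> (y + h) - \<psi> y) \<le> C * norm ((y + h) - y)"
      using schwartz_has_derivative[OF \<psi>] C' by (intro differentiable_bound[of UNIV \<psi> ?\<psi>']) auto
    moreover have "norm (?\<psi>' y h) \<le> C * norm h"
      using onorm[OF bl, of y h] C'[of y] by (meson mult_right_mono norm_ge_zero order_trans)
    ultimately show ?thesis
      unfolding R_def using norm_triangle_ineq4[of "\<psi> (y + h) - \<psi> y" "?\<psi>' y h"] by simp
  qed
  have rem: "euclidean_convolution \<kappa> \<psi> (x + h) - euclidean_convolution \<kappa> \<psi> x - ?D h = (\<integral>z. \<kappa> z * R (x - z) h \<partial>lborel)" for h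
  proof -
    have i1: "integrable lborel (\<lambda>z. \<kappa> z * \<psi> (x + h - z))" "integrable lborel (\<lambda>z. \<kappa> z * \<psi> (x - z))"
      by (intro euclidean_convolution_integrable \<kappa> schwartz_rapid \<psi>)+
    have i2: "integrable lborel (\<lambda>z. (h \<bullet> b) *\<^sub>R (\<kappa> z * ?\<psi>' (x - z) b))" if "b \<in> Basis" for b
      by (intro integrable_scaleR_right euclidean_convolution_integrable \<kappa> \<psi>'_rapid that)
    have i3: "integrable lborel (\<lambda>z. \<Sum>b\<in>Basis. (h \<bullet> b) *\<^sub>R (\<kappa> z * ?\<psi>' (x - z) b))"
      by (intro Bochner_Integration.integrable_sum i2)
    have "?D h = (\<Sum>b\<in>Basis. \<integral>z. (h \<bullet> b) *\<^sub>R (\<kappa> z * ?\<psi>' (x - z) b) \<partial>lborel)"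
      by (simp add: euclidean_convolution_def)
    also have "\<dots> = (\<integral>z. (\<Sum>b\<in>Basis. (h \<bullet> b) *\<^sub>R (\<kappa> z * ?\<psi>' (x - z) b)) \<partial>lborel)"
      by (rule Bochner_Integration.integral_sum[symmetric]) (rule i2)
    finally have D: "?D h = (\<integral>z. (\<Sum>b\<in>Basis. (h \<bullet> b) *\<^sub>R (\<kappa> z * ?\<psi>' (x - z) b)) \<partial>lborel)" .
    have "euclidean_convolution \<kappa> \<psi> (x + h) - euclidean_convolution \<kappa> \<psi> x - ?D h
      = (\<integral>z. \<kappa> z * \<psi> (x + h - z) - \<kappa> z * \<psi> (x - z) - (\<Sum>b\<in>Basis. (h \<bullet> b) *\<^sub>R (\<kappa> z * ?\<psi>' (x - z) b)) \<partial>lborel)"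
      unfolding D unfolding euclidean_convolution_def using i1 i3 by simp
    also have "\<dots> = (\<integral>z. \<kappa> z * R (x - z) h \<partial>lborel)"
    proof (rule Bochner_Integration.integral_cong[OF refl])
      fix z
      have eq: "\<kappa> z * ?\<psi>' (x - z) h = (\<Sum>b\<in>Basis. (h \<bullet> b) *\<^sub>R (\<kappa> z * ?\<psi>' (x - z) b))"
        unfolding schwartz_deriv_expand[OF \<psi>, of _ h] by (simp add: sum_distrib_left)
      show "\<kappa> z * \<psi> (x + h - z) - \<kappa> z * \<psi> (x - z) - (\<Sum>b\<in>Basis. (h \<bullet> b) *\<^sub>R (\<kappa> z * ?\<psi>' (x - z) b)) = \<kappa> z * R (x - z) h"
        unfolding R_def eq[symmetric] by (simp add: algebra_simps)
    qed
    finally show ?thesis .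
  qed
  show ?thesis
    unfolding has_derivative_at
  proof
    show "bounded_linear ?D"
      by (intro bounded_linear_sum bounded_linear_scaleR_left[THEN bounded_linear_compose] bounded_linear_inner_left)
    show "(\<lambda>h. norm (euclidean_convolution \<kappa> \<psi> (x + h) - euclidean_convolution \<kappa> \<psi> x - ?D h) / norm h) \<midarrow>0\<rightarrow> 0"
      \<comment> \<open>Dominated convergence speaks of sequences, so the limit in \<open>h\<close>
        is tested along sequences of nonzero vectors tending to \<open>0\<close>.\<close>
      unfolding rem tendsto_at_iff_sequentially
    proof (intro allI impI)
      fix X :: "nat \<Rightarrow> 'a"
      assume X: "\<forall>i. X i \<in> UNIV - {0}" "X \<longlonglongrightarrow> 0"
      have X0: "0 < norm (X i)" for i using X by auto
      have "(\<lambda>i. \<integral>z. \<kappa> z * R (x - z) (X i) / norm (X i) \<partial>lborel) \<longlonglongrightarrow> (\<integral>z. 0 \<partial>(lborel :: 'a measure))"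
      proof (rule integral_dominated_convergence)
        show "integrable lborel (\<lambda>z. 2 * C * norm (\<kappa> z))"
          using rapid_integrable[OF \<kappa>] by auto
        show "AE z in lborel. norm (\<kappa> z * R (x - z) (X i) / norm (X i)) \<le> 2 * C * norm (\<kappa> z)" for i
        proof (rule AE_I2)
          fix z
          have "norm (R (x - z) (X i)) / norm (X i) \<le> 2 * C"
            using R_le[of "x - z" "X i"] X0[of i] by (simp add: field_simps)
          then have "norm (\<kappa> z) * (norm (R (x - z) (X i)) / norm (X i)) \<le> norm (\<kappa> z) * (2 * C)"
            by (intro mult_left_mono) auto
          then show "norm (\<kappa> z * R (x - z) (X i) / norm (X i)) \<le> 2 * C * norm (\<kappa> z)"
            by (simp add: norm_mult norm_divide mult_ac)
        qed
        show "AE z in lborel. (\<lambda>i. \<kappa> z * R (x - z) (X i) / norm (X i)) \<longlonglongrightarrow> 0"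
        proof (rule AE_I2)
          fix z
          have "(\<lambda>h. norm (R (x - z) h) / norm h) \<midarrow>0\<rightarrow> 0"
            using schwartz_has_derivative[OF \<psi>, of "x - z"] unfolding has_derivative_at R_def by simp
          moreover have "filterlim X (at 0) sequentially"
            using X by (intro filterlim_atI) auto
          ultimately have "(\<lambda>i. norm (R (x - z) (X i)) / norm (X i)) \<longlonglongrightarrow> 0"
            by (rule filterlim_compose)
          then have "(\<lambda>i. norm (\<kappa> z) * (norm (R (x - z) (X i)) / norm (X i))) \<longlonglongrightarrow> norm (\<kappa> z) * 0"
            by (intro tendsto_mult tendsto_const)
          then show "(\<lambda>i. \<kappa> z * R (x - z) (X i) / norm (X i)) \<longlonglongrightarrow> 0"
            by (intro tendsto_norm_zero_cancel[where f="\<lambda>i. \<kappa> z * R (x - z) (X i) / norm (X i)"])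
              (simp add: norm_mult norm_divide)
        qed
      qed measurable
      then have "(\<lambda>i. norm (\<integral>z. \<kappa> z * R (x - z) (X i) / norm (X i) \<partial>lborel)) \<longlonglongrightarrow> 0"
        by (simp add: tendsto_norm_zero)
      then show "((\<lambda>h. norm (\<integral>z. \<kappa> z * R (x - z) h \<partial>lborel) / norm h) \<circ> X) \<longlonglongrightarrow> 0"
        by (simp add: comp_def norm_divide)
    qed
  qed
qed

lemma iter_deriv_euclidean_convolution:
  assumes "rapid \<kappa>" "\<psi> \<in> schwartz" "vs \<in> lists Basis"
  shows "iter_deriv vs (euclidean_convolution \<kappa> \<psi>) = euclidean_convolution \<kappa> (iter_deriv vs \<psi>)"
  using assms(3)
proof (induction vs)
  case (Cons v vs)
  have \<psi>: "iter_deriv vs \<psi> \<in> schwartz" using Cons assms(2) by (intro schwartz_iter_deriv) auto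
  show ?case
  proof
    fix x
    have "iter_deriv (v # vs) (euclidean_convolution \<kappa> \<psi>) x
      = frechet_derivative (euclidean_convolution \<kappa> (iter_deriv vs \<psi>)) (at x) v"
      using Cons by simp
    also have "\<dots> = (\<Sum>b\<in>Basis. (v \<bullet> b) *\<^sub>R euclidean_convolution \<kappa> (\<lambda>y. frechet_derivative (iter_deriv vs \<psi>) (at y) b) x)"
      by (rule fun_cong[OF frechet_derivative_at[OF euclidean_convolution_has_derivative[OF assms(1) \<psi>], symmetric]])
    also have "\<dots> = euclidean_convolution \<kappa> (\<lambda>y. frechet_derivative (iter_deriv vs \<psi>) (at y) v) x"
    proof -
      have v: "v \<in> Basis" using Cons by simp
      have "(\<Sum>b\<in>Basis. (v \<bullet> b) *\<^sub>R euclidean_convolution \<kappa> (\<lambda>y. frechet_derivative (iter_deriv vs \<psi>) (at y) b) x)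
        = (\<Sum>b\<in>Basis. if b = v then euclidean_convolution \<kappa> (\<lambda>y. frechet_derivative (iter_deriv vs \<psi>) (at y) b) x else 0)"
        using v by (intro sum.cong) (auto simp: inner_Basis)
      then show ?thesis using v by simp
    qed
    finally show "iter_deriv (v # vs) (euclidean_convolution \<kappa> \<psi>) x = euclidean_convolution \<kappa> (iter_deriv (v # vs) \<psi>) x"
      by simp
  qed
qed simp

text \<open>All derivatives pass to \<open>\<psi>\<close>, so decay of \<open>\<kappa>\<close> is
  enough. This admits the convolution as a test function in \<open>represents\<close>, whose clauses
  speak of Schwartz functions only.\<close>

lemma schwartz_convolution:
  assumes "rapid \<kappa>" "\<psi> \<in> schwartz"
  shows "euclidean_convolution \<kappa> \<psi> \<in> schwartz"
  unfolding schwartz_def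
proof (intro CollectI ballI conjI allI)
  fix vs :: "'a list" assume vs: "vs \<in> lists Basis"
  have \<psi>: "iter_deriv vs \<psi> \<in> schwartz" by (rule schwartz_iter_deriv[OF assms(2) vs])
  show "iter_deriv vs (euclidean_convolution \<kappa> \<psi>) differentiable at x" for x
    unfolding iter_deriv_euclidean_convolution[OF assms vs]
    using euclidean_convolution_has_derivative[OF assms(1) \<psi>] by (rule differentiableI)
  show "bounded (range (\<lambda>x. (1 + norm x) ^ N * norm (iter_deriv vs (euclidean_convolution \<kappa> \<psi>) x)))" for N
    unfolding iter_deriv_euclidean_convolution[OF assms vs]
    using euclidean_convolution_rapid[OF assms(1) schwartz_rapid[OF \<psi>], of N]
    unfolding bounded_iff by (auto simp: abs_mult)
qed

section \<open>Fourier transforms of products, and regularity of inverse transforms\<close>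

lemma lborel_swap_unimodular:
  fixes f g :: "'a::euclidean_space \<Rightarrow> complex" and k :: "'a \<Rightarrow> 'a \<Rightarrow> complex"
  assumes f: "integrable lborel f" and g: "integrable lborel g"
    and [measurable]: "(\<lambda>(x, y). k x y) \<in> borel_measurable (borel \<Otimes>\<^sub>M borel)"
    and k: "\<And>x y. norm (k x y) = 1"
  shows "(\<integral>x. (\<integral>y. k x y * (f x * g y) \<partial>lborel) \<partial>lborel) = (\<integral>y. (\<integral>x. k x y * (f x * g y) \<partial>lborel) \<partial>lborel)"
proof -
  have [measurable]: "f \<in> borel_measurable borel" "g \<in> borel_measurable borel"
    using f g by (auto dest: borel_measurable_integrable)
  have "integrable (lborel \<Otimes>\<^sub>M lborel) (\<lambda>(x, y). k x y * (f x * g y))"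
  proof (rule lborel_pair.Fubini_integrable)
    show "(\<lambda>(x, y). k x y * (f x * g y)) \<in> borel_measurable (lborel \<Otimes>\<^sub>M lborel)"
      by measurable
    show "integrable lborel (\<lambda>x. \<integral>y. norm (case (x, y) of (x, y) \<Rightarrow> k x y * (f x * g y)) \<partial>lborel)"
      using f by (simp add: norm_mult k)
    show "AE x in lborel. integrable lborel (\<lambda>y. case (x, y) of (x, y) \<Rightarrow> k x y * (f x * g y))"
    proof (rule AE_I2)
      fix x
      have "integrable lborel (\<lambda>y. k x y * (f x * g y))"
        using g k by (intro integrable_unimodular_mult[of lborel "\<lambda>y. f x * g y" "k x"]) auto
      then show "integrable lborel (\<lambda>y. case (x, y) of (x, y) \<Rightarrow> k x y * (f x * g y))" by simp
    qed
  qed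
  from lborel_pair.Fubini_integral[OF this] show ?thesis by simp
qed

text \<open>Fubini alone gives this, without inversion: once the inverse transform is written out,
  the inner integral over \<open>\<xi>\<close> is the transform of \<open>\<Phi>\<close> at
  \<open>x - y\<close>.\<close>

lemma fourier_mult_inv_fourier:
  fixes \<Phi> \<psi> :: "'a::euclidean_space \<Rightarrow> complex"
  assumes \<Phi>: "integrable lborel \<Phi>" and \<psi>: "integrable lborel \<psi>"
  shows "fourier (\<lambda>\<xi>. \<Phi> \<xi> * inv_fourier \<psi> \<xi>) = euclidean_convolution (fourier \<Phi>) \<psi>"
proof
  fix x
  have [measurable]: "\<Phi> \<in> borel_measurable borel" "\<psi> \<in> borel_measurable borel"
    using \<Phi> \<psi> by (auto dest: borel_measurable_integrable)
  have "fourier (\<lambda>\<xi>. \<Phi> \<xi> * inv_fourier \<psi> \<xi>) x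
    = (\<integral>\<xi>. (\<integral>y. cis (2 * pi * ((y - x) \<bullet> \<xi>)) * (\<Phi> \<xi> * \<psi> y) \<partial>lborel) \<partial>lborel)"
    unfolding fourier_def inv_fourier_def
  proof (rule Bochner_Integration.integral_cong[OF refl])
    fix \<xi>
    have "cis (- 2 * pi * (\<xi> \<bullet> x)) * (\<Phi> \<xi> * (\<integral>y. cis (2 * pi * (\<xi> \<bullet> y)) * \<psi> y \<partial>lborel))
      = (\<integral>y. (cis (- 2 * pi * (\<xi> \<bullet> x)) * \<Phi> \<xi>) * (cis (2 * pi * (\<xi> \<bullet> y)) * \<psi> y) \<partial>lborel)"
      by (simp only: integral_mult_right_zero mult.assoc)
    also have "\<dots> = (\<integral>y. cis (2 * pi * ((y - x) \<bullet> \<xi>)) * (\<Phi> \<xi> * \<psi> y) \<partial>lborel)"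
    proof (rule Bochner_Integration.integral_cong[OF refl])
      fix y
      have "cis (- 2 * pi * (\<xi> \<bullet> x)) * cis (2 * pi * (\<xi> \<bullet> y)) = cis (2 * pi * ((y - x) \<bullet> \<xi>))"
        by (simp add: cis_mult inner_diff_left inner_commute algebra_simps)
      note eq = this
      show "(cis (- 2 * pi * (\<xi> \<bullet> x)) * \<Phi> \<xi>) * (cis (2 * pi * (\<xi> \<bullet> y)) * \<psi> y) = cis (2 * pi * ((y - x) \<bullet> \<xi>)) * (\<Phi> \<xi> * \<psi> y)"
        unfolding eq[symmetric] by (simp only: mult_ac)
    qed
    finally show "cis (- 2 * pi * (\<xi> \<bullet> x)) * (\<Phi> \<xi> * (\<integral>y. cis (2 * pi * (\<xi> \<bullet> y)) * \<psi> y \<partial>lborel))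
      = (\<integral>y. cis (2 * pi * ((y - x) \<bullet> \<xi>)) * (\<Phi> \<xi> * \<psi> y) \<partial>lborel)" .
  qed
  also have "\<dots> = (\<integral>y. (\<integral>\<xi>. cis (2 * pi * ((y - x) \<bullet> \<xi>)) * (\<Phi> \<xi> * \<psi> y) \<partial>lborel) \<partial>lborel)"
    by (rule lborel_swap_unimodular[OF \<Phi> \<psi>]) auto
  also have "\<dots> = (\<integral>y. fourier \<Phi> (x - y) * \<psi> y \<partial>lborel)"
  proof (rule Bochner_Integration.integral_cong[OF refl])
    fix y
    have "(\<integral>\<xi>. cis (2 * pi * ((y - x) \<bullet> \<xi>)) * (\<Phi> \<xi> * \<psi> y) \<partial>lborel) = (\<integral>\<xi>. (cis (- 2 * pi * (\<xi> \<bullet> (x - y))) * \<Phi> \<xi>) * \<psi> y \<partial>lborel)"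
      by (intro Bochner_Integration.integral_cong) (auto simp: inner_diff_left inner_diff_right inner_commute algebra_simps)
    then show "(\<integral>\<xi>. cis (2 * pi * ((y - x) \<bullet> \<xi>)) * (\<Phi> \<xi> * \<psi> y) \<partial>lborel) = fourier \<Phi> (x - y) * \<psi> y"
      by (simp add: fourier_def)
  qed
  also have "\<dots> = euclidean_convolution (fourier \<Phi>) \<psi> x"
    unfolding euclidean_convolution_def
    using fourier_measurable[of \<Phi>]
    by (subst integral_lborel_affine[where c="-1" and t=x]) auto
  finally show "fourier (\<lambda>\<xi>. \<Phi> \<xi> * inv_fourier \<psi> \<xi>) x = euclidean_convolution (fourier \<Phi>) \<psi> x" .
qed

lemma inv_fourier_bounded: "norm (inv_fourier \<psi> x) \<le> (\<integral>y. norm (\<psi> y) \<partial>lborel)"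
  unfolding inv_fourier_def by (rule order_trans[OF integral_norm_bound]) (simp add: norm_mult)

lemma inv_fourier_continuous:
  fixes \<psi> :: "'a::euclidean_space \<Rightarrow> complex"
  assumes \<psi>: "integrable lborel \<psi>"
  shows "continuous_on UNIV (inv_fourier \<psi>)"
proof (rule continuous_at_imp_continuous_on, rule ballI, unfold continuous_at_sequentially, intro allI impI)
  fix x :: 'a and X assume X: "X \<longlonglongrightarrow> x"
  have [measurable]: "\<psi> \<in> borel_measurable borel"
    using \<psi> by (auto dest: borel_measurable_integrable)
  have "(\<lambda>i. inv_fourier \<psi> (X i)) \<longlonglongrightarrow> inv_fourier \<psi> x"
    unfolding inv_fourier_def
  proof (rule integral_dominated_convergence)
    show "integrable lborel (\<lambda>y. norm (\<psi> y))" using \<psi> by simp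
    show "AE y in lborel. (\<lambda>i. cis (2 * pi * (X i \<bullet> y)) * \<psi> y) \<longlonglongrightarrow> cis (2 * pi * (x \<bullet> y)) * \<psi> y"
    proof (rule AE_I2, intro tendsto_mult tendsto_const)
      fix y
      have "continuous_on UNIV cis" by (intro continuous_intros)
      then have "isCont cis a" for a by (simp add: continuous_on_eq_continuous_at)
      then show "(\<lambda>i. cis (2 * pi * (X i \<bullet> y))) \<longlonglongrightarrow> cis (2 * pi * (x \<bullet> y))"
        by (rule isCont_tendsto_compose) (intro tendsto_intros X)
    qed
  qed (auto simp: norm_mult)
  then show "(inv_fourier \<psi> \<circ> X) \<longlonglongrightarrow> inv_fourier \<psi> x" by (simp add: comp_def)
qed

subsection \<open>Fourier inversion\<close>

text \<open>A dilation by \<open>sqrt (2 * pi)\<close> in the characteristic function of the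
  standard normal law. With this normalisation the Gaussian is its own transform.\<close>

lemma gauss_fourier_real:
  shows integrable_gauss_real: "integrable lborel (\<lambda>x::real. exp (- pi * x\<^sup>2))"
    and gauss_fourier_real_eq: "(\<integral>x. cis (2 * pi * t * x) * exp (- pi * x\<^sup>2) \<partial>lborel) = exp (- pi * t\<^sup>2)"
proof -
  let ?s = "sqrt (2 * pi)"
  have s: "0 < ?s" by simp
  have dens: "std_normal_density (0 + ?s * x) = exp (- pi * x\<^sup>2) / ?s" for x
    by (simp add: normal_density_def power_mult_distrib)
  have "integrable lborel (\<lambda>x. std_normal_density (0 + ?s * x))"
    using lborel_integrable_real_affine_iff[of ?s std_normal_density 0] s integrable_normal_density[of 1 0] by simp
  then have "integrable lborel (\<lambda>x. ?s * (exp (- pi * x\<^sup>2) / ?s))"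
    unfolding dens by (rule integrable_mult_right)
  then show "integrable lborel (\<lambda>x::real. exp (- pi * x\<^sup>2))" using s by simp
  have "complex_of_real (exp (- ((?s * t)\<^sup>2) / 2)) = char std_normal_distribution (?s * t)"
    by (simp add: char_std_normal_distribution)
  also have "\<dots> = (\<integral>x. std_normal_density x *\<^sub>R cis (?s * t * x) \<partial>lborel)"
    unfolding char_def by (subst integral_density) (auto simp: cis_conv_exp)
  also have "\<dots> = ?s *\<^sub>R (\<integral>x. std_normal_density (0 + ?s * x) *\<^sub>R cis (?s * t * (0 + ?s * x)) \<partial>lborel)"
    using lborel_integral_real_affine[of ?s "\<lambda>x. std_normal_density x *\<^sub>R cis (?s * t * x)" 0] s by simp
  also have "\<dots> = (\<integral>x. ?s *\<^sub>R (std_normal_density (0 + ?s * x) *\<^sub>R cis (?s * t * (0 + ?s * x))) \<partial>lborel)"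
    by (rule integral_scaleR_right[symmetric])
  also have "\<dots> = (\<integral>x. cis (2 * pi * t * x) * exp (- pi * x\<^sup>2) \<partial>lborel)"
  proof (rule Bochner_Integration.integral_cong[OF refl])
    fix x
    have "?s * t * (0 + ?s * x) = 2 * pi * t * x"
      using real_sqrt_mult_self[of "2 * pi"] by (simp add: mult_ac)
    note eq = this
    show "?s *\<^sub>R (std_normal_density (0 + ?s * x) *\<^sub>R cis (?s * t * (0 + ?s * x))) = cis (2 * pi * t * x) * exp (- pi * x\<^sup>2)"
      unfolding dens eq using s by (simp add: scaleR_conv_of_real)
  qed
  finally show "(\<integral>x. cis (2 * pi * t * x) * exp (- pi * x\<^sup>2) \<partial>lborel) = exp (- pi * t\<^sup>2)"
    by (simp add: power_mult_distrib)
qed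

lemma cis_sum: "finite I \<Longrightarrow> cis (\<Sum>i\<in>I. f i) = (\<Prod>i\<in>I. cis (f i))"
  by (induction I rule: finite_induct) (auto simp: cis_mult[symmetric])

lemma gauss_prod: "exp (- pi * (norm (\<xi>::'a::euclidean_space))\<^sup>2) = (\<Prod>b\<in>Basis. exp (- pi * (\<xi> \<bullet> b)\<^sup>2))"
proof -
  have "(norm \<xi>)\<^sup>2 = (\<Sum>b\<in>Basis. (\<xi> \<bullet> b)\<^sup>2)"
    unfolding power2_norm_eq_inner by (subst euclidean_inner) (simp add: power2_eq_square)
  then show ?thesis by (simp add: sum_distrib_left flip: exp_sum)
qed

lemma integrable_gauss: "integrable lborel (\<lambda>\<xi>::'a::euclidean_space. exp (- pi * (norm \<xi>)\<^sup>2))"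
  unfolding gauss_prod by (rule integrable_lborel_prod_basis) (rule integrable_gauss_real)

lemma gauss_fourier:
  fixes y :: "'a::euclidean_space"
  shows "(\<integral>\<xi>. cis (2 * pi * (y \<bullet> \<xi>)) * exp (- pi * (norm \<xi>)\<^sup>2) \<partial>lborel) = exp (- pi * (norm y)\<^sup>2)"
proof -
  have "cis (2 * pi * (y \<bullet> \<xi>)) * exp (- pi * (norm \<xi>)\<^sup>2)
      = (\<Prod>b\<in>Basis. cis (2 * pi * (y \<bullet> b) * (\<xi> \<bullet> b)) * exp (- pi * (\<xi> \<bullet> b)\<^sup>2))" for \<xi>
  proof -
    have "cis (2 * pi * (y \<bullet> \<xi>)) = (\<Prod>b\<in>Basis. cis (2 * pi * (y \<bullet> b) * (\<xi> \<bullet> b)))"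
      by (subst euclidean_inner) (simp add: sum_distrib_left cis_sum[symmetric] mult.assoc)
    then show ?thesis unfolding gauss_prod by (simp add: prod.distrib)
  qed
  then have "(\<integral>\<xi>. cis (2 * pi * (y \<bullet> \<xi>)) * exp (- pi * (norm \<xi>)\<^sup>2) \<partial>lborel)
      = (\<integral>\<xi>. (\<Prod>b\<in>Basis. cis (2 * pi * (y \<bullet> b) * (\<xi> \<bullet> b)) * exp (- pi * (\<xi> \<bullet> b)\<^sup>2)) \<partial>lborel)"
    by presburger
  also have "\<dots> = (\<Prod>b\<in>Basis. \<integral>t. cis (2 * pi * (y \<bullet> b) * t) * complex_of_real (exp (- pi * t\<^sup>2)) \<partial>lborel)"
    by (rule integral_lborel_prod_basis
        integrable_unimodular_mult[OF integrable_of_real[OF integrable_gauss_real]])+ auto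
  also have "\<dots> = exp (- pi * (norm y)\<^sup>2)"
    unfolding gauss_fourier_real_eq gauss_prod[of y] by simp
  finally show ?thesis .
qed

text \<open>Gaussian summation: the inverse transform is damped by a Gaussian dilated by
  \<open>e m\<close>, and the limit of the damped integral \<open>A m\<close> is found twice.
  Integrability of the transform removes the damping; Fubini turns \<open>A m\<close> into a
  Gaussian average of \<open>h\<close> around \<open>x\<close>, which tends to \<open>h x\<close> by
  continuity and boundedness.\<close>

theorem fourier_inversion:
  fixes h :: "'a::euclidean_space \<Rightarrow> complex"
  assumes h: "integrable lborel h" and cont: "continuous_on UNIV h"
    and M: "\<And>x. norm (h x) \<le> M" and Fh: "integrable lborel (fourier h)"
  shows "inv_fourier (fourier h) = h"
proof
  fix x
  define e where "e m = inverse (real (Suc m))" for m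
  have e: "0 < e m" for m by (auto simp: e_def)
  have e0: "e \<longlonglongrightarrow> 0" unfolding e_def by (rule LIMSEQ_inverse_real_of_nat)
  let ?g = "\<lambda>\<xi>::'a. complex_of_real (exp (- pi * (norm \<xi>)\<^sup>2))"
  have [measurable]: "h \<in> borel_measurable borel" by (rule borel_measurable_continuous_onI[OF cont])
  have [measurable]: "fourier h \<in> borel_measurable borel" by (rule fourier_measurable) simp
  have g_int: "integrable lborel ?g" by (intro integrable_of_real integrable_gauss)
  have g_int': "integrable lborel (\<lambda>\<xi>. ?g (e m *\<^sub>R \<xi>))" for m
    using integrable_lborel_affine[of "e m" ?g 0] g_int e[of m] by simp
  define A where "A m = (\<integral>\<xi>. cis (2 * pi * (x \<bullet> \<xi>)) * fourier h \<xi> * ?g (e m *\<^sub>R \<xi>) \<partial>lborel)" for m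
  have "A \<longlonglongrightarrow> (\<integral>\<xi>. cis (2 * pi * (x \<bullet> \<xi>)) * fourier h \<xi> \<partial>lborel)"
    unfolding A_def
  proof (rule integral_dominated_convergence)
    show "integrable lborel (\<lambda>\<xi>. norm (fourier h \<xi>))" using Fh by simp
    show "AE \<xi> in lborel. norm (cis (2 * pi * (x \<bullet> \<xi>)) * fourier h \<xi> * ?g (e m *\<^sub>R \<xi>)) \<le> norm (fourier h \<xi>)" for m
      by (intro AE_I2) (auto simp: norm_mult intro!: mult_left_le)
    show "AE \<xi> in lborel. (\<lambda>m. cis (2 * pi * (x \<bullet> \<xi>)) * fourier h \<xi> * ?g (e m *\<^sub>R \<xi>)) \<longlonglongrightarrow> cis (2 * pi * (x \<bullet> \<xi>)) * fourier h \<xi>"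
    proof (rule AE_I2)
      fix \<xi> :: 'a
      have "(\<lambda>m. ?g (e m *\<^sub>R \<xi>)) \<longlonglongrightarrow> ?g (0 *\<^sub>R \<xi>)"
        by (intro tendsto_intros e0)
      then have "(\<lambda>m. cis (2 * pi * (x \<bullet> \<xi>)) * fourier h \<xi> * ?g (e m *\<^sub>R \<xi>)) \<longlonglongrightarrow> cis (2 * pi * (x \<bullet> \<xi>)) * fourier h \<xi> * ?g (0 *\<^sub>R \<xi>)"
        by (intro tendsto_mult tendsto_const)
      then show "(\<lambda>m. cis (2 * pi * (x \<bullet> \<xi>)) * fourier h \<xi> * ?g (e m *\<^sub>R \<xi>)) \<longlonglongrightarrow> cis (2 * pi * (x \<bullet> \<xi>)) * fourier h \<xi>"
        by simp
    qed
  qed measurable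
  moreover have "A m = (\<integral>z. h (x + e m *\<^sub>R z) * ?g z \<partial>lborel)" for m
  proof -
    have "A m = (\<integral>\<xi>. (\<integral>y. cis (2 * pi * ((x - y) \<bullet> \<xi>)) * (?g (e m *\<^sub>R \<xi>) * h y) \<partial>lborel) \<partial>lborel)"
      unfolding A_def fourier_def
    proof (rule Bochner_Integration.integral_cong[OF refl])
      fix \<xi>
      have "cis (2 * pi * (x \<bullet> \<xi>)) * (\<integral>y. cis (- 2 * pi * (y \<bullet> \<xi>)) * h y \<partial>lborel) * ?g (e m *\<^sub>R \<xi>)
        = (\<integral>y. (cis (2 * pi * (x \<bullet> \<xi>)) * ?g (e m *\<^sub>R \<xi>)) * (cis (- 2 * pi * (y \<bullet> \<xi>)) * h y) \<partial>lborel)"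
        unfolding integral_mult_right_zero by (simp only: mult_ac)
      also have "\<dots> = (\<integral>y. cis (2 * pi * ((x - y) \<bullet> \<xi>)) * (?g (e m *\<^sub>R \<xi>) * h y) \<partial>lborel)"
      proof (rule Bochner_Integration.integral_cong[OF refl])
        fix y
        have "cis (2 * pi * (x \<bullet> \<xi>)) * cis (- 2 * pi * (y \<bullet> \<xi>)) = cis (2 * pi * ((x - y) \<bullet> \<xi>))"
          by (simp add: cis_mult inner_diff_left algebra_simps)
        note eq = this
        show "(cis (2 * pi * (x \<bullet> \<xi>)) * ?g (e m *\<^sub>R \<xi>)) * (cis (- 2 * pi * (y \<bullet> \<xi>)) * h y)
            = cis (2 * pi * ((x - y) \<bullet> \<xi>)) * (?g (e m *\<^sub>R \<xi>) * h y)"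
          unfolding eq[symmetric] by (simp only: mult_ac)
      qed
      finally show "cis (2 * pi * (x \<bullet> \<xi>)) * (\<integral>y. cis (- 2 * pi * (y \<bullet> \<xi>)) * h y \<partial>lborel) * ?g (e m *\<^sub>R \<xi>)
        = (\<integral>y. cis (2 * pi * ((x - y) \<bullet> \<xi>)) * (?g (e m *\<^sub>R \<xi>) * h y) \<partial>lborel)" .
    qed
    also have "\<dots> = (\<integral>y. (\<integral>\<xi>. cis (2 * pi * ((x - y) \<bullet> \<xi>)) * (?g (e m *\<^sub>R \<xi>) * h y) \<partial>lborel) \<partial>lborel)"
      by (rule lborel_swap_unimodular[OF g_int' h]) auto
    \<comment> \<open>The inner integral is the transform of a dilated Gaussian, again a Gaussian,
      concentrated around \<open>y = x\<close> at width \<open>e m\<close>. The substitution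
      \<open>y = x + e m *\<^sub>R z\<close> that follows undoes the dilation.\<close>
    also have "\<dots> = (\<integral>y. inverse (e m ^ DIM('a)) *\<^sub>R (?g ((x - y) /\<^sub>R e m) * h y) \<partial>lborel)"
    proof (rule Bochner_Integration.integral_cong[OF refl])
      fix y
      let ?f = "\<lambda>\<omega>. cis (2 * pi * (((x - y) /\<^sub>R e m) \<bullet> \<omega>)) * ?g \<omega>"
      have "?g ((x - y) /\<^sub>R e m) = (\<integral>\<omega>. ?f \<omega> \<partial>lborel)"
        by (rule gauss_fourier[symmetric])
      also have "\<dots> = e m ^ DIM('a) *\<^sub>R (\<integral>\<xi>. ?f (0 + e m *\<^sub>R \<xi>) \<partial>lborel)"
        using e[of m] by (subst integral_lborel_affine[where c="e m" and t=0]) auto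
      also have "(\<integral>\<xi>. ?f (0 + e m *\<^sub>R \<xi>) \<partial>lborel) = (\<integral>\<xi>. cis (2 * pi * ((x - y) \<bullet> \<xi>)) * ?g (e m *\<^sub>R \<xi>) \<partial>lborel)"
      proof -
        have cancel: "e m * (inverse (e m) * a) = a" for a using e[of m] by (simp add: mult.assoc[symmetric])
        show ?thesis by (intro Bochner_Integration.integral_cong) (auto simp: cancel)
      qed
      finally have "inverse (e m ^ DIM('a)) *\<^sub>R ?g ((x - y) /\<^sub>R e m) = (\<integral>\<xi>. cis (2 * pi * ((x - y) \<bullet> \<xi>)) * ?g (e m *\<^sub>R \<xi>) \<partial>lborel)"
        using e[of m] by simp
      then show "(\<integral>\<xi>. cis (2 * pi * ((x - y) \<bullet> \<xi>)) * (?g (e m *\<^sub>R \<xi>) * h y) \<partial>lborel)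
        = inverse (e m ^ DIM('a)) *\<^sub>R (?g ((x - y) /\<^sub>R e m) * h y)"
        by (metis (no_types, lifting) Bochner_Integration.integral_cong integral_mult_left_zero mult.assoc mult_scaleR_left)
    qed
    also have "\<dots> = e m ^ DIM('a) *\<^sub>R (\<integral>z. inverse (e m ^ DIM('a)) *\<^sub>R (?g ((x - (x + e m *\<^sub>R z)) /\<^sub>R e m) * h (x + e m *\<^sub>R z)) \<partial>lborel)"
      using e[of m] by (subst integral_lborel_affine[where c="e m" and t=x]) auto
    also have "\<dots> = (\<integral>z. ?g ((x - (x + e m *\<^sub>R z)) /\<^sub>R e m) * h (x + e m *\<^sub>R z) \<partial>lborel)"
      using e[of m] by simp
    also have "\<dots> = (\<integral>z. h (x + e m *\<^sub>R z) * ?g z \<partial>lborel)"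
      using e[of m] by (intro Bochner_Integration.integral_cong) (auto simp: mult.commute)
    finally show ?thesis .
  qed
  moreover have "(\<lambda>m. \<integral>z. h (x + e m *\<^sub>R z) * ?g z \<partial>lborel) \<longlonglongrightarrow> (\<integral>z. h x * ?g z \<partial>lborel)"
  proof (rule integral_dominated_convergence)
    show "integrable lborel (\<lambda>z. M * norm (?g z))" using g_int by (intro integrable_mult_right integrable_norm)
    show "AE z in lborel. norm (h (x + e m *\<^sub>R z) * ?g z) \<le> M * norm (?g z)" for m
      unfolding norm_mult by (intro AE_I2 mult_right_mono M) auto
    show "AE z in lborel. (\<lambda>m. h (x + e m *\<^sub>R z) * ?g z) \<longlonglongrightarrow> h x * ?g z"
    proof (rule AE_I2, intro tendsto_mult tendsto_const)
      fix z
      have "isCont h x" using cont by (simp add: continuous_on_eq_continuous_at)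
      moreover have "(\<lambda>m. x + e m *\<^sub>R z) \<longlonglongrightarrow> x + 0 *\<^sub>R z" by (intro tendsto_intros e0)
      ultimately show "(\<lambda>m. h (x + e m *\<^sub>R z)) \<longlonglongrightarrow> h x"
        by (intro isCont_tendsto_compose[of x h]) auto
    qed
  qed measurable
  \<comment> \<open>The value of \<open>gauss_fourier\<close> at \<open>0\<close>: the Gaussian has
    total mass one.\<close>
  moreover have "(\<integral>z. h x * ?g z \<partial>lborel) = h x"
    using gauss_fourier[of "0 :: 'a"] by simp
  ultimately show "inv_fourier (fourier h) x = h x"
    unfolding inv_fourier_def by (metis (no_types, lifting) LIMSEQ_unique ext)
qed

subsection \<open>Dyadic blocks\<close>

lemma fourier_dilate:
  fixes h :: "'a::euclidean_space \<Rightarrow> complex"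
  assumes [measurable]: "h \<in> borel_measurable borel" and r: "0 < r"
  shows "fourier (\<lambda>\<xi>. h (r *\<^sub>R \<xi>)) x = inverse r ^ DIM('a) * fourier h (inverse r *\<^sub>R x)"
proof -
  have "fourier h (inverse r *\<^sub>R x)
    = r ^ DIM('a) *\<^sub>R (\<integral>\<xi>. cis (- 2 * pi * ((0 + r *\<^sub>R \<xi>) \<bullet> (inverse r *\<^sub>R x))) * h (0 + r *\<^sub>R \<xi>) \<partial>lborel)"
    unfolding fourier_def using r by (subst integral_lborel_affine[where c=r and t=0]) auto
  also have "(\<integral>\<xi>. cis (- 2 * pi * ((0 + r *\<^sub>R \<xi>) \<bullet> (inverse r *\<^sub>R x))) * h (0 + r *\<^sub>R \<xi>) \<partial>lborel) = fourier (\<lambda>\<xi>. h (r *\<^sub>R \<xi>)) x"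
    unfolding fourier_def using r by (intro Bochner_Integration.integral_cong) (auto simp: field_simps)
  finally show ?thesis using r by (simp add: scaleR_conv_of_real field_simps)
qed

text \<open>A block tests \<open>f\<close> on the transform of \<open>inv_fourier \<psi>\<close> cut
  off by a dilate of \<open>\<phi>\<close>. The same dilate of \<open>\<Phi>\<close> equals
  \<open>1\<close> wherever that cut-off is nonzero, so inserting it changes nothing, and by
  inversion inserting it means convolving \<open>\<psi>\<close> with its transform. The identity
  thus holds already between the arguments handed to \<open>f\<close>.\<close>

lemma dyadic_block_reproducing:
  fixes \<phi> :: "'a::euclidean_space \<Rightarrow> complex"
  assumes "dyadic_resolution \<phi>"
  obtains \<kappa> where "rapid \<kappa>"
    and "\<And>k f \<psi>. \<psi> \<in> schwartz \<Longrightarrow>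
      dyadic_block \<phi> k f (euclidean_convolution (\<lambda>z. (2 powi k) ^ DIM('a) * \<kappa> ((2 powi k) *\<^sub>R z)) \<psi>) = dyadic_block \<phi> k f \<psi>"
proof -
  have \<phi>: "\<phi> \<in> schwartz" using assms by (simp add: dyadic_resolution_def)
  have [measurable]: "\<phi> \<in> borel_measurable borel" by (rule schwartz_measurable[OF \<phi>])
  \<comment> \<open>Three terms suffice if one knows that \<open>\<phi>\<close> vanishes on the boundary of the annulus; five avoid that.\<close>
  define \<Phi> where "\<Phi> \<xi> = (\<Sum>j\<in>{-2..2::int}. \<phi> ((2 powi (- j)) *\<^sub>R \<xi>))" for \<xi>
  have \<Phi>1: "\<Phi> \<xi> = 1" if "\<phi> \<xi> \<noteq> 0" for \<xi>
  proof -
    have ann: "closure {\<xi>. \<phi> \<xi> \<noteq> 0} = {\<xi>. 1 / 2 \<le> norm \<xi> \<and> norm \<xi> \<le> 2}"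
      using assms by (simp add: dyadic_resolution_def)
    have supp: "1 / 2 \<le> norm \<xi> \<and> norm \<xi> \<le> 2" if "\<phi> \<xi> \<noteq> 0" for \<xi>
    proof -
      have "\<xi> \<in> closure {\<xi>. \<phi> \<xi> \<noteq> 0}" using that by (intro subsetD[OF closure_subset]) simp
      then show ?thesis unfolding ann by simp
    qed
    have \<xi>: "1 / 2 \<le> norm \<xi>" "norm \<xi> \<le> 2" using supp[OF that] by auto
    have "\<phi> ((2 powi (- j)) *\<^sub>R \<xi>) = 0" if j: "j \<notin> {-2..2}" for j :: int
    proof (rule ccontr)
      assume "\<phi> ((2 powi (- j)) *\<^sub>R \<xi>) \<noteq> 0"
      then have *: "1 / 2 \<le> 2 powi (- j) * norm \<xi>" "2 powi (- j) * norm \<xi> \<le> 2"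
        using supp[of "(2 powi (- j)) *\<^sub>R \<xi>"] by (simp_all add: abs_of_nonneg)
      consider "j \<ge> 3" | "j \<le> -3" using j by force
      then show False
      proof cases
        case 1
        then have "(2::real) powi (- j) \<le> 2 powi (-3)" by (intro power_int_increasing) auto
        then have "2 powi (- j) * norm \<xi> \<le> (1 / 8) * 2" using \<xi> by (intro mult_mono) (auto simp: power_int_minus)
        then show False using * by simp
      next
        case 2
        then have "(2::real) powi 3 \<le> 2 powi (- j)" by (intro power_int_increasing) auto
        then have "8 * (1 / 2) \<le> 2 powi (- j) * norm \<xi>" using \<xi> by (intro mult_mono) auto
        then show False using * by simp
      qed
    qed
    moreover have "((\<lambda>j::int. \<phi> ((2 powi (- j)) *\<^sub>R \<xi>)) has_sum \<Phi> \<xi>) {-2..2}"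
      unfolding \<Phi>_def by (intro has_sum_finiteI) auto
    \<comment> \<open>All other dilates vanish at \<open>\<xi>\<close>, so the sum over all integers
      is \<open>\<Phi> \<xi>\<close>; the resolution of unity gives it the value
      \<open>1\<close>.\<close>
    ultimately have "((\<lambda>j::int. \<phi> ((2 powi (- j)) *\<^sub>R \<xi>)) has_sum \<Phi> \<xi>) UNIV"
      by (subst has_sum_cong_neutral[of "{-2..2}" UNIV _ "\<lambda>j::int. \<phi> ((2 powi (- j)) *\<^sub>R \<xi>)"]) auto
    moreover have "((\<lambda>j::int. \<phi> ((2 powi (- j)) *\<^sub>R \<xi>)) has_sum 1) UNIV"
    proof -
      have "\<xi> \<noteq> 0" using \<xi>(1) by auto
      then show ?thesis using assms unfolding dyadic_resolution_def by blast
    qed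
    ultimately show ?thesis by (rule has_sum_unique)
  qed
  have rap: "rapid \<Phi>" unfolding \<Phi>_def by (intro rapid_sum rapid_dilate schwartz_rapid \<phi>) auto
  have [measurable]: "\<Phi> \<in> borel_measurable borel" by (rule rapid_measurable[OF rap])
  have cont: "continuous_on UNIV \<Phi>"
    unfolding \<Phi>_def
    by (intro continuous_on_sum continuous_on_compose2[OF schwartz_continuous[OF \<phi>]] continuous_intros) auto
  \<comment> \<open>Decay of the transform of \<open>\<Phi>\<close> is obtained termwise, from the
    dilates of \<open>fourier \<phi>\<close>.\<close>
  have "fourier \<Phi> = (\<lambda>x. \<Sum>j\<in>{-2..2::int}. complex_of_real (inverse (2 powi (- j)) ^ DIM('a)) * fourier \<phi> (inverse (2 powi (- j)) *\<^sub>R x))"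
  proof
    fix x
    have "fourier \<Phi> x = (\<integral>\<xi>. (\<Sum>j\<in>{-2..2::int}. cis (- 2 * pi * (\<xi> \<bullet> x)) * \<phi> ((2 powi (- j)) *\<^sub>R \<xi>)) \<partial>lborel)"
      unfolding fourier_def \<Phi>_def by (simp add: sum_distrib_left)
    also have "\<dots> = (\<Sum>j\<in>{-2..2::int}. fourier (\<lambda>\<xi>. \<phi> ((2 powi (- j)) *\<^sub>R \<xi>)) x)"
      unfolding fourier_def
      by (intro Bochner_Integration.integral_sum integrable_unimodular_mult rapid_integrable rapid_dilate schwartz_rapid \<phi>) auto
    also have "\<dots> = (\<Sum>j\<in>{-2..2::int}. complex_of_real (inverse (2 powi (- j)) ^ DIM('a)) * fourier \<phi> (inverse (2 powi (- j)) *\<^sub>R x))"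
      by (intro sum.cong refl, subst fourier_dilate) auto
    finally show "fourier \<Phi> x = (\<Sum>j\<in>{-2..2::int}. complex_of_real (inverse (2 powi (- j)) ^ DIM('a)) * fourier \<phi> (inverse (2 powi (- j)) *\<^sub>R x))" .
  qed
  then have F: "rapid (fourier \<Phi>)"
    by (simp only:) (intro rapid_sum rapid_cmult rapid_dilate fourier_rapid \<phi>, auto)
  show ?thesis
  proof (rule that[OF F])
    fix k :: int and f :: "'a distr" and \<psi> :: "'a \<Rightarrow> complex"
    assume \<psi>: "\<psi> \<in> schwartz"
    let ?r = "2 powi (- k) :: real"
    define \<kappa> where "\<kappa> z = (2 powi k) ^ DIM('a) * fourier \<Phi> ((2 powi k) *\<^sub>R z)" for z
    have r: "0 < ?r" "inverse ?r = 2 powi k" by (auto simp: power_int_minus)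
    have \<kappa>_eq: "fourier (\<lambda>\<xi>. \<Phi> (?r *\<^sub>R \<xi>)) = \<kappa>"
    proof
      fix x
      show "fourier (\<lambda>\<xi>. \<Phi> (?r *\<^sub>R \<xi>)) x = \<kappa> x"
        unfolding fourier_dilate[OF \<open>\<Phi> \<in> borel_measurable borel\<close> r(1)] r(2) \<kappa>_def
        by (simp add: power_int_minus)
    qed
    have \<kappa>: "rapid \<kappa>" unfolding \<kappa>_def by (intro rapid_cmult rapid_dilate F) auto
    have \<Phi>r: "rapid (\<lambda>\<xi>. \<Phi> (?r *\<^sub>R \<xi>))" by (intro rapid_dilate rap r)
    define h where "h \<xi> = \<Phi> (?r *\<^sub>R \<xi>) * inv_fourier \<psi> \<xi>" for \<xi>
    have \<psi>_int: "integrable lborel \<psi>" by (intro rapid_integrable schwartz_rapid \<psi>)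
    have Fh: "fourier h = euclidean_convolution \<kappa> \<psi>"
      unfolding h_def \<kappa>_eq[symmetric]
      by (intro fourier_mult_inv_fourier rapid_integrable \<Phi>r schwartz_rapid \<psi>)
    have conv: "euclidean_convolution \<kappa> \<psi> \<in> schwartz" by (rule schwartz_convolution[OF \<kappa> \<psi>])
    obtain C where C: "0 < C" "\<And>x. norm (\<Phi> (?r *\<^sub>R x)) \<le> C / (1 + norm x) ^ 0"
      using rapid_bound[OF \<Phi>r] by metis
    \<comment> \<open>Integrability of the transform, the delicate hypothesis of inversion, holds
      because the transform of \<open>h\<close> is the Schwartz function
      \<open>euclidean_convolution \<kappa> \<psi>\<close>.\<close>
    have "inv_fourier (fourier h) = h"
    proof (rule fourier_inversion)
      show "integrable lborel h"
        unfolding h_def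
        using borel_measurable_continuous_onI[OF inv_fourier_continuous[OF \<psi>_int]] inv_fourier_bounded[of \<psi>]
        by (intro integrable_mult_bounded[OF rapid_integrable[OF \<Phi>r]]) auto
      show "continuous_on UNIV h"
        unfolding h_def
        by (intro continuous_on_mult inv_fourier_continuous \<psi>_int continuous_on_compose2[OF cont] continuous_intros) auto
      show "norm (h x) \<le> C * (\<integral>y. norm (\<psi> y) \<partial>lborel)" for x
        unfolding h_def norm_mult using C(1) C(2)[of x] by (intro mult_mono inv_fourier_bounded) auto
      show "integrable lborel (fourier h)"
        unfolding Fh by (intro rapid_integrable schwartz_rapid conv)
    qed
    then have inv: "inv_fourier (euclidean_convolution \<kappa> \<psi>) = h" by (simp add: Fh)
    have mult_h: "(\<lambda>\<xi>. \<phi> (?r *\<^sub>R \<xi>) * h \<xi>) = (\<lambda>\<xi>. \<phi> (?r *\<^sub>R \<xi>) * inv_fourier \<psi> \<xi>)"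
      using \<Phi>1 by (force simp: h_def)
    show "dyadic_block \<phi> k f (euclidean_convolution (\<lambda>z. (2 powi k) ^ DIM('a) * fourier \<Phi> ((2 powi k) *\<^sub>R z)) \<psi>) = dyadic_block \<phi> k f \<psi>"
      unfolding \<kappa>_def[symmetric] dyadic_block_def inv_fourier_distr_def mult_distr_def inv mult_h ..
  qed
qed

section \<open>Functions representing a distribution\<close>

lemma lebesgue_borel_version:
  fixes g :: "'a::euclidean_space \<Rightarrow> complex"
  assumes "g \<in> borel_measurable lebesgue"
  obtains g' where "g' \<in> borel_measurable borel" "AE x in lebesgue. g x = g' x"
proof -
  have "(\<lambda>x. Re (g x)) \<in> borel_measurable lebesgue" "(\<lambda>x. Im (g x)) \<in> borel_measurable lebesgue"
    using assms by measurable
  then obtain u v where uv [measurable]: "u \<in> borel_measurable lborel" "v \<in> borel_measurable lborel"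
    and ae: "AE x in lborel. Re (g x) = u x" "AE x in lborel. Im (g x) = v x"
    by (metis completion_ex_borel_measurable_real)
  show ?thesis
  proof (rule that)
    show "(\<lambda>x. complex_of_real (u x) + \<i> * complex_of_real (v x)) \<in> borel_measurable borel"
      using uv by simp
    have "AE x in lborel. g x = complex_of_real (u x) + \<i> * complex_of_real (v x)"
      using ae by eventually_elim (simp add: complex_eq_iff)
    then show "AE x in lebesgue. g x = complex_of_real (u x) + \<i> * complex_of_real (v x)"
      by (rule AE_completion)
  qed
qed

lemma rearr_cong_AE:
  fixes g g' :: "'a::euclidean_space \<Rightarrow> complex"
  assumes [measurable]: "g \<in> borel_measurable lebesgue" "g' \<in> borel_measurable lebesgue"
    and ae: "AE x in lebesgue. g x = g' x"
  shows "rearr g = rearr g'"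
proof -
  have "emeasure lebesgue {x. s < ennreal (norm (g x))} = emeasure lebesgue {x. s < ennreal (norm (g' x))}" for s
  proof (rule emeasure_eq_AE)
    show "AE x in lebesgue. (x \<in> {x. s < ennreal (norm (g x))}) = (x \<in> {x. s < ennreal (norm (g' x))})"
      using ae by eventually_elim simp
    have "{x \<in> space lebesgue. s < ennreal (norm (g x))} \<in> sets lebesgue"
      "{x \<in> space lebesgue. s < ennreal (norm (g' x))} \<in> sets lebesgue"
      by measurable
    then show "{x. s < ennreal (norm (g x))} \<in> sets lebesgue" "{x. s < ennreal (norm (g' x))} \<in> sets lebesgue"
      by simp_all
  qed
  then show ?thesis unfolding rearr_def[abs_def] by simp
qed

lemma represents_borel_iff:
  fixes g :: "'a::euclidean_space \<Rightarrow> complex"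
  assumes g [measurable]: "g \<in> borel_measurable borel"
  shows "represents g T \<longleftrightarrow> (\<forall>\<psi>\<in>schwartz. integrable lborel (\<lambda>x. g x * \<psi> x) \<and> T \<psi> = (\<integral>x. g x * \<psi> x \<partial>lborel))"
proof -
  have "(\<lambda>x. g x * \<psi> x) \<in> borel_measurable lborel" if "\<psi> \<in> schwartz" for \<psi>
    using schwartz_measurable[OF that] by measurable
  moreover have "g \<in> borel_measurable lebesgue" using g by (simp add: measurable_completion)
  ultimately show ?thesis
    unfolding represents_def by (auto simp: integrable_completion integral_completion)
qed

text \<open>\<open>represents\<close> asks for Lebesgue measurability, while the Fubini arguments
  for convolutions run over Borel functions. Changing a representative on a null set alters neither
  its integrals nor its rearrangement.\<close>

lemma represents_borel_version:
  fixes g :: "'a::euclidean_space \<Rightarrow> complex"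
  assumes "represents g T"
  obtains g' where "g' \<in> borel_measurable borel" "represents g' T" "lz_norm p b A g' = lz_norm p b A g"
proof -
  have g: "g \<in> borel_measurable lebesgue" using assms by (simp add: represents_def)
  then obtain g' where g' [measurable]: "g' \<in> borel_measurable borel" and ae: "AE x in lebesgue. g x = g' x"
    by (rule lebesgue_borel_version)
  have g'l: "g' \<in> borel_measurable lebesgue" using g' by (simp add: measurable_completion)
  have "represents g' T"
    unfolding represents_def
  proof (intro conjI ballI g'l)
    fix \<psi> :: "'a \<Rightarrow> complex" assume \<psi>: "\<psi> \<in> schwartz"
    have m: "\<psi> \<in> borel_measurable lebesgue"
      using schwartz_measurable[OF \<psi>] by (simp add: measurable_completion)
    have m1: "(\<lambda>x. g x * \<psi> x) \<in> borel_measurable lebesgue" and m2: "(\<lambda>x. g' x * \<psi> x) \<in> borel_measurable lebesgue"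
      using m g g'l by (auto intro: borel_measurable_times)
    have ae': "AE x in lebesgue. g x * \<psi> x = g' x * \<psi> x" using ae by eventually_elim simp
    have I: "integrable lebesgue (\<lambda>x. g x * \<psi> x)" "T \<psi> = (\<integral>x. g x * \<psi> x \<partial>lebesgue)"
      using assms \<psi> by (auto simp: represents_def)
    show "integrable lebesgue (\<lambda>x. g' x * \<psi> x)"
      using I(1) integrable_cong_AE[OF m1 m2 ae'] by simp
    show "T \<psi> = (\<integral>x. g' x * \<psi> x \<partial>lebesgue)"
      using I(2) integral_cong_AE[OF m1 m2 ae'] by simp
  qed
  moreover have "lz_norm p b A g' = lz_norm p b A g"
    unfolding lz_norm_def rearr_cong_AE[OF g g'l ae] ..
  ultimately show ?thesis using that g' by blast
qed

text \<open>Write \<open>T \<psi>\<close> as \<open>T\<close> of the convolution, expand it against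
  \<open>g\<close>, and let Fubini move the kernel onto \<open>g\<close>, which reflects it. The
  uniform bound \<open>c\<close> and the integrability of \<open>\<psi>\<close> give absolute
  convergence of the double integral.\<close>

lemma represents_convolution:
  fixes g \<kappa> :: "'a::euclidean_space \<Rightarrow> complex"
  assumes g [measurable]: "g \<in> borel_measurable borel" and T: "represents g T"
    and \<kappa>: "rapid \<kappa>" and rep: "\<And>\<psi>. \<psi> \<in> schwartz \<Longrightarrow> T (euclidean_convolution \<kappa> \<psi>) = T \<psi>"
    and c: "c < \<infinity>" "\<And>y. (\<integral>\<^sup>+x. ennreal (norm (g x)) * ennreal (norm (\<kappa> (x - y))) \<partial>lborel) \<le> c"
  shows "represents (\<lambda>y. \<integral>x. g x * \<kappa> (x - y) \<partial>lborel) T"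
proof -
  have [measurable]: "\<kappa> \<in> borel_measurable borel" by (rule rapid_measurable[OF \<kappa>])
  show ?thesis
  proof (subst represents_borel_iff, measurable, intro ballI)
    fix \<psi> :: "'a \<Rightarrow> complex" assume \<psi>: "\<psi> \<in> schwartz"
    have [measurable]: "\<psi> \<in> borel_measurable borel" by (rule schwartz_measurable[OF \<psi>])
    have int: "integrable (lborel \<Otimes>\<^sub>M lborel) (\<lambda>(x, y). g x * \<kappa> (x - y) * \<psi> y)"
    proof (rule integrableI_bounded)
      have "(\<integral>\<^sup>+p. ennreal (norm (case p of (x, y) \<Rightarrow> g x * \<kappa> (x - y) * \<psi> y)) \<partial>(lborel \<Otimes>\<^sub>M lborel))
        = (\<integral>\<^sup>+y. (\<integral>\<^sup>+x. ennreal (norm (g x * \<kappa> (x - y) * \<psi> y)) \<partial>lborel) \<partial>lborel)"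
        by (subst lborel_pair.nn_integral_snd[symmetric]) auto
      also have "\<dots> = (\<integral>\<^sup>+y. (\<integral>\<^sup>+x. ennreal (norm (g x)) * ennreal (norm (\<kappa> (x - y))) \<partial>lborel) * ennreal (norm (\<psi> y)) \<partial>lborel)"
        by (simp add: norm_mult ennreal_mult nn_integral_multc)
      also have "\<dots> \<le> (\<integral>\<^sup>+y. c * ennreal (norm (\<psi> y)) \<partial>lborel)"
        by (intro nn_integral_mono mult_right_mono c) simp
      also have "\<dots> = c * (\<integral>\<^sup>+y. ennreal (norm (\<psi> y)) \<partial>lborel)"
        by (simp add: nn_integral_cmult)
      also have "\<dots> < \<infinity>"
        using c(1) rapid_integrable[OF schwartz_rapid[OF \<psi>]]
        by (simp add: integrable_iff_bounded ennreal_mult_less_top)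
      finally show "(\<integral>\<^sup>+p. ennreal (norm (case p of (x, y) \<Rightarrow> g x * \<kappa> (x - y) * \<psi> y)) \<partial>(lborel \<Otimes>\<^sub>M lborel)) < \<infinity>" .
    qed measurable
    have "integrable lborel (\<lambda>y. \<integral>x. g x * \<kappa> (x - y) * \<psi> y \<partial>lborel)"
      using lborel_pair.integrable_snd[OF int] by simp
    then have "integrable lborel (\<lambda>y. (\<integral>x. g x * \<kappa> (x - y) \<partial>lborel) * \<psi> y)" by simp
    moreover have "T \<psi> = (\<integral>y. (\<integral>x. g x * \<kappa> (x - y) \<partial>lborel) * \<psi> y \<partial>lborel)"
    proof -
      have "T \<psi> = (\<integral>x. g x * euclidean_convolution \<kappa> \<psi> x \<partial>lborel)"
        using T schwartz_convolution[OF \<kappa> \<psi>] rep[OF \<psi>] unfolding represents_borel_iff[OF g] by metis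
      also have "\<dots> = (\<integral>x. (\<integral>y. g x * \<kappa> (x - y) * \<psi> y \<partial>lborel) \<partial>lborel)"
      proof (rule Bochner_Integration.integral_cong[OF refl])
        fix x
        have "euclidean_convolution \<kappa> \<psi> x = (\<integral>y. \<kappa> (x - y) * \<psi> y \<partial>lborel)"
          unfolding euclidean_convolution_def
          by (subst integral_lborel_affine[where c="-1" and t=x]) auto
        then show "g x * euclidean_convolution \<kappa> \<psi> x = (\<integral>y. g x * \<kappa> (x - y) * \<psi> y \<partial>lborel)"
          by (simp add: mult.assoc)
      qed
      also have "\<dots> = (\<integral>y. (\<integral>x. g x * \<kappa> (x - y) * \<psi> y \<partial>lborel) \<partial>lborel)"
        using lborel_pair.Fubini_integral[OF int] by simp
      finally show ?thesis by simp
    qed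
    ultimately show "integrable lborel (\<lambda>y. (\<integral>x. g x * \<kappa> (x - y) \<partial>lborel) * \<psi> y) \<and>
        T \<psi> = (\<integral>y. (\<integral>x. g x * \<kappa> (x - y) \<partial>lborel) * \<psi> y \<partial>lborel)" by blast
  qed
qed

section \<open>Logarithmic weights at dyadic points\<close>

lemma powr_one_plus_dilate:
  fixes a n :: real
  assumes "0 \<le> a" "1 \<le> n"
  shows "(1 + n * a) powr \<alpha> \<le> n powr \<bar>\<alpha>\<bar> * (1 + a) powr \<alpha>"
proof (cases "0 \<le> \<alpha>")
  case True
  have "(1 + n * a) powr \<alpha> \<le> (n * (1 + a)) powr \<alpha>"
    using assms True by (intro powr_mono2) (auto simp: distrib_left)
  then show ?thesis using True assms by (simp add: powr_mult)
next
  case False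
  have "(1 + n * a) powr \<alpha> \<le> (1 + a) powr \<alpha>"
    using assms False mult_right_mono[of 1 n a] by (intro powr_mono2') auto
  also have "\<dots> \<le> n powr \<bar>\<alpha>\<bar> * (1 + a) powr \<alpha>"
    using assms ge_one_powr_ge_zero[of n "\<bar>\<alpha>\<bar>"] by simp
  finally show ?thesis .
qed

text \<open>For \<open>k \<noteq> 0\<close> the two arguments lie on opposite sides of
  \<open>1\<close>, so the entry of \<open>D\<close> read at the first is the one that
  \<open>prod.swap\<close> moves to the branch read at the second. Their logarithms differ in
  modulus by the factor \<open>n\<close>, which costs only a constant.\<close>

lemma blog_dyadic_le:
  fixes k :: int
  assumes "1 \<le> n"
  shows "blog D (2 powr - (real n * k)) \<le> real n powr (\<bar>fst D\<bar> + \<bar>snd D\<bar>) * blog (prod.swap D) (2 powi k)"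
proof -
  have ln1: "\<bar>ln (2 powr - (real n * k))\<bar> = real n * \<bar>ln (2 powi k)\<bar>"
  proof -
    have "(2::real) powi k = 2 powr k" by (simp add: powr_real_of_int')
    then show ?thesis by (simp add: ln_powr abs_mult)
  qed
  have mono: "real n powr \<bar>\<alpha>\<bar> \<le> real n powr (\<bar>fst D\<bar> + \<bar>snd D\<bar>)" if "\<alpha> = fst D \<or> \<alpha> = snd D" for \<alpha>
    using that assms by (intro powr_mono) auto
  have main: "(1 + real n * \<bar>ln (2 powi k)\<bar>) powr \<alpha> \<le> real n powr (\<bar>fst D\<bar> + \<bar>snd D\<bar>) * (1 + \<bar>ln (2 powi k :: real)\<bar>) powr \<alpha>"
    if "\<alpha> = fst D \<or> \<alpha> = snd D" for \<alpha>
  proof -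
    have "(1 + real n * \<bar>ln (2 powi k)\<bar>) powr \<alpha> \<le> real n powr \<bar>\<alpha>\<bar> * (1 + \<bar>ln (2 powi k :: real)\<bar>) powr \<alpha>"
      using assms by (intro powr_one_plus_dilate) auto
    also have "\<dots> \<le> real n powr (\<bar>fst D\<bar> + \<bar>snd D\<bar>) * (1 + \<bar>ln (2 powi k :: real)\<bar>) powr \<alpha>"
      by (intro mult_right_mono mono that) auto
    finally show ?thesis .
  qed
  consider "k > 0" | "k = 0" | "k < 0" by linarith
  then show ?thesis
  proof cases
    case 1
    then have "2 powr - (real n * k) \<le> 1" using assms powr_mono[of "- (real n * k)" 0 2] by simp
    moreover have "\<not> (2::real) powi k \<le> 1" using 1 by (simp add: not_le one_less_power_int)
    ultimately show ?thesis using main[of "fst D"] unfolding blog_def ln1 by simp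
  next
    case 2
    then show ?thesis using assms by (simp add: blog_def ge_one_powr_ge_zero)
  next
    case 3
    then have "real n * real_of_int k < 0" using assms by (intro mult_pos_neg) auto
    then have "2 powr 0 < 2 powr - (real n * k)" by (intro powr_less_mono) auto
    then have "\<not> 2 powr - (real n * k) \<le> 1" by simp
    moreover have "(2::real) powi k \<le> 1" using 3 power_int_increasing[of k 0 "2::real"] by simp
    ultimately show ?thesis using main[of "snd D"] unfolding blog_def ln1 by simp
  qed
qed

subsection \<open>The embedding\<close>

lemma powi_pow_eq_powr: "((2::real) powi k) ^ n = 2 powr (real n * k)"
proof -
  have "(2::real) powi k = 2 powr k" by (simp add: powr_real_of_int')
  then show ?thesis by (simp add: powr_powr mult.commute flip: powr_realpow)
qed

text \<open>
  Since \<^const>\<open>lz_norm_distr\<close> is an infimum over representatives, it suffices to bound the particular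
  representative \<open>K\<^sub>k * g\<close>; that it agrees with \<open>g\<close> almost everywhere is never needed.
\<close>

lemma dyadic_block_nikolskii:
  fixes \<phi> :: "'a::euclidean_space \<Rightarrow> complex"
  assumes \<phi>: "dyadic_resolution \<phi>"
    and q: "1 \<le> q" "q < \<infinity>" "0 < c" "q = 1 \<and> c = 1 \<and> B = (0, 0) \<or> 1 < q"
    and p: "0 < p" "0 < b" "q < p \<and> p < \<infinity> \<or> p = \<infinity> \<and> b = \<infinity> \<and> A = (0, 0)"
  obtains C where "0 < C"
    and "\<And>k f. lz_norm_distr p b A (dyadic_block \<phi> k f)
      \<le> ennreal (C * 2 powr (real DIM('a) * (recip q - recip p) * k) * blog (prod.swap A - prod.swap B) (2 powi k))
          * lz_norm_distr q c B (dyadic_block \<phi> k f)"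
proof -
  obtain \<kappa> where \<kappa>: "rapid \<kappa>"
    and rep: "\<And>k f \<psi>. \<psi> \<in> schwartz \<Longrightarrow>
      dyadic_block \<phi> k f (euclidean_convolution (\<lambda>z. (2 powi k) ^ DIM('a) * \<kappa> ((2 powi k) *\<^sub>R z)) \<psi>) = dyadic_block \<phi> k f \<psi>"
    using dyadic_block_reproducing[OF \<phi>] by metis
  obtain C0 where C0: "0 < C0" "\<And>x. norm (\<kappa> x) \<le> C0 / (1 + norm x) ^ 0"
    using rapid_bound[OF \<kappa>] by metis
  have [measurable]: "\<kappa> \<in> borel_measurable borel" by (rule rapid_measurable[OF \<kappa>])
  \<comment> \<open>One constant for the sup and the \<open>L\<^sub>1\<close> norm of
    \<open>\<kappa>\<close>, as the convolution bounds expect. Under the dilations below the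
    \<open>L\<^sub>1\<close> norm is unchanged and the sup norm is multiplied by
    \<open>1 / T0\<close>.\<close>
  define M where "M = max C0 (\<integral>z. norm (\<kappa> z) \<partial>lborel)"
  have M: "0 < M" "C0 \<le> M" "(\<integral>z. norm (\<kappa> z) \<partial>lborel) \<le> M" using C0 by (auto simp: M_def)
  obtain C1 where C1: "0 < C1" "\<And>(g :: 'a \<Rightarrow> complex) t. g \<in> borel_measurable borel \<Longrightarrow> 0 < t \<Longrightarrow>
      ennreal (t powr recip q * blog B t) * rearr_avg g t \<le> ennreal C1 * lz_norm q c B g"
    by (rule rearr_avg_le_lz_norm[OF q, where ?'a='a]) blast
  obtain q' where q': "q = ennreal q'" "1 \<le> q'"
    using q(1,2) by (cases q) (auto simp: ennreal_1[symmetric] simp del: ennreal_1)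
  have \<theta>: "0 < recip q" using q' by (simp add: recip_ennreal)
  have "recip p < recip q" if lt: "q < p" "p < \<infinity>"
  proof -
    obtain p' where "p = ennreal p'" "0 \<le> p'" using lt by (cases p) auto
    then show ?thesis using lt q' by (simp add: recip_ennreal ennreal_less_iff frac_less2)
  qed
  then have p': "recip p < recip q \<and> p < \<infinity> \<or> p = \<infinity> \<and> b = \<infinity> \<and> A = (0, 0)" using p(3) by blast
  obtain C2 where C2: "0 < C2" "\<And>(G :: 'a \<Rightarrow> complex) X T. G \<in> borel_measurable borel \<Longrightarrow> 0 < T \<Longrightarrow>
      (\<And>t. 0 < t \<Longrightarrow> ennreal (max t T powr recip q * blog B (max t T)) * rearr G t \<le> X) \<Longrightarrow>
      lz_norm p b A G \<le> ennreal (C2 * T powr (recip p - recip q) * blog (A - B) T) * X"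
    by (rule lz_norm_le_of_rearr_le[OF p(1,2) \<theta> p', where ?'a='a and B=B]) blast
  define N where "N = real DIM('a) powr (\<bar>fst (A - B)\<bar> + \<bar>snd (A - B)\<bar>)"
  have N: "0 < N" by (simp add: N_def)
  \<comment> \<open>\<open>C2\<close> comes from the norm of the majorant, \<open>N\<close> from
    reading the weights at \<open>2 powi k\<close> instead of \<open>T0\<close>,
    \<open>2 * M\<close> from the convolution and \<open>C1\<close> from the average.\<close>
  define C where "C = C2 * N * (2 * M * C1)"
  have C: "0 < C" using C1 C2 M N by (simp add: C_def)
  show ?thesis
  proof (rule that[OF C])
    fix k :: int and f :: "'a distr"
    let ?T = "dyadic_block \<phi> k f"
    define T0 where "T0 = 2 powr - (real DIM('a) * k)"
    have T0: "0 < T0" by (simp add: T0_def)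
    define w where "w = 2 powr (real DIM('a) * (recip q - recip p) * k) * blog (prod.swap A - prod.swap B) (2 powi k)"
    have w: "0 < w" using blog_pos[of "prod.swap A - prod.swap B" "2 powi k"] by (simp add: w_def)
    define \<kappa>k where "\<kappa>k z = (2 powi k) ^ DIM('a) * \<kappa> ((2 powi k) *\<^sub>R z)" for z
    have \<kappa>k: "rapid \<kappa>k" unfolding \<kappa>k_def by (intro rapid_cmult rapid_dilate \<kappa>) auto
    have [measurable]: "\<kappa>k \<in> borel_measurable borel" by (rule rapid_measurable[OF \<kappa>k])
    have norm_\<kappa>k: "norm (\<kappa>k z) = (2 powi k) ^ DIM('a) * norm (\<kappa> ((2 powi k) *\<^sub>R z))" for z
      by (simp add: \<kappa>k_def norm_mult norm_power norm_power_int)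
    have sup: "norm (\<kappa>k z) \<le> M / T0" for z
    proof -
      have "norm (\<kappa>k z) \<le> (2 powi k) ^ DIM('a) * M"
        unfolding norm_\<kappa>k using C0(2)[of "(2 powi k) *\<^sub>R z"] M(2) by (intro mult_left_mono) auto
      then show ?thesis by (simp add: T0_def powi_pow_eq_powr powr_minus divide_inverse mult.commute)
    qed
    have L1: "(\<integral>\<^sup>+z. ennreal (norm (\<kappa>k z)) \<partial>lborel) \<le> ennreal M"
    proof -
      have "(\<integral>\<^sup>+z. ennreal (norm (\<kappa>k z)) \<partial>lborel) = ennreal (\<integral>z. norm (\<kappa>k z) \<partial>lborel)"
        using rapid_integrable[OF \<kappa>k] by (intro nn_integral_eq_integral) auto
      also have "(\<integral>z. norm (\<kappa>k z) \<partial>lborel) = (\<integral>z. norm (\<kappa> z) \<partial>lborel)"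
        unfolding norm_\<kappa>k
        by (subst (2) integral_lborel_affine[where c="2 powi k" and t=0]) auto
      finally show ?thesis using M(3) by (simp add: ennreal_leI)
    qed
    have key: "lz_norm_distr p b A ?T \<le> ennreal (C * w) * lz_norm q c B g" if g: "represents g ?T" for g
    proof -
      obtain g' where g' [measurable]: "g' \<in> borel_measurable borel" and rep': "represents g' ?T"
        and eq: "lz_norm q c B g' = lz_norm q c B g"
        by (rule represents_borel_version[OF g])
      show ?thesis
      \<comment> \<open>With an infinite norm the right-hand side is infinite, since
        \<open>C * w\<close> is positive. A finite norm makes the average at \<open>T0\<close>
        finite, hence the convolution absolutely convergent with a uniform bound.\<close>
      proof (cases "lz_norm q c B g = \<infinity>")
        case True
        then show ?thesis using C w by (simp add: ennreal_mult_top)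
      next
        case False
        let ?G = "\<lambda>y. \<integral>x. g' x * \<kappa>k (x - y) \<partial>lborel"
        have G: "?G \<in> borel_measurable borel" by measurable
        have "rearr_avg g' T0 < \<infinity>"
        proof (rule ccontr)
          assume "\<not> ?thesis"
          then have "ennreal (T0 powr recip q * blog B T0) * rearr_avg g' T0 = \<infinity>"
            using T0 blog_pos[of B T0] by (simp add: ennreal_mult_top not_less top_unique)
          then have "ennreal C1 * lz_norm q c B g' = \<infinity>"
            using C1(2)[OF g' T0] by (simp add: top_unique)
          then show False using False by (simp add: eq ennreal_mult_eq_top_iff)
        qed
        then have fin: "ennreal (2 * M) * rearr_avg g' T0 < \<infinity>" by (simp add: ennreal_mult_less_top)
        have "represents ?G ?T"
          using M(1)
          by (intro represents_convolution[OF g' rep' \<kappa>k _ fin] convolution_sup_bound T0 sup L1)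
            (auto simp: \<kappa>k_def[abs_def] rep)
        then have "lz_norm_distr p b A ?T \<le> lz_norm p b A ?G"
          unfolding lz_norm_distr_def by (intro INF_lower) auto
        also have "\<dots> \<le> ennreal (C2 * T0 powr (recip p - recip q) * blog (A - B) T0) * (ennreal (2 * M * C1) * lz_norm q c B g')"
        proof (rule C2(2)[OF G T0])
          fix t :: real assume t: "0 < t"
          let ?m = "max t T0"
          have "ennreal (?m powr recip q * blog B ?m) * rearr ?G t
            \<le> ennreal (?m powr recip q * blog B ?m) * (ennreal (2 * M) * rearr_avg g' ?m)"
            using M(1) T0 by (intro mult_left_mono rearr_convolution_le sup L1) auto
          also have "\<dots> = ennreal (2 * M) * (ennreal (?m powr recip q * blog B ?m) * rearr_avg g' ?m)"
            by (rule mult.left_commute)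
          also have "\<dots> \<le> ennreal (2 * M) * (ennreal C1 * lz_norm q c B g')"
            using t by (intro mult_left_mono C1(2)) auto
          also have "\<dots> = ennreal (2 * M * C1) * lz_norm q c B g'"
            using M C1 by (subst ennreal_mult) (auto simp: mult.assoc)
          finally show "ennreal (?m powr recip q * blog B ?m) * rearr ?G t \<le> ennreal (2 * M * C1) * lz_norm q c B g'" .
        qed
        also have "\<dots> = ennreal ((C2 * T0 powr (recip p - recip q) * blog (A - B) T0) * (2 * M * C1)) * lz_norm q c B g"
          using C2 M C1 blog_pos[of "A - B" T0] by (subst ennreal_mult) (auto simp: mult.assoc eq less_imp_le)
        also have "\<dots> \<le> ennreal (C * w) * lz_norm q c B g"
        proof (intro mult_right_mono ennreal_leI)
          have "T0 powr (recip p - recip q) = 2 powr (real DIM('a) * (recip q - recip p) * k)"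
            by (simp add: T0_def powr_powr algebra_simps)
          moreover have "blog (A - B) T0 \<le> N * blog (prod.swap A - prod.swap B) (2 powi k)"
          proof -
            have "prod.swap (A - B) = prod.swap A - prod.swap B" by (simp add: prod_eq_iff)
            then show ?thesis using blog_dyadic_le[of "DIM('a)" "A - B" k] by (simp add: T0_def N_def)
          qed
          ultimately have "C2 * T0 powr (recip p - recip q) * blog (A - B) T0 \<le> C2 * N * w"
            using C2(1) by (simp add: w_def mult.assoc mult.left_commute[of N] mult_left_mono)
          then have "C2 * T0 powr (recip p - recip q) * blog (A - B) T0 * (2 * M * C1) \<le> C2 * N * w * (2 * M * C1)"
            using M C1 by (intro mult_right_mono) auto
          then show "C2 * T0 powr (recip p - recip q) * blog (A - B) T0 * (2 * M * C1) \<le> C * w"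
            by (simp add: C_def mult_ac)
        qed simp
        finally show ?thesis .
      qed
    qed
    \<comment> \<open>The factor is divided out so that the bound for single representatives becomes
      a lower bound of the infimum. This includes the empty infimum \<open>\<infinity>\<close>, the
      value for a block not given by a function.\<close>
    have Cw: "0 < C * w" using C w by simp
    have inv: "ennreal (inverse (C * w)) * ennreal (C * w) = 1"
    proof -
      have "inverse (C * w) * (C * w) = 1" by (rule left_inverse) (use Cw in linarith)
      then show ?thesis using Cw by (metis ennreal_1 ennreal_mult inverse_nonnegative_iff_nonnegative less_imp_le)
    qed
    have "ennreal (inverse (C * w)) * lz_norm_distr p b A ?T \<le> lz_norm_distr q c B ?T"
      unfolding lz_norm_distr_def[of q]
    proof (rule INF_greatest)
      fix g assume "g \<in> {g. represents g ?T}"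
      then have "ennreal (inverse (C * w)) * lz_norm_distr p b A ?T \<le> ennreal (inverse (C * w)) * (ennreal (C * w) * lz_norm q c B g)"
        by (intro mult_left_mono key) auto
      then show "ennreal (inverse (C * w)) * lz_norm_distr p b A ?T \<le> lz_norm q c B g"
        by (simp only: mult.assoc[symmetric] inv mult_1_left)
    qed
    then have "ennreal (C * w) * (ennreal (inverse (C * w)) * lz_norm_distr p b A ?T) \<le> ennreal (C * w) * lz_norm_distr q c B ?T"
      by (intro mult_left_mono) auto
    then have "lz_norm_distr p b A ?T \<le> ennreal (C * w) * lz_norm_distr q c B ?T"
      by (simp only: mult.assoc[symmetric] inv[unfolded mult.commute[of "ennreal (inverse (C * w))"]] mult_1_left)
    then show "lz_norm_distr p b A ?T
      \<le> ennreal (C * 2 powr (real DIM('a) * (recip q - recip p) * k) * blog (prod.swap A - prod.swap B) (2 powi k))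
          * lz_norm_distr q c B ?T"
      by (simp add: w_def mult.assoc)
  qed
qed

text \<open>The expression is monotone in its terms and homogeneous, so a termwise bound passes
  through with the same constant for every \<open>u\<close>. For finite \<open>u\<close> the
  infinite sum is the supremum of its finite partial sums.\<close>

lemma besov_norm_le:
  assumes "0 < u" "0 < C"
    and le: "\<And>k. ennreal (2 powr (\<sigma>2 * of_int k) * blog \<Gamma>2 (2 powi k)) * lz_norm_distr p2 b2 A2 (dyadic_block \<phi> k f)
      \<le> ennreal C * (ennreal (2 powr (\<sigma>1 * of_int k) * blog \<Gamma>1 (2 powi k)) * lz_norm_distr p1 b1 A1 (dyadic_block \<phi> k f))"
  shows "besov_norm \<phi> \<sigma>2 \<Gamma>2 p2 b2 A2 u f \<le> ennreal C * besov_norm \<phi> \<sigma>1 \<Gamma>1 p1 b1 A1 u f"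
proof -
  define a2 where "a2 k = ennreal (2 powr (\<sigma>2 * of_int k) * blog \<Gamma>2 (2 powi k)) * lz_norm_distr p2 b2 A2 (dyadic_block \<phi> k f)" for k :: int
  define a1 where "a1 k = ennreal (2 powr (\<sigma>1 * of_int k) * blog \<Gamma>1 (2 powi k)) * lz_norm_distr p1 b1 A1 (dyadic_block \<phi> k f)" for k :: int
  have le': "a2 k \<le> ennreal C * a1 k" for k using le by (simp add: a1_def a2_def)
  show ?thesis
  proof (cases "u = \<infinity>")
    case True
    have "(SUP k. a2 k) \<le> ennreal C * (SUP k. a1 k)"
      by (intro SUP_least order_trans[OF le'] mult_left_mono SUP_upper) auto
    then show ?thesis using True by (simp add: besov_norm_def Let_def a1_def a2_def)
  next
    case False
    then obtain r where r: "u = ennreal r" "0 < r" using assms(1) by (cases u) auto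
    have "(\<Sum>\<^sub>\<infinity>k. epowr (a2 k) r) \<le> ennreal (C powr r) * (\<Sum>\<^sub>\<infinity>k. epowr (a1 k) r)"
      unfolding nonneg_infsum_complete[of UNIV "\<lambda>k. epowr (a2 k) r", simplified]
    proof (rule SUP_least)
      fix F :: "int set" assume F: "F \<in> {F. finite F}"
      have "(\<Sum>k\<in>F. epowr (a2 k) r) \<le> (\<Sum>k\<in>F. ennreal (C powr r) * epowr (a1 k) r)"
      proof (rule sum_mono)
        fix k
        show "epowr (a2 k) r \<le> ennreal (C powr r) * epowr (a1 k) r"
          using epowr_mono[OF le'[of k], of r] r by (simp add: epowr_cmult[OF assms(2)])
      qed
      also have "\<dots> = ennreal (C powr r) * (\<Sum>k\<in>F. epowr (a1 k) r)" by (simp add: sum_distrib_left)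
      also have "\<dots> \<le> ennreal (C powr r) * (\<Sum>\<^sub>\<infinity>k. epowr (a1 k) r)"
        using F unfolding nonneg_infsum_complete[of UNIV "\<lambda>k. epowr (a1 k) r", simplified]
        by (intro mult_left_mono SUP_upper) auto
      finally show "(\<Sum>k\<in>F. epowr (a2 k) r) \<le> ennreal (C powr r) * (\<Sum>\<^sub>\<infinity>k. epowr (a1 k) r)" .
    qed
    then have "epowr (\<Sum>\<^sub>\<infinity>k. epowr (a2 k) r) (1 / r) \<le> epowr (ennreal (C powr r) * (\<Sum>\<^sub>\<infinity>k. epowr (a1 k) r)) (1 / r)"
      using r by (intro epowr_mono) auto
    also have "\<dots> = ennreal C * epowr (\<Sum>\<^sub>\<infinity>k. epowr (a1 k) r) (1 / r)"
      using r assms(2) by (simp add: epowr_cmult powr_powr)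
    finally show ?thesis using r by (simp add: besov_norm_def Let_def a1_def a2_def recip_ennreal)
  qed
qed

text \<open>Apart from a constant, the block estimate costs a power of \<open>2 powi k\<close> and a
  logarithmic weight at \<open>2 powi k\<close>. These are exactly the factors by which the
  smoothness parameters of the source exceed those of the target.\<close>

lemma besov_embedding_nikolskii:
  fixes \<phi> :: "'a::euclidean_space \<Rightarrow> complex"
  assumes \<phi>: "dyadic_resolution \<phi>" and u: "0 < u"
    and q: "1 \<le> q" "q < \<infinity>" "0 < c" "q = 1 \<and> c = 1 \<and> B = (0, 0) \<or> 1 < q"
    and p: "0 < p" "0 < b" "q < p \<and> p < \<infinity> \<or> p = \<infinity> \<and> b = \<infinity> \<and> A = (0, 0)"
  shows "besov_embedding \<phi>
    (\<sigma> + real DIM('a) * (recip q - recip p)) (\<Gamma> + (prod.swap A - prod.swap B)) q c B u \<sigma> \<Gamma> p b A u"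
proof -
  obtain C where C: "0 < C" and block: "\<And>k f. lz_norm_distr p b A (dyadic_block \<phi> k f)
      \<le> ennreal (C * 2 powr (real DIM('a) * (recip q - recip p) * k) * blog (prod.swap A - prod.swap B) (2 powi k))
          * lz_norm_distr q c B (dyadic_block \<phi> k f)"
    using dyadic_block_nikolskii[OF \<phi> q p] by metis
  let ?\<sigma> = "\<sigma> + real DIM('a) * (recip q - recip p)" and ?\<Gamma> = "\<Gamma> + (prod.swap A - prod.swap B)"
  have le: "besov_norm \<phi> \<sigma> \<Gamma> p b A u f \<le> ennreal C * besov_norm \<phi> ?\<sigma> ?\<Gamma> q c B u f" for f
  proof (rule besov_norm_le[OF u C])
    fix k :: int
    let ?D = "prod.swap A - prod.swap B" and ?s = "real DIM('a) * (recip q - recip p)"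
    have pos: "0 < blog \<Gamma> (2 powi k)" "0 < blog ?D (2 powi k)" by (rule blog_pos)+
    have "ennreal (2 powr (\<sigma> * of_int k) * blog \<Gamma> (2 powi k)) * lz_norm_distr p b A (dyadic_block \<phi> k f)
      \<le> ennreal (2 powr (\<sigma> * of_int k) * blog \<Gamma> (2 powi k)) *
        (ennreal (C * 2 powr (?s * k) * blog ?D (2 powi k)) * lz_norm_distr q c B (dyadic_block \<phi> k f))"
      by (intro mult_left_mono block) simp
    also have "\<dots> = ennreal ((2 powr (\<sigma> * of_int k) * blog \<Gamma> (2 powi k)) * (C * 2 powr (?s * k) * blog ?D (2 powi k)))
        * lz_norm_distr q c B (dyadic_block \<phi> k f)"
      using pos C by (subst (3) ennreal_mult) (auto simp: mult.assoc)
    also have "(2 powr (\<sigma> * of_int k) * blog \<Gamma> (2 powi k)) * (C * 2 powr (?s * k) * blog ?D (2 powi k))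
        = C * (2 powr (?\<sigma> * of_int k) * blog ?\<Gamma> (2 powi k))"
      unfolding blog_add distrib_right[of \<sigma>] powr_add by (simp only: mult_ac)
    also have "ennreal \<dots> = ennreal C * ennreal (2 powr (?\<sigma> * of_int k) * blog ?\<Gamma> (2 powi k))"
      using C blog_pos[of ?\<Gamma> "2 powi k"] by (intro ennreal_mult) auto
    finally show "ennreal (2 powr (\<sigma> * of_int k) * blog \<Gamma> (2 powi k)) * lz_norm_distr p b A (dyadic_block \<phi> k f)
      \<le> ennreal C * (ennreal (2 powr (?\<sigma> * of_int k) * blog ?\<Gamma> (2 powi k)) * lz_norm_distr q c B (dyadic_block \<phi> k f))"
      by (simp only: mult.assoc)
  qed
  have "besov_norm \<phi> \<sigma> \<Gamma> p b A u f < \<infinity>" if "besov_norm \<phi> ?\<sigma> ?\<Gamma> q c B u f < \<infinity>" for f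
    by (rule le_less_trans[OF le]) (use that in \<open>simp add: ennreal_mult_less_top\<close>)
  with le show ?thesis
    unfolding besov_embedding_def besov_space_def by blast
qed

theorem corollary19:
  fixes \<phi> :: "real ^ 'n \<Rightarrow> complex"
    and \<sigma> :: real and \<Gamma> :: "real \<times> real" and u :: ennreal
  assumes "dyadic_resolution \<phi>" and "0 < u"
  shows "(\<forall>(q::ennreal) (c::ennreal) (B::real \<times> real) (p::ennreal) (b::ennreal) (A::real \<times> real).
            1 \<le> q \<and> q < \<infinity> \<and> 0 < c \<and>
            (q = 1 \<and> c = 1 \<and> B = (0, 0) \<or> 1 < q) \<and>
            0 < p \<and> 0 < b \<and>
            (q < p \<and> p < \<infinity> \<or> p = \<infinity> \<and> b = \<infinity> \<and> A = (0, 0)) \<longrightarrow>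
            besov_embedding \<phi>
              (\<sigma> + real CARD('n) * (recip q - recip p)) (\<Gamma> + (prod.swap A - prod.swap B)) q c B u
              \<sigma> \<Gamma> p b A u)
       \<and> (\<forall>(q::ennreal) (p::ennreal). 1 \<le> q \<and> q < p \<longrightarrow>
            besov_embedding \<phi>
              (\<sigma> + real CARD('n) * (recip q - recip p)) \<Gamma> q q (0, 0) u
              \<sigma> \<Gamma> p p (0, 0) u)"
proof -
  have main: "besov_embedding \<phi>
      (\<sigma> + real CARD('n) * (recip q - recip p)) (\<Gamma> + (prod.swap A - prod.swap B)) q c B u \<sigma> \<Gamma> p b A u"
    if "1 \<le> q" "q < \<infinity>" "0 < c" "q = 1 \<and> c = 1 \<and> B = (0, 0) \<or> 1 < q"
      "0 < p" "0 < b" "q < p \<and> p < \<infinity> \<or> p = \<infinity> \<and> b = \<infinity> \<and> A = (0, 0)"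
    for q c p b :: ennreal and A B :: "real \<times> real"
    using besov_embedding_nikolskii[OF assms that] by simp
  have "besov_embedding \<phi> (\<sigma> + real CARD('n) * (recip q - recip p)) \<Gamma> q q (0, 0) u \<sigma> \<Gamma> p p (0, 0) u"
    if "1 \<le> q" "q < p" for q p :: ennreal
  proof -
    have "0 < q" using that(1) zero_less_one less_le_trans by blast
    then have "besov_embedding \<phi> (\<sigma> + real CARD('n) * (recip q - recip p)) (\<Gamma> + (prod.swap (0, 0) - prod.swap (0, 0)))
        q q (0, 0) u \<sigma> \<Gamma> p p (0, 0) u"
      \<comment> \<open>With \<open>c = q\<close>, \<open>b = p\<close> and zero pairs, the cases
        \<open>q = 1\<close> and \<open>p = \<infinity>\<close> satisfy the endpoint alternatives,
        and \<open>q < p\<close> makes \<open>q\<close> finite.\<close>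
      using that by (intro main) (auto simp: less_top top.not_eq_extremum intro: less_trans less_le_trans)
    moreover have "\<Gamma> + (prod.swap (0, 0) - prod.swap (0, 0)) = \<Gamma>"
      by (cases \<Gamma>) (simp add: plus_prod_def minus_prod_def)
    ultimately show ?thesis by simp
  qed
  with main show ?thesis by blast
qed

end
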